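(* Let $n\in\mathbb N$. The map $M$ is well-defined on $\mathcal D^n$: for every $f\in\mathcal D^n$ the limit $Mf=\lim_{t\to\infty}R_tW_tR_t(f|_{[0,t]})$ exists uniformly on compact sets and $Mf\in\mathcal D^n$. Moreover: (i) (Isometry) For every $f\in\mathcal D^n$ and all $0\le x\le y$, with $p=(x,n)$ and $q=(y,1)$, we have $f[p\to q]=Mf[p\to q]$. (ii) (Idempotent property) $M\circ M=M$. (iii) (Image) $\operatorname{Im}M=\mathcal D^n_\downarrow$. (iv) (Bijection) $M$ restricts to a bijection from $\mathcal D^n_\uparrow$ onto $\mathcal D^n_\downarrow$, with inverse (the restriction to $\mathcal D^n_\downarrow$ of) $W$.
   Context: $\mathcal D^n$ is the set of $f=(f_1,\dots,f_n)$ where each $f_i:[0,\infty)\to\mathbb R$ is cadlag (right-continuous with left limits), has no negative jumps ($f_i(x)\ge f_i(x^-)$ for all $x$), and $f_i(0)\ge 0$; by convention $f_i(0^-)=0$. $\mathcal D^n_t$ is the analogous set of $n$-tuples of functions on $[0,t]$. Each $f$ defines a finitely additive signed measure $df$ by $df([x,y]\times\{i\})=f_i(y)-f_i(x^-)$. Paths. For $p=(x,\ell)$, $q=(y,m)$ with $0\le x\le y$ and $n\ge\ell\ge m\ge1$, a path from $p$ to $q$ is a set $\pi=\bigcup_{i=m}^{\ell}[t_i,t_{i-1}]\times\{i\}$ with $x=t_\ell\le t_{\ell-1}\le\dots\le t_m\le t_{m-1}=y$. Two paths are essentially disjoint if their intersection is finite. Put $f[p\to q]=\sup_\pi df(\pi)$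 over paths $\pi$ from $p$ to $q$, and $f[p^k\to q^k]=\sup df(\pi_1\cup\dots\cup\pi_k)$ over $k$-tuples of pairwise essentially disjoint paths from $p$ to $q$, with $f[p^0\to q^0]=0$. Melon map. For $k=1,\dots,n$, $Wf_k(y)=f[(0,n)^k\to(y,1)^k]-f[(0,n)^{k-1}\to(y,1)^{k-1}]$, giving $W:\mathcal D^n\to\mathcal D^n$; the same formula for $y\in[0,t]$ defines $W_t:\mathcal D^n_t\to\mathcal D^n_t$. Rotation. $R_t:\mathcal D^n_t\to\mathcal D^n_t$ rotates the measure $df$ by 180 degrees: $(R_tf)_i(x)=f_{n+1-i}(t)-f_{n+1-i}((t-x)^-)$ for $x\in[0,t]$. $\mathcal D^n_\uparrow$ is the set of $f\in\mathcal D^n$ with $f_{i-1}(y^-)\ge f_i(y)$ for all $i\in\{2,\dots,n\}$, $y\ge0$. The set $\mathcal D^n_\downarrow$. A path $\pi$ is to the left of a path $\rho$ if for all $(x,\ell)\in\pi$, $(y,m)\in\rho$ we have $\ell\le m$ or $x\le y$. For $1\le k\le n$, a $k$-disjoint optimizer from $(0,n)$ to $(t,1)$ is a $k$-tuple $(\pi_1,\dots,\pi_k)$ of pairwise essentially disjoint paths from $(0,n)$ to $(t,1)$, with $\pi_i$ to the left of $\pi_j$ for $i<j$, attaining $f[(0,n)^k\to(t,1)^k]$. $\mathcal D^n_{\downarrow-}$ is the set of $f\in\mathcal D^n$ such that for every $k\in\{1,\dots,n\}$ there are times $t_m\to\infty$ and $k$-disjoint optimizers $(\pi^m_1,\dots,\pi^m_k)$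 from $(0,n)$ to $(t_m,1)$ converging locally to the $k$ lowest constant paths, i.e. for every $T>0$, for all sufficiently large $m$, $[0,T]\times\{n-k+i\}\subset\pi^m_i$ for all $i=1,\dots,k$. $\mathcal D^n_\downarrow$ is the closure of $\mathcal D^n_{\downarrow-}$ in $\mathcal D^n$ in the topology of uniform convergence on $[0,\infty)\times\{1,\dots,n\}$. *)

theory Defs
  imports "HOL-Analysis.Analysis"
begin

(* Functions on [0, infinity) x {1..n} (or on [0,t] x {1..n}) are represented by maps
   nat => real => real that vanish outside this domain, so that equality of maps is equality
   on the domain. In particular, vanishing on the negative half-line encodes f_i(0^-) = 0. *)

definition left_lim :: "(real \<Rightarrow> real) \<Rightarrow> real \<Rightarrow> real" where
  "left_lim g x = Lim (at_left x) g"

definition cadlag :: "(real \<Rightarrow> real) \<Rightarrow> bool" where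
  "cadlag g \<longleftrightarrow> (\<forall>x\<ge>0. continuous (at_right x) g \<and> (\<exists>l. (g \<longlongrightarrow> l) (at_left x)))"

definition Dn :: "nat \<Rightarrow> (nat \<Rightarrow> real \<Rightarrow> real) set" where
  "Dn n = {f. (\<forall>i\<in>{1..n}. cadlag (f i) \<and> (\<forall>x\<ge>0. left_lim (f i) x \<le> f i x) \<and> 0 \<le> f i 0) \<and>
              (\<forall>i x. i \<notin> {1..n} \<or> x < 0 \<longrightarrow> f i x = 0)}"

definition Dn_up :: "nat \<Rightarrow> (nat \<Rightarrow> real \<Rightarrow> real) set" where
  "Dn_up n = {f \<in> Dn n. \<forall>i\<in>{2..n}. \<forall>y\<ge>0. f i y \<le> left_lim (f (i - 1)) y}"

(* The finitely additive signed measure df on finite unions of sets [x,y] x {i}: such a union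
   meets each line in finitely many disjoint compact intervals (its connected components),
   and an interval [x,y] x {i} has measure f_i(y) - f_i(x^-). See dmeas_interval and
   dmeas_additive below; on sets that are not such finite unions the value is irrelevant. *)
definition dmeas :: "(nat \<Rightarrow> real \<Rightarrow> real) \<Rightarrow> (real \<times> nat) set \<Rightarrow> real" where
  "dmeas f A = (\<Sum>i\<in>snd ` A. \<Sum>C\<in>components {x. (x, i) \<in> A}. f i (Sup C) - left_lim (f i) (Inf C))"

lemma dmeas_interval:
  assumes "x \<le> y"
  shows "dmeas f ({x..y} \<times> {i}) = f i y - left_lim (f i) x"
proof -
  have "snd ` ({x..y} \<times> {i}) = {i}" "{z. (z, i) \<in> {x..y} \<times> {i}} = {x..y}"
    using assms by force+
  moreover have "components {x..y} = {{x..y}}"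
    using assms by (simp add: components_eq_sing_iff)
  ultimately show ?thesis
    using assms by (simp add: dmeas_def)
qed

lemma components_Un_disjoint_closed:
  fixes A B :: "real set"
  assumes "closed A" "closed B" "A \<inter> B = {}"
  shows "components (A \<union> B) = components A \<union> components B"
proof -
  have sub: "C \<subseteq> A \<or> C \<subseteq> B" if "connected C" "C \<subseteq> A \<union> B" for C
    using that assms unfolding connected_closed by blast
  have 1: "C \<in> components A" if "C \<in> components (A \<union> B)" "C \<subseteq> A" for A B and C :: "real set"
    using that unfolding in_components_maximal by blast
  have 2: "C \<in> components (A \<union> B)"
    if sub: "\<And>C. connected C \<Longrightarrow> C \<subseteq> A \<union> B \<Longrightarrow> C \<subseteq> A \<or> C \<subseteq> B"
      and "A \<inter> B = {}" "C \<in> components A" for A B and C :: "real set"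
    unfolding in_components_maximal
  proof (intro conjI allI impI)
    show "C \<noteq> {}" "C \<subseteq> A \<union> B" "connected C"
      using that(3) in_components_nonempty in_components_subset in_components_connected by blast+
    fix D assume D: "D \<noteq> {} \<and> C \<subseteq> D \<and> D \<subseteq> A \<union> B \<and> connected D"
    have "D \<subseteq> A"
      using sub[of D] D that(2) in_components_nonempty[OF that(3)] in_components_subset[OF that(3)] by blast
    then show "D = C"
      using that(3) D unfolding in_components_maximal by blast
  qed
  show ?thesis
  proof (intro equalityI subsetI)
    fix C assume C: "C \<in> components (A \<union> B)"
    then have "C \<subseteq> A \<or> C \<subseteq> B"
      by (meson sub in_components_connected in_components_subset)
    then show "C \<in> components A \<union> components B"
      using 1[of C A B] 1[of C B A] C by (auto simp: Un_commute)
  next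
    fix C assume "C \<in> components A \<union> components B"
    then show "C \<in> components (A \<union> B)"
    proof
      assume "C \<in> components A"
      then show ?thesis using 2[of A B C] sub assms(3) by blast
    next
      assume "C \<in> components B"
      then have "C \<in> components (B \<union> A)" using 2[of B A C] sub assms(3) by blast
      then show ?thesis by (simp add: Un_commute)
    qed
  qed
qed

lemma dmeas_additive:
  assumes A: "A = (\<Union>(x, y, i)\<in>I. {x..y} \<times> {i})" "finite I"
    and B: "B = (\<Union>(x, y, i)\<in>J. {x..y} \<times> {i})" "finite J"
    and disj: "A \<inter> B = {}"
  shows "dmeas f (A \<union> B) = dmeas f A + dmeas f B"
proof -
  define s where "s = (\<lambda>(S :: (real \<times> nat) set) i. {x. (x, i) \<in> S})"
  define v where
    "v = (\<lambda>i S. \<Sum>C\<in>components S. f i (Sup C) - left_lim (f i) (Inf C))"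
  have elem: "closed (s S i) \<and> finite (components (s S i)) \<and> finite (snd ` S)"
    if S: "S = (\<Union>(x, y, i)\<in>K. {x..y} \<times> {i})" "finite K" for S K i
  proof -
    define L where "L = (\<lambda>(x, y, j). {x..y::real}) ` {k\<in>K. snd (snd k) = i}"
    have "finite L" "\<And>l. l \<in> L \<Longrightarrow> closed l \<and> connected l"
      using S(2) by (auto simp: L_def)
    moreover have "s S i = \<Union>L"
      unfolding L_def s_def S(1) by (fastforce simp: case_prod_unfold)
    ultimately have L: "finite L" "s S i = \<Union>L" "\<And>l. l \<in> L \<Longrightarrow> closed l \<and> connected l"
      by blast+
    have "components (\<Union>L) \<subseteq> (\<lambda>l. THE C. C \<in> components (\<Union>L) \<and> l \<subseteq> C) ` {l\<in>L. l \<noteq> {}}"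
    proof
      fix C assume C: "C \<in> components (\<Union>L)"
      then obtain x l where l: "x \<in> C" "x \<in> l" "l \<in> L"
        using in_components_nonempty in_components_subset by (metis UnionE all_not_in_conv subsetD)
      then have lC: "l \<subseteq> C" using components_maximal[OF C, of l] L(3) by blast
      have "(THE C. C \<in> components (\<Union>L) \<and> l \<subseteq> C) = C"
        using C lC l components_eq by (intro the_equality) blast+
      then show "C \<in> (\<lambda>l. THE C. C \<in> components (\<Union>L) \<and> l \<subseteq> C) ` {l\<in>L. l \<noteq> {}}"
        using l by (metis (mono_tags, lifting) empty_iff image_eqI mem_Collect_eq)
    qed
    then have "finite (components (\<Union>L))"
      using L(1) finite_subset by fastforce
    moreover have "closed (\<Union>L)" using L by (intro closed_Union) auto
    moreover have "snd ` S \<subseteq> (snd \<circ> snd) ` K"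
      unfolding S(1) by force
    then have "finite (snd ` S)" using S(2) finite_subset by blast
    ultimately show ?thesis using L(2) by simp
  qed
  have dm: "dmeas f S = (\<Sum>i\<in>N. v i (s S i))" if "snd ` S \<subseteq> N" "finite N" for S N
    unfolding dmeas_def v_def s_def
  proof (rule sum.mono_neutral_left)
    have "{x. (x, i) \<in> S} = {}" if "i \<notin> snd ` S" for i using that by force
    then show "\<forall>i\<in>N - snd ` S. (\<Sum>C\<in>components {x. (x, i) \<in> S}. f i (Sup C) - left_lim (f i) (Inf C)) = 0"
      by simp
  qed (use that in auto)
  have v: "v i (s (A \<union> B) i) = v i (s A i) + v i (s B i)" for i
  proof -
    have "s (A \<union> B) i = s A i \<union> s B i" "s A i \<inter> s B i = {}"
      using disj by (auto simp: s_def)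
    moreover have "components (s A i) \<inter> components (s B i) = {}"
      using \<open>s A i \<inter> s B i = {}\<close> in_components_nonempty in_components_subset by blast
    ultimately show ?thesis
      using components_Un_disjoint_closed[of "s A i" "s B i"] elem[OF A] elem[OF B]
      by (simp add: v_def sum.union_disjoint)
  qed
  let ?N = "snd ` (A \<union> B)"
  have "finite ?N" using elem[OF A] elem[OF B] by (simp add: image_Un)
  then show ?thesis
    using dm[of _ ?N] v by (simp add: image_Un sum.distrib)
qed

definition is_path :: "real \<times> nat \<Rightarrow> real \<times> nat \<Rightarrow> (real \<times> nat) set \<Rightarrow> bool" where
  "is_path p q \<pi> \<longleftrightarrow> (case (p, q) of ((x, l), (y, m)) \<Rightarrow>
     0 \<le> x \<and> x \<le> y \<and> 1 \<le> m \<and> m \<le> l \<and>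
     (\<exists>t :: nat \<Rightarrow> real. t l = x \<and> t (m - 1) = y \<and> (\<forall>i\<in>{m..l}. t i \<le> t (i - 1)) \<and>
        \<pi> = (\<Union>i\<in>{m..l}. {t i..t (i - 1)} \<times> {i})))"

definition ess_disjoint :: "(real \<times> nat) set \<Rightarrow> (real \<times> nat) set \<Rightarrow> bool" where
  "ess_disjoint \<pi> \<rho> \<longleftrightarrow> finite (\<pi> \<inter> \<rho>)"

definition disjoint_paths ::
    "nat \<Rightarrow> real \<times> nat \<Rightarrow> real \<times> nat \<Rightarrow> (nat \<Rightarrow> (real \<times> nat) set) \<Rightarrow> bool" where
  "disjoint_paths k p q \<pi> \<longleftrightarrow> (\<forall>i\<in>{1..k}. is_path p q (\<pi> i)) \<and>
     (\<forall>i\<in>{1..k}. \<forall>j\<in>{1..k}. i \<noteq> j \<longrightarrow> ess_disjoint (\<pi> i) (\<pi> j))"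

definition lpp :: "(nat \<Rightarrow> real \<Rightarrow> real) \<Rightarrow> real \<times> nat \<Rightarrow> real \<times> nat \<Rightarrow> real" where
  "lpp f p q = (SUP \<pi>\<in>{\<pi>. is_path p q \<pi>}. dmeas f \<pi>)"

definition multi_lpp :: "(nat \<Rightarrow> real \<Rightarrow> real) \<Rightarrow> nat \<Rightarrow> real \<times> nat \<Rightarrow> real \<times> nat \<Rightarrow> real" where
  "multi_lpp f k p q =
     (if k = 0 then 0 else SUP \<pi>\<in>{\<pi>. disjoint_paths k p q \<pi>}. dmeas f (\<Union>i\<in>{1..k}. \<pi> i))"

definition W :: "nat \<Rightarrow> (nat \<Rightarrow> real \<Rightarrow> real) \<Rightarrow> nat \<Rightarrow> real \<Rightarrow> real" where
  "W n f = (\<lambda>k y. if k \<in> {1..n} \<and> 0 \<le> y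
     then multi_lpp f k (0, n) (y, 1) - multi_lpp f (k - 1) (0, n) (y, 1) else 0)"

definition restr :: "real \<Rightarrow> (nat \<Rightarrow> real \<Rightarrow> real) \<Rightarrow> nat \<Rightarrow> real \<Rightarrow> real" where
  "restr t f = (\<lambda>i x. if x \<in> {0..t} then f i x else 0)"

(* W_t is given by the same formula as W, which at y only involves f on [0,y]. *)
definition Wt :: "nat \<Rightarrow> real \<Rightarrow> (nat \<Rightarrow> real \<Rightarrow> real) \<Rightarrow> nat \<Rightarrow> real \<Rightarrow> real" where
  "Wt n t f = restr t (W n f)"

definition Rt :: "nat \<Rightarrow> real \<Rightarrow> (nat \<Rightarrow> real \<Rightarrow> real) \<Rightarrow> nat \<Rightarrow> real \<Rightarrow> real" where
  "Rt n t f = (\<lambda>i x. if i \<in> {1..n} \<and> x \<in> {0..t}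
     then f (n + 1 - i) t - left_lim (f (n + 1 - i)) (t - x) else 0)"

definition M_approx :: "nat \<Rightarrow> (nat \<Rightarrow> real \<Rightarrow> real) \<Rightarrow> real \<Rightarrow> nat \<Rightarrow> real \<Rightarrow> real" where
  "M_approx n f t = Rt n t (Wt n t (Rt n t (restr t f)))"

(* The pointwise limit; that it exists, locally uniformly, is part of the theorem. *)
definition M :: "nat \<Rightarrow> (nat \<Rightarrow> real \<Rightarrow> real) \<Rightarrow> nat \<Rightarrow> real \<Rightarrow> real" where
  "M n f = (\<lambda>i x. if i \<in> {1..n} \<and> 0 \<le> x then Lim at_top (\<lambda>t. M_approx n f t i x) else 0)"

definition left_of :: "(real \<times> nat) set \<Rightarrow> (real \<times> nat) set \<Rightarrow> bool" where
  "left_of \<pi> \<rho> \<longleftrightarrow> (\<forall>(x, l)\<in>\<pi>. \<forall>(y, m)\<in>\<rho>. l \<le> m \<or> x \<le> y)"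

definition optimizer ::
    "nat \<Rightarrow> (nat \<Rightarrow> real \<Rightarrow> real) \<Rightarrow> nat \<Rightarrow> real \<Rightarrow> (nat \<Rightarrow> (real \<times> nat) set) \<Rightarrow> bool" where
  "optimizer n f k t \<pi> \<longleftrightarrow> disjoint_paths k (0, n) (t, 1) \<pi> \<and>
     (\<forall>i\<in>{1..k}. \<forall>j\<in>{1..k}. i < j \<longrightarrow> left_of (\<pi> i) (\<pi> j)) \<and>
     dmeas f (\<Union>i\<in>{1..k}. \<pi> i) = multi_lpp f k (0, n) (t, 1)"

definition Dn_down_minus :: "nat \<Rightarrow> (nat \<Rightarrow> real \<Rightarrow> real) set" where
  "Dn_down_minus n = {f \<in> Dn n. \<forall>k\<in>{1..n}.
     \<exists>(t :: nat \<Rightarrow> real) (\<pi> :: nat \<Rightarrow> nat \<Rightarrow> (real \<times> nat) set).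
       filterlim t at_top sequentially \<and> (\<forall>m. optimizer n f k (t m) (\<pi> m)) \<and>
       (\<forall>T>0. \<forall>\<^sub>F m in sequentially. \<forall>i\<in>{1..k}. {0..T} \<times> {n - k + i} \<subseteq> \<pi> m i)}"

(* Closure in Dn n for uniform convergence on [0, infinity) x {1..n}. *)
definition Dn_down :: "nat \<Rightarrow> (nat \<Rightarrow> real \<Rightarrow> real) set" where
  "Dn_down n = {f \<in> Dn n. \<forall>\<epsilon>>0. \<exists>g\<in>Dn_down_minus n. \<forall>i\<in>{1..n}. \<forall>x\<ge>0. \<bar>f i x - g i x\<bar> < \<epsilon>}"

end

theory Submission
  imports Defs
begin

text \<open>
  Blow up every time \<open>s\<close> to a fibre \<open>{s} \<times> [0,1]\<close> and order the result lexicographically. On this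
  linear continuum the given functions become continuous, provided that simultaneous jumps are
  ramped up from the lowest line to the highest. A \<open>k\<close>-tuple of disjoint paths becomes an array of
  jump times satisfying interlacing inequalities, and its weight is a sum of functions of the
  single entries. This has two consequences. First, pointwise minima and maxima of arrays are
  arrays of the same total weight, which gives the quadrangle inequality. Second, with all but one
  column of an array fixed, the entries of that column are optimized independently of each other, so
  the Pitman transform of two adjacent lines preserves all last passage values. Pitman transforms
  sort the lines, and for sorted lines the \<open>k\<close>-path value is the sum of the \<open>k\<close> top lines; so the
  sorted ensemble is the melon, and it has the same last passage values.

  By rotation, the sum of the \<open>k\<close> lowest lines of \<open>R_t W_t R_t f\<close> at \<open>x\<close> is
  \<open>f[0\<^sup>k \<rightarrow> t\<^sup>k] - f[x\<^sup>k \<rightarrow> t\<^sup>k]\<close>. The quadrangle inequality makes it decreasing in \<open>t\<close>, with an excess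
  over its limit that increases in \<open>x\<close>; hence convergence is locally uniform, the limit has the same
  last passage values, and \<open>M f\<close> and \<open>W f\<close> are both determined by these values. The fixed points
  of \<open>M\<close> are the \<open>f\<close> for which the \<open>k\<close> lowest lines are asymptotically optimal, and an arbitrarily
  small tilt in favour of late jumps makes them exactly optimal, as in the definition of
  \<open>Dn_down_minus\<close>.
\<close>

section \<open>Running maxima on a linear continuum\<close>

text \<open>Cadlag lines resist this plan in two ways. The difference of two lines may jump in both
  directions, so its running maximum can skip values, whereas the reflection step needs an
  intermediate value. And the measure of a tuple counts a jump at a common point of two paths only
  once, so it is not a plain sum over the single jump times. Both defects vanish in the fibres:
  \<open>spt s 0\<close> carries the left limit at \<open>s\<close>, \<open>spt s 1\<close> the
  value, and a path from \<open>x\<close> to \<open>y\<close> becomes an array from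
  \<open>spt x 0\<close> to \<open>spt y 1\<close>. The price is that the split line is not
  metrizable, since a compact interval contains uncountably many disjoint open intervals;
  compactness and attained suprema are therefore derived from the order alone. Moreover a function
  has many extensions into the fibres, and Pitman transforms do not preserve the standard one. Hence
  the class \<open>line_ensemble\<close>, which is closed under all operations used and on which
  array values agree with the path values of the sampled function.\<close>

lemma compact_Icc_linear_continuum:
  fixes a b :: "'a::linear_continuum_topology"
  shows "compact {a..b}"
proof (cases "a \<le> b")
  case True
  show ?thesis
    unfolding compact_eq_Heine_Borel
  proof (intro allI impI, elim conjE)
    fix C :: "'a set set"
    assume op: "\<forall>c\<in>C. open c" and cov: "{a..b} \<subseteq> \<Union>C"
    \<comment> \<open>These are the points reachable from \<open>a\<close> by a finite subcover.
      Their supremum is reachable too, and a cover element around it would reach further if it were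
      not \<open>b\<close>.\<close>
    define P where "P = {x\<in>{a..b}. \<exists>D\<subseteq>C. finite D \<and> {a..x} \<subseteq> \<Union>D}"
    have PD: "a \<le> x \<and> x \<le> b" "\<exists>D\<subseteq>C. finite D \<and> {a..x} \<subseteq> \<Union>D" if "x \<in> P" for x
      using that unfolding P_def by simp_all
    have PI: "x \<in> P" if "a \<le> x" "x \<le> b" "D \<subseteq> C" "finite D" "{a..x} \<subseteq> \<Union>D" for x D
      using that unfolding P_def mem_Collect_eq atLeastAtMost_iff by (intro conjI exI[of _ D])
    obtain c where c: "c \<in> C" "a \<in> c" using cov True by auto
    have aP: "a \<in> P" by (rule PI[of _ "{c}"]) (use True c in auto)
    have bdd: "bdd_above P" by (rule bdd_aboveI[of _ b]) (use PD in blast)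
    define s where "s = Sup P"
    have s: "a \<le> s" unfolding s_def by (rule cSup_upper[OF aP bdd])
    have sb: "s \<le> b" unfolding s_def by (rule cSup_least) (use aP PD in blast)+
    note s = s sb
    obtain c where c: "c \<in> C" "s \<in> c" using cov s by auto
    have sP: "s \<in> P"
    proof (cases "s = a")
      case False
      then have "a < s" using s by simp
      then obtain l where l: "l < s" "{l<..s} \<subseteq> c"
        using open_left[of c s a] op c by blast
      have "P \<noteq> {}" using aP by auto
      with l(1) obtain x where x: "x \<in> P" "l < x"
        unfolding s_def by (rule less_cSupE)
      then obtain D where D: "D \<subseteq> C" "finite D" "{a..x} \<subseteq> \<Union>D" using PD(2)[OF x(1)] by metis
      have "{a..s} \<subseteq> \<Union>(insert c D)"
      proof
        fix w assume w: "w \<in> {a..s}"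
        show "w \<in> \<Union>(insert c D)"
        proof (cases "w \<le> x")
          case True then show ?thesis using D w by auto
        next
          case False
          then have "w \<in> {l<..s}" using x w by auto
          then show ?thesis using l(2) by auto
        qed
      qed
      then show ?thesis using s D c PI[of s "insert c D"] by simp
    qed (use aP in simp)
    then obtain D where D: "D \<subseteq> C" "finite D" "{a..s} \<subseteq> \<Union>D" using PD(2)[OF sP] by metis
    have "s = b"
    proof (rule ccontr)
      assume "s \<noteq> b"
      then have sb: "s < b" using s by simp
      then obtain r where r: "s < r" "{s..<r} \<subseteq> c"
        using open_right[of c s b] op c by blast
      obtain y where y: "s < y" "y < min r b" using dense[of s "min r b"] r sb by auto
      have "{a..y} \<subseteq> \<Union>(insert c D)"
      proof
        fix w assume w: "w \<in> {a..y}"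
        show "w \<in> \<Union>(insert c D)"
        proof (cases "w \<le> s")
          case True then show ?thesis using D w by auto
        next
          case False
          then have "w \<in> {s..<r}" using y w by auto
          then show ?thesis using r(2) by auto
        qed
      qed
      then have "y \<in> P" using s D c y PI[of y "insert c D"] order.trans[OF s(1) less_imp_le[OF y(1)]] less_imp_le[of y b] by simp
      then have "y \<le> s" using cSup_upper[of y P] bdd unfolding s_def by blast
      then show False using y by simp
    qed
    then show "\<exists>D\<subseteq>C. finite D \<and> {a..b} \<subseteq> \<Union>D" using D by metis
  qed
qed auto

definition running_max :: "('a::linorder \<Rightarrow> real) \<Rightarrow> 'a \<Rightarrow> real" where
  "running_max G x = Sup (G ` {..x})"

text \<open>The supremum runs over the unbounded set \<open>{..x}\<close>. Since \<open>G\<close>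
  vanishes up to \<open>z\<close>, it is the maximum over the compact interval from \<open>z\<close>
  to \<open>x\<close> once \<open>x\<close> is beyond \<open>z\<close>; hence it is attained and
  nonnegative.\<close>

locale running_maximum =
  fixes G :: "'a::linear_continuum_topology \<Rightarrow> real" and z :: 'a and S :: "'a \<Rightarrow> real"
  assumes cont: "continuous_on UNIV G" and zero: "\<And>x. x \<le> z \<Longrightarrow> G x = 0"
    and S_eq: "S = running_max G"
begin

lemma maximum: obtains w where "w \<le> x" "S x = G w" "\<And>v. v \<le> x \<Longrightarrow> G v \<le> G w"
proof -
  have "\<exists>w\<le>x. \<forall>v\<le>x. G v \<le> G w"
  proof (cases "x \<le> z")
    case True
    have "\<forall>v\<le>x. G v \<le> G x"
    proof (intro allI impI)
      fix v assume "v \<le> x"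
      then show "G v \<le> G x" using zero[of v] zero[of x] True by simp
    qed
    then show ?thesis by auto
  next
    case False
    have "{z..x} \<noteq> {}" using False by simp
    then obtain w where w: "w \<in> {z..x}" "\<And>v. v \<in> {z..x} \<Longrightarrow> G v \<le> G w"
      using continuous_attains_sup[OF compact_Icc_linear_continuum _ continuous_on_subset[OF cont]]
      by blast
    have "G v \<le> G w" if "v \<le> x" for v
      using w(2)[of v] w(2)[of z] zero[of v] zero[of z] that False by (cases "v \<le> z") auto
    then show ?thesis using w(1) by auto
  qed
  then obtain w where w: "w \<le> x" "\<And>v. v \<le> x \<Longrightarrow> G v \<le> G w" by blast
  have "S x = G w"
    unfolding S_eq running_max_def by (rule cSup_eq_maximum) (use w in auto)
  with w show thesis by (intro that)
qed

lemma upper: "w \<le> x \<Longrightarrow> G w \<le> S x"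
  by (metis maximum)

lemma attained: obtains w where "w \<le> x" "S x = G w"
  by (metis maximum)

lemma mono: "x \<le> y \<Longrightarrow> S x \<le> S y"
  by (metis attained order_trans upper)

lemma attained_between:
  assumes "x \<le> y" "S x < S y" obtains w where "x < w" "w \<le> y" "S y = G w"
  using attained[of y] upper assms by (metis linorder_not_less order.strict_iff_not)

lemma S_zero: "x \<le> z \<Longrightarrow> S x = 0"
  by (metis attained order_trans zero)

lemma S_nonneg: "0 \<le> S x"
  by (metis S_zero linear mono)

text \<open>Lower bounds persist because a maximizer before \<open>x\<close> serves all nearby
  points, and one at \<open>x\<close> moves continuously. Upper bounds persist because only values
  of \<open>G\<close> on a short interval to the right of \<open>x\<close> can be new.\<close>

lemma continuous: "continuous_on UNIV S"
  unfolding continuous_on_def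
proof (intro ballI order_tendstoI)
  fix x and a :: real
  assume a: "a < S x"
  obtain w where w: "w \<le> x" "S x = G w" using attained by blast
  have "open {y. a < G y}"
    using open_Collect_less[of "\<lambda>_. a" G] cont by auto
  moreover have "w \<in> {y. a < G y}" using a w by simp
  ultimately have ev: "eventually (\<lambda>y. a < G y) (nhds w)" using eventually_nhds by blast
  show "eventually (\<lambda>y. a < S y) (at x within UNIV)"
  proof (cases "w = x")
    case True
    have "eventually (\<lambda>y. a < S y) (nhds x)"
      by (rule eventually_mono[OF ev[unfolded True]]) (meson less_le_trans order_refl upper)
    then show ?thesis using eventually_nhds_conv_at by auto
  next
    case False
    then have "eventually (\<lambda>y. y \<in> {w<..}) (nhds x)"
      using w by (intro eventually_nhds_in_open) auto
    then have "eventually (\<lambda>y. a < S y) (nhds x)"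
      by (rule eventually_mono) (use a w upper in \<open>auto intro: less_le_trans\<close>)
    then show ?thesis using eventually_nhds_conv_at by auto
  qed
next
  fix x and a :: real
  assume a: "S x < a"
  have op: "open {y. G y < a}"
    using open_Collect_less[of G "\<lambda>_. a"] cont by auto
  have xin: "x \<in> {y. G y < a}" using a upper[of x x] by simp
  show "eventually (\<lambda>y. S y < a) (at x within UNIV)"
  proof (cases "\<exists>y. x < y")
    case True
    then obtain y where "x < y" by blast
    then obtain b where b: "x < b" "{x..<b} \<subseteq> {y. G y < a}"
      using open_right[OF op xin, of y] by auto
    have "eventually (\<lambda>y. y \<in> {..<b}) (nhds x)"
      using b by (intro eventually_nhds_in_open) auto
    then have "eventually (\<lambda>y. S y < a) (nhds x)"
    proof (rule eventually_mono)
      fix y assume y: "y \<in> {..<b}"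
      obtain w where w: "w \<le> y" "S y = G w" using attained by blast
      show "S y < a"
      proof (cases "w \<le> x")
        case True then show ?thesis using upper[of w x] w a by simp
      next
        case False
        then have "w \<in> {x..<b}" using w y by auto
        then show ?thesis using b w by auto
      qed
    qed
    then show ?thesis using eventually_nhds_conv_at by auto
  next
    case False
    then have "S y < a" for y using mono[of y x] a by (meson le_less_trans not_le)
    then show ?thesis by simp
  qed
qed

text \<open>The witness is the first point of the interval where \<open>G\<close> reaches the level
  \<open>S a\<close>. By the intermediate value theorem \<open>G\<close> does not overshoot there,
  and before it the running maximum cannot have grown.\<close>

lemma hitting:
  assumes "a \<le> b" "S a < S b"
  obtains w where "a \<le> w" "w \<le> b" "G w = S a" "S w = S a"
proof -
  define K where "K = {a..b} \<inter> {w. S a \<le> G w}"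
  have "closed {w. S a \<le> G w}"
    using closed_Collect_le[of "\<lambda>_. S a" G] cont by auto
  then have comp: "compact K"
    unfolding K_def by (intro compact_Int_closed compact_Icc_linear_continuum)
  obtain v where v: "a < v" "v \<le> b" "S b = G v" using attained_between assms by blast
  then have "v \<in> K" using assms by (auto simp: K_def)
  then obtain w where w: "w \<in> K" "\<And>y. y \<in> K \<Longrightarrow> w \<le> y"
    using compact_attains_inf[OF comp] by auto
  have eq: "G w = S a"
  proof (rule ccontr)
    assume "G w \<noteq> S a"
    then have gt: "S a < G w" using w by (auto simp: K_def)
    have "continuous_on {a..w} G" using cont continuous_on_subset by blast
    then obtain y where y: "a \<le> y" "y \<le> w" "G y = S a"
      using IVT'[of G a "S a" w] upper[of a a] gt w by (auto simp: K_def)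
    then have "y \<in> K" using w by (auto simp: K_def)
    then show False using w(2) y gt by force
  qed
  have "S w = S a"
  proof -
    obtain y where y: "y \<le> w" "S w = G y" using attained by blast
    have "G y \<le> S a"
    proof (cases "y \<le> a")
      case True then show ?thesis using upper by simp
    next
      case False
      show ?thesis
      proof (rule ccontr)
        assume "\<not> G y \<le> S a"
        then have "y \<in> K" using False y w by (auto simp: K_def)
        then show False using w(2)[of y] y eq \<open>\<not> G y \<le> S a\<close> by auto
      qed
    qed
    moreover have "S a \<le> S w" using mono w by (auto simp: K_def)
    ultimately show ?thesis using y by simp
  qed
  then show thesis using that[of w] eq w by (auto simp: K_def)
qed

text \<open>With \<open>hitting\<close>, the two halves of
  \<open>sup\<^bsub>[a,b]\<^esub> G = sup\<^bsub>[a,b]\<^esub> (G - 2 S) + S a + S b\<close>.\<close>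

lemma reflection_le:
  assumes "a \<le> x" "x \<le> b"
  obtains y where "a \<le> y" "y \<le> b" "G x - 2 * S x + S a + S b \<le> G y"
proof (cases "S x < S b")
  case True
  then obtain w where w: "x < w" "w \<le> b" "S b = G w" using attained_between assms by blast
  show ?thesis
    by (rule that[of w]) (use w assms upper[of x x] mono[of a x] in auto)
next
  case False
  show ?thesis
    by (rule that[of x]) (use False assms mono[of a x] mono[of x b] in auto)
qed

lemma reflection_ge:
  assumes "a \<le> x" "x \<le> b"
  obtains y where "a \<le> y" "y \<le> b" "G x \<le> G y - 2 * S y + S a + S b"
proof (cases "S a < S b")
  case True
  \<comment> \<open>At this point the right-hand side equals \<open>S b\<close>, which bounds
    \<open>G\<close> on the whole interval; the choice does not depend on \<open>x\<close>.\<close>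
  obtain w where w: "a \<le> w" "w \<le> b" "G w = S a" "S w = S a"
    using hitting[OF order.trans[OF assms] True] by metis
  show ?thesis by (rule that[of w]) (use w assms upper[of x b] in auto)
next
  case False
  show ?thesis
    by (rule that[of x]) (use False assms mono[of a x] mono[of x b] in auto)
qed

end

section \<open>Arrays of disjoint paths\<close>

text \<open>A \<open>k\<close>-tuple of disjoint paths from line \<open>n\<close> at time \<open>u\<close> to line 1 at time \<open>v\<close>: the \<open>i\<close>-th
  path (counted from 0) occupies line \<open>j + 1\<close> during \<open>[A i (j + 1), A i j]\<close>.\<close>

definition path_arrays :: "nat \<Rightarrow> nat \<Rightarrow> 'a::linorder \<Rightarrow> 'a \<Rightarrow> (nat \<Rightarrow> nat \<Rightarrow> 'a) set" where
  "path_arrays k n u v = {A. \<forall>i<k. A i n = u \<and> A i 0 = v \<and>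
     (\<forall>j<n. A i (Suc j) \<le> A i j \<and> (Suc i < k \<longrightarrow> A i j \<le> A (Suc i) (Suc j)))}"

definition weight :: "(nat \<Rightarrow> 'a \<Rightarrow> real) \<Rightarrow> nat \<Rightarrow> nat \<Rightarrow> (nat \<Rightarrow> nat \<Rightarrow> 'a) \<Rightarrow> real" where
  "weight F k n A = (\<Sum>i<k. \<Sum>j<n. F (Suc j) (A i j) - F (Suc j) (A i (Suc j)))"

definition array_lpp :: "(nat \<Rightarrow> 'a::linorder \<Rightarrow> real) \<Rightarrow> nat \<Rightarrow> nat \<Rightarrow> 'a \<Rightarrow> 'a \<Rightarrow> real" where
  "array_lpp F k n u v = Sup (weight F k n ` path_arrays k n u v)"

lemma path_arraysD:
  assumes "A \<in> path_arrays k n u v" "i < k"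
  shows "A i n = u" "A i 0 = v" "j < n \<Longrightarrow> A i (Suc j) \<le> A i j"
    "j < n \<Longrightarrow> Suc i < k \<Longrightarrow> A i j \<le> A (Suc i) (Suc j)"
  using assms unfolding path_arrays_def by auto

lemma path_arrays_antimono:
  assumes A: "A \<in> path_arrays k n u v" "i < k" and "j \<le> l" "l \<le> n"
  shows "A i l \<le> A i j"
  using assms(3,4)
proof (induction l rule: dec_induct)
  case (step l)
  then show ?case using path_arraysD(3)[OF A, of l] by simp
qed simp

lemma path_arrays_bounds:
  assumes A: "A \<in> path_arrays k n u v" "i < k" "j \<le> n"
  shows "u \<le> A i j" "A i j \<le> v"
  using path_arrays_antimono[OF A(1,2), of j n] path_arrays_antimono[OF A(1,2), of 0 j]
    path_arraysD[OF A(1,2)] A(3) by auto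

text \<open>In the witness, path \<open>i\<close> spends the whole time on line
  \<open>i + 1\<close>, which exists because \<open>k \<le> n\<close>.\<close>

lemma path_arrays_nonempty:
  assumes "k \<le> n" "u \<le> v"
  shows "(\<lambda>i j. if j \<le> i then v else u) \<in> path_arrays k n u v"
  using assms unfolding path_arrays_def by auto

lemma weight_alt:
  "weight F k n A = (\<Sum>j<n. \<Sum>i<k. F (Suc j) (A i j) - F (Suc j) (A i (Suc j)))"
  unfolding weight_def by (rule sum.swap)

lemma weight_cong:
  assumes "\<And>i j. i < k \<Longrightarrow> j \<le> n \<Longrightarrow> A i j = B i j"
    "\<And>i j. i < k \<Longrightarrow> j < n \<Longrightarrow> F (Suc j) (B i j) = G (Suc j) (B i j)"
    "\<And>i j. i < k \<Longrightarrow> j < n \<Longrightarrow> F (Suc j) (B i (Suc j)) = G (Suc j) (B i (Suc j))"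
  shows "weight F k n A = weight G k n B"
  unfolding weight_def by (intro sum.cong refl) (use assms in auto)

text \<open>Arrays with entries in \<open>{u..v}\<close> form a compact set by Tychonoff's theorem,
  the interlacing conditions are closed, and the weight is continuous in finitely many
  coordinates.\<close>

lemma array_lpp_attained:
  fixes u v :: "'a::linear_continuum_topology"
  assumes cont: "\<forall>j\<in>{1..n}. continuous_on UNIV (F j)" and kn: "k \<le> n" "u \<le> v"
  obtains A where "A \<in> path_arrays k n u v" "weight F k n A = array_lpp F k n u v"
    "\<And>B. B \<in> path_arrays k n u v \<Longrightarrow> weight F k n B \<le> array_lpp F k n u v"
proof -
  define P where "P = (\<lambda>a :: nat \<times> nat \<Rightarrow> 'a. (\<lambda>i j. a (i, j)) \<in> path_arrays k n u v)"
  define w where "w = (\<lambda>a :: nat \<times> nat \<Rightarrow> 'a. weight F k n (\<lambda>i j. a (i, j)))"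
  have "compactin euclidean (PiE UNIV (\<lambda>_ :: nat \<times> nat. {u..v}))"
    using compactin_PiE[of "\<lambda>_. euclidean" UNIV "\<lambda>_ :: nat \<times> nat. {u..v}"]
    by (simp add: euclidean_product_topology compact_Icc_linear_continuum)
  then have "compact (PiE UNIV (\<lambda>_ :: nat \<times> nat. {u..v}))" by simp
  moreover have "closed {a. P a}"
    unfolding P_def path_arrays_def mem_Collect_eq
    by (intro closed_Collect_all closed_Collect_imp closed_Collect_conj closed_Collect_eq
        closed_Collect_le open_Collect_const continuous_intros)
       auto
  ultimately have comp: "compact (PiE UNIV (\<lambda>_ :: nat \<times> nat. {u..v}) \<inter> {a. P a})" (is "compact ?K")
    by (rule compact_Int_closed)
  have "continuous_on UNIV (\<lambda>a :: nat \<times> nat \<Rightarrow> 'a. F (Suc j) (a p))" if "j < n" for j p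
    by (rule continuous_on_compose2[OF _ continuous_on_product_coordinates[of p]])
      (use cont that in auto)
  then have "continuous_on UNIV w"
    unfolding w_def weight_def by (intro continuous_on_sum continuous_on_diff) auto
  then have wc: "continuous_on ?K w" using continuous_on_subset by blast
  \<comment> \<open>Entries outside the range \<open>i < k\<close>, \<open>j \<le> n\<close> are
    unconstrained; setting them to \<open>u\<close> moves the array into the compact product without
    changing its weight.\<close>
  define clip where "clip = (\<lambda>(B :: nat \<Rightarrow> nat \<Rightarrow> 'a) (i, j). if i < k \<and> j \<le> n then B i j else u)"
  have clip: "clip B \<in> ?K" "w (clip B) = weight F k n B" if B: "B \<in> path_arrays k n u v" for B
  proof -
    show "clip B \<in> ?K"
      using B path_arrays_bounds[OF B] kn unfolding P_def clip_def path_arrays_def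
      by (auto simp: PiE_def)
    show "w (clip B) = weight F k n B"
      unfolding w_def clip_def by (rule weight_cong) auto
  qed
  have "?K \<noteq> {}" using clip(1)[OF path_arrays_nonempty[OF kn]] by blast
  then obtain a where a: "a \<in> ?K" "\<And>b. b \<in> ?K \<Longrightarrow> w b \<le> w a"
    using continuous_attains_sup[OF comp _ wc] by blast
  define A where "A = (\<lambda>i j. a (i, j))"
  have A: "A \<in> path_arrays k n u v" using a(1) by (simp add: P_def A_def)
  have max: "weight F k n B \<le> weight F k n A" if "B \<in> path_arrays k n u v" for B
    using a(2)[OF clip(1)[OF that]] clip(2)[OF that] by (simp add: w_def A_def)
  have "weight F k n A = array_lpp F k n u v"
    unfolding array_lpp_def using A max by (intro cSup_eq_maximum[symmetric]) auto
  show thesis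
    by (rule that[OF A \<open>weight F k n A = array_lpp F k n u v\<close>])
      (use max \<open>weight F k n A = array_lpp F k n u v\<close> in simp)
qed

text \<open>The real supremum is a function of the set of upper bounds, so mutual domination
  suffices and no boundedness has to be checked.\<close>

lemma Sup_eq_mutual:
  fixes X Y :: "real set"
  assumes X: "\<And>x. x \<in> X \<Longrightarrow> \<exists>y\<in>Y. x \<le> y" and Y: "\<And>y. y \<in> Y \<Longrightarrow> \<exists>x\<in>X. y \<le> x"
  shows "Sup X = Sup Y"
proof -
  have "(\<forall>x\<in>X. x \<le> c) \<longleftrightarrow> (\<forall>y\<in>Y. y \<le> c)" for c
  proof (intro iffI ballI)
    fix y assume "\<forall>x\<in>X. x \<le> c" "y \<in> Y"
    then show "y \<le> c" using Y[of y] by force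
  next
    fix x assume "\<forall>y\<in>Y. y \<le> c" "x \<in> X"
    then show "x \<le> c" using X[of x] by force
  qed
  then show ?thesis unfolding Sup_real_def by simp
qed

lemma array_lpp_eqI:
  assumes "\<And>A. A \<in> path_arrays k n u v \<Longrightarrow> \<exists>B\<in>path_arrays k n u' v'. weight F k n A \<le> weight G k n B"
    and "\<And>B. B \<in> path_arrays k n u' v' \<Longrightarrow> \<exists>A\<in>path_arrays k n u v. weight G k n B \<le> weight F k n A"
  shows "array_lpp F k n u v = array_lpp G k n u' v'"
  unfolding array_lpp_def by (rule Sup_eq_mutual) (use assms in blast)+

lemma array_lpp_0: "array_lpp F 0 n u v = 0"
proof -
  have "weight F 0 n ` path_arrays 0 n u v = {0}" by (auto simp: weight_def path_arrays_def)
  then show ?thesis by (simp add: array_lpp_def)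
qed

text \<open>The earlier paths leave no room: path \<open>i\<close> reaches the lines numbered
  \<open>i\<close> or less only at the final time \<open>v\<close>.\<close>

lemma path_arrays_top:
  assumes A: "A \<in> path_arrays k n u v" and "i < k" "j \<le> i" "j \<le> n"
  shows "A i j = v"
  using assms(2-)
proof (induction i arbitrary: j)
  case 0
  then show ?case using path_arraysD[OF A] by simp
next
  case (Suc i)
  show ?case
  proof (cases j)
    case 0
    then show ?thesis using path_arraysD[OF A] Suc.prems by simp
  next
    case (Suc l)
    have "v = A i l" using Suc.IH[of l] Suc.prems Suc by simp
    also have "\<dots> \<le> A (Suc i) j" using path_arraysD(4)[OF A, of i l] Suc Suc.prems by simp
    finally show ?thesis using path_arrays_bounds[OF A, of "Suc i" j] Suc.prems by simp
  qed
qed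

text \<open>The later paths push path \<open>i\<close> off all lines numbered above
  \<open>n - k + i + 1\<close> already at time \<open>u\<close>; this is the line on which it
  effectively starts.\<close>

lemma path_arrays_bottom:
  assumes A: "A \<in> path_arrays k n u v" and "i < k" "n + i < j + k" "j \<le> n"
  shows "A i j = u"
  using assms(2-)
proof (induction "k - i" arbitrary: i j)
  case 0
  then show ?case by simp
next
  case (Suc d)
  show ?case
  proof (cases "j = n")
    case True
    then show ?thesis using path_arraysD[OF A] Suc.prems by simp
  next
    case False
    then have k: "Suc i < k" "j < n" using Suc.prems by auto
    have "A i j \<le> A (Suc i) (Suc j)" using path_arraysD(4)[OF A, of i j] k by simp
    also have "A (Suc i) (Suc j) = u" using Suc.hyps(1)[of "Suc i" "Suc j"] Suc.hyps(2) Suc.prems k by simp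
    finally show ?thesis using path_arrays_bounds[OF A, of i j] Suc.prems by simp
  qed
qed

section \<open>Modularity and estimates for array weights\<close>

lemma path_arrays_min:
  assumes A: "A \<in> path_arrays k n u v" and B: "B \<in> path_arrays k n u' v'"
  shows "(\<lambda>i j. min (A i j) (B i j)) \<in> path_arrays k n (min u u') (min v v')"
  unfolding path_arrays_def mem_Collect_eq
  by (intro allI impI conjI min.mono)
     (simp_all add: path_arraysD[OF A] path_arraysD[OF B])

lemma path_arrays_max:
  assumes A: "A \<in> path_arrays k n u v" and B: "B \<in> path_arrays k n u' v'"
  shows "(\<lambda>i j. max (A i j) (B i j)) \<in> path_arrays k n (max u u') (max v v')"
  unfolding path_arrays_def mem_Collect_eq
  by (intro allI impI conjI max.mono)
     (simp_all add: path_arraysD[OF A] path_arraysD[OF B])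

lemma weight_min_max:
  "weight F k n (\<lambda>i j. min (A i j) (B i j)) + weight F k n (\<lambda>i j. max (A i j) (B i j)) =
     weight F k n A + weight F k n B"
proof -
  have "f (min a b) + f (max a b) = f a + f b" for f :: "'a \<Rightarrow> real" and a b
    by (cases "a \<le> b") (auto simp: min_def max_def)
  then have *: "f (min a b) - g (min c d) + (f (max a b) - g (max c d)) = f a - g c + (f b - g d)"
    for f g :: "'a \<Rightarrow> real" and a b c d
    by (smt (verit))
  show ?thesis unfolding weight_def sum.distrib[symmetric] by (simp only: *)
qed

lemma array_lpp_upper:
  fixes u v :: "'a::linear_continuum_topology"
  assumes cont: "\<forall>j\<in>{1..n}. continuous_on UNIV (F j)" and kn: "k \<le> n" "u \<le> v"
    and A: "A \<in> path_arrays k n u v"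
  shows "weight F k n A \<le> array_lpp F k n u v"
  by (rule array_lpp_attained[of n F k u v]) (use cont kn A in auto)

text \<open>For optimal arrays with endpoints \<open>(u, v')\<close> and \<open>(u', v)\<close>, the
  pointwise minimum and maximum have endpoints \<open>(u, v)\<close> and
  \<open>(u', v')\<close>.\<close>

lemma array_lpp_quadrangle:
  fixes u v :: "'a::linear_continuum_topology"
  assumes cont: "\<forall>j\<in>{1..n}. continuous_on UNIV (F j)" and kn: "k \<le> n"
    and le: "u \<le> u'" "u' \<le> v" "v \<le> v'"
  shows "array_lpp F k n u v' + array_lpp F k n u' v \<le> array_lpp F k n u v + array_lpp F k n u' v'"
proof -
  obtain A where A: "A \<in> path_arrays k n u v'" "weight F k n A = array_lpp F k n u v'"
    by (rule array_lpp_attained[of n F k u v']) (use cont kn le in auto)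
  obtain B where B: "B \<in> path_arrays k n u' v" "weight F k n B = array_lpp F k n u' v"
    by (rule array_lpp_attained[of n F k u' v]) (use cont kn le in auto)
  have uv: "u \<le> v" "u' \<le> v'" using le by auto
  have eq: "min u u' = u" "min v' v = v" "max u u' = u'" "max v' v = v'" using le by (auto simp: min_def max_def)
  have "(\<lambda>i j. min (A i j) (B i j)) \<in> path_arrays k n u v"
    using path_arrays_min[OF A(1) B(1)] eq by simp
  then have 1: "weight F k n (\<lambda>i j. min (A i j) (B i j)) \<le> array_lpp F k n u v"
    by (rule array_lpp_upper[OF cont kn uv(1)])
  have "(\<lambda>i j. max (A i j) (B i j)) \<in> path_arrays k n u' v'"
    using path_arrays_max[OF A(1) B(1)] eq by simp
  then have 2: "weight F k n (\<lambda>i j. max (A i j) (B i j)) \<le> array_lpp F k n u' v'"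
    by (rule array_lpp_upper[OF cont kn uv(2)])
  show ?thesis using 1 2 weight_min_max[of F k n A B] A B by linarith
qed

text \<open>Path \<open>i\<close> is extended back to time \<open>u\<close> along line
  \<open>n - k + i + 1\<close>. All entries of \<open>B\<close> beyond column
  \<open>n - k + i\<close> equal \<open>u'\<close>, so only this line gains an increment.\<close>

lemma weight_prepend:
  assumes B: "B \<in> path_arrays k n u' v" and kn: "k \<le> n" and "u \<le> u'"
  defines "A \<equiv> \<lambda>i j. if n - k + i < j then u else B i j"
  shows "A \<in> path_arrays k n u v"
    and "weight F k n A = weight F k n B + (\<Sum>i<k. F (Suc (n - k + i)) u' - F (Suc (n - k + i)) u)"
proof -
  note BD = path_arraysD[OF B] and Bb = path_arrays_bounds[OF B]
  have up: "u \<le> B i j" if "i < k" "j \<le> n" for i j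
    using Bb[OF that] \<open>u \<le> u'\<close> by simp
  show "A \<in> path_arrays k n u v"
    unfolding path_arrays_def mem_Collect_eq A_def using BD up kn by auto
  have "(\<Sum>j<n. F (Suc j) (A i j) - F (Suc j) (A i (Suc j))) =
    (\<Sum>j<n. F (Suc j) (B i j) - F (Suc j) (B i (Suc j))) + (F (Suc (n - k + i)) u' - F (Suc (n - k + i)) u)"
    if i: "i < k" for i
  proof -
    have Bbot: "B i j = u'" if "n - k + i < j" "j \<le> n" for j
      using path_arrays_bottom[OF B i, of j] that kn by simp
    have "F (Suc j) (A i j) - F (Suc j) (A i (Suc j)) = F (Suc j) (B i j) - F (Suc j) (B i (Suc j)) +
        (if j = n - k + i then F (Suc j) u' - F (Suc j) u else 0)" if j: "j < n" for j
      using j Bbot[of j] Bbot[of "Suc j"] by (auto simp: A_def)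
    then have "(\<Sum>j<n. F (Suc j) (A i j) - F (Suc j) (A i (Suc j))) =
        (\<Sum>j<n. F (Suc j) (B i j) - F (Suc j) (B i (Suc j)) +
          (if j = n - k + i then F (Suc j) u' - F (Suc j) u else 0))"
      by (intro sum.cong) auto
    also have "\<dots> = (\<Sum>j<n. F (Suc j) (B i j) - F (Suc j) (B i (Suc j))) + (F (Suc (n - k + i)) u' - F (Suc (n - k + i)) u)"
      using i kn by (simp add: sum.distrib sum.delta Suc_diff_le less_diff_conv2)
    finally show ?thesis .
  qed
  then show "weight F k n A = weight F k n B + (\<Sum>i<k. F (Suc (n - k + i)) u' - F (Suc (n - k + i)) u)"
    unfolding weight_def sum.distrib[symmetric] by (intro sum.cong) auto
qed

lemma array_lpp_prepend:
  fixes u v :: "'a::linear_continuum_topology"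
  assumes cont: "\<forall>j\<in>{1..n}. continuous_on UNIV (F j)" and kn: "k \<le> n"
    and le: "u \<le> u'" "u' \<le> v"
  shows "array_lpp F k n u' v + (\<Sum>i<k. F (Suc (n - k + i)) u' - F (Suc (n - k + i)) u)
    \<le> array_lpp F k n u v"
proof -
  obtain B where B: "B \<in> path_arrays k n u' v" "weight F k n B = array_lpp F k n u' v"
    by (rule array_lpp_attained[of n F k u' v]) (use cont kn le in auto)
  have "u \<le> v" using le by simp
  show ?thesis
    using array_lpp_upper[OF cont kn \<open>u \<le> v\<close> weight_prepend(1)[OF B(1) kn le(1)]]
      weight_prepend(2)[OF B(1) kn le(1), of F] B(2) by simp
qed

text \<open>The constant counts \<open>k\<close> times \<open>n\<close> increments, with two
  evaluations each.\<close>

lemma weight_diff_le: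
  assumes A: "A \<in> path_arrays k n u v"
    and d: "\<And>j w. 1 \<le> j \<Longrightarrow> j \<le> n \<Longrightarrow> u \<le> w \<Longrightarrow> w \<le> v \<Longrightarrow> \<bar>F j w - G j w\<bar> \<le> d"
  shows "weight F k n A \<le> weight G k n A + real k * (real n * (2 * d))"
proof -
  have "weight F k n A \<le> (\<Sum>i<k. \<Sum>j<n. (G (Suc j) (A i j) - G (Suc j) (A i (Suc j))) + 2 * d)"
    unfolding weight_def
  proof (intro sum_mono)
    fix i j assume ij: "i \<in> {..<k}" "j \<in> {..<n}"
    have "\<bar>F (Suc j) (A i j) - G (Suc j) (A i j)\<bar> \<le> d"
      "\<bar>F (Suc j) (A i (Suc j)) - G (Suc j) (A i (Suc j))\<bar> \<le> d"
      using ij path_arrays_bounds[OF A, of i j] path_arrays_bounds[OF A, of i "Suc j"]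
      by (intro d; simp)+
    then show "F (Suc j) (A i j) - F (Suc j) (A i (Suc j))
        \<le> (G (Suc j) (A i j) - G (Suc j) (A i (Suc j))) + 2 * d" by linarith
  qed
  also have "\<dots> = weight G k n A + real k * (real n * (2 * d))"
    unfolding weight_def by (simp add: sum.distrib)
  finally show ?thesis .
qed

lemma array_lpp_perturb:
  fixes u v :: "'a::linear_continuum_topology"
  assumes F: "\<forall>j\<in>{1..n}. continuous_on UNIV (F j)"
    and G: "\<forall>j\<in>{1..n}. continuous_on UNIV (G j)" and kn: "k \<le> n" "u \<le> v"
    and d: "\<And>j w. 1 \<le> j \<Longrightarrow> j \<le> n \<Longrightarrow> u \<le> w \<Longrightarrow> w \<le> v \<Longrightarrow> \<bar>F j w - G j w\<bar> \<le> d"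
  shows "\<bar>array_lpp F k n u v - array_lpp G k n u v\<bar> \<le> real k * (real n * (2 * d))"
proof -
  obtain A where A: "A \<in> path_arrays k n u v" "weight F k n A = array_lpp F k n u v"
    by (rule array_lpp_attained[of n F k u v]) (use F kn in auto)
  obtain B where B: "B \<in> path_arrays k n u v" "weight G k n B = array_lpp G k n u v"
    by (rule array_lpp_attained[of n G k u v]) (use G kn in auto)
  have d': "\<And>j w. 1 \<le> j \<Longrightarrow> j \<le> n \<Longrightarrow> u \<le> w \<Longrightarrow> w \<le> v \<Longrightarrow> \<bar>G j w - F j w\<bar> \<le> d"
    using d by (simp add: abs_minus_commute)
  have "weight F k n A \<le> weight G k n A + real k * (real n * (2 * d))"
    by (rule weight_diff_le[OF A(1)]) (rule d)
  moreover have "weight G k n B \<le> weight F k n B + real k * (real n * (2 * d))"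
    by (rule weight_diff_le[OF B(1)]) (rule d')
  ultimately show ?thesis
    using array_lpp_upper[OF F kn B(1)] array_lpp_upper[OF G kn A(1)] A(2) B(2) by linarith
qed

text \<open>Path \<open>i\<close> is confined to the lines from \<open>i + 1\<close> on until the
  end. Going back from \<open>v\<close>, each change of line trades \<open>F (Suc m)\<close> for the
  larger \<open>F m\<close> at the same point, so its weight is at most \<open>F (Suc i) v\<close>.
  Paths that stay on one line attain this bound.\<close>

lemma array_lpp_sorted:
  fixes u v :: "'a::linear_continuum_topology"
  assumes cont: "\<forall>j\<in>{1..n}. continuous_on UNIV (F j)" and kn: "k \<le> n" "u \<le> v"
    and zero: "\<And>j. 1 \<le> j \<Longrightarrow> j \<le> n \<Longrightarrow> F j u = 0"
    and sorted: "\<And>j x. 1 \<le> j \<Longrightarrow> j < n \<Longrightarrow> F (Suc j) x \<le> F j x"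
  shows "array_lpp F k n u v = (\<Sum>i<k. F (Suc i) v)"
proof (rule antisym)
  obtain A where A: "A \<in> path_arrays k n u v" "weight F k n A = array_lpp F k n u v"
    by (rule array_lpp_attained[of n F k u v]) (use cont kn in auto)
  have "(\<Sum>j<n. F (Suc j) (A i j) - F (Suc j) (A i (Suc j))) \<le> F (Suc i) v" if i: "i < k" for i
  proof -
    let ?t = "\<lambda>j. F (Suc j) (A i j) - F (Suc j) (A i (Suc j))"
    have Av: "A i j = v" if "j \<le> i" for j using path_arrays_top[OF A(1) i that] that i kn by simp
    have 1: "(\<Sum>j<i. ?t j) = 0" by (intro sum.neutral) (auto simp: Av)
    have 2: "(\<Sum>j\<in>{i..<m}. ?t j) \<le> F (Suc i) v - F m (A i m)" if "Suc i \<le> m" "m \<le> n" for m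
      using that
    proof (induction m rule: dec_induct)
      case base
      then show ?case by (simp add: Av)
    next
      case (step m)
      have "(\<Sum>j\<in>{i..<Suc m}. ?t j) = (\<Sum>j\<in>{i..<m}. ?t j) + ?t m"
        using step.hyps by simp
      then show ?case using step.IH sorted[of m "A i m"] step.prems step.hyps by simp
    qed
    have "(\<Sum>j<n. ?t j) = (\<Sum>j<i. ?t j) + (\<Sum>j\<in>{i..<n}. ?t j)"
      using i kn by (subst sum.union_disjoint[symmetric]) (auto intro: sum.cong)
    then show ?thesis
      using 1 2[of n] i kn path_arraysD(1)[OF A(1) i] zero[of n] by simp
  qed
  then show "array_lpp F k n u v \<le> (\<Sum>i<k. F (Suc i) v)"
    unfolding A(2)[symmetric] weight_def by (intro sum_mono) auto
  let ?B = "\<lambda>i j. if j \<le> i then v else u"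
  have "(\<Sum>j<n. F (Suc j) (?B i j) - F (Suc j) (?B i (Suc j))) = F (Suc i) v" if i: "i < k" for i
  proof -
    have "(\<Sum>j<n. F (Suc j) (?B i j) - F (Suc j) (?B i (Suc j))) =
        (\<Sum>j<n. if j = i then F (Suc i) v else 0)"
      by (intro sum.cong) (use zero[of "Suc i"] i kn in auto)
    also have "\<dots> = F (Suc i) v" using i kn by simp
    finally show ?thesis .
  qed
  then have "weight F k n ?B = (\<Sum>i<k. F (Suc i) v)"
    unfolding weight_def by (intro sum.cong) auto
  then show "(\<Sum>i<k. F (Suc i) v) \<le> array_lpp F k n u v"
    using array_lpp_upper[OF cont kn path_arrays_nonempty[OF kn]] by simp
qed

section \<open>Pitman transforms\<close>

text \<open>\<open>F m x + S x\<close> is the two-line last passage value: the supremum over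
  \<open>w \<le> x\<close> of \<open>F (Suc m) w + F m x - F m w\<close>. The other line is changed
  so that the sum of the two lines is kept.\<close>

definition pitman :: "nat \<Rightarrow> (nat \<Rightarrow> 'a::linorder \<Rightarrow> real) \<Rightarrow> nat \<Rightarrow> 'a \<Rightarrow> real" where
  "pitman m F = (let S = running_max (\<lambda>x. F (Suc m) x - F m x) in
     F(m := \<lambda>x. F m x + S x, Suc m := \<lambda>x. F (Suc m) x - S x))"

lemma sum_change_two:
  fixes h h' :: "nat \<Rightarrow> real"
  assumes "Suc p < n" "\<And>j. j < n \<Longrightarrow> j \<noteq> p \<Longrightarrow> j \<noteq> Suc p \<Longrightarrow> h' j = h j"
  shows "(\<Sum>j<n. h' j) = (\<Sum>j<n. h j) + (h' p - h p) + (h' (Suc p) - h (Suc p))"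
proof -
  have "(\<Sum>j<n. h' j - h j) = (\<Sum>j\<in>{p, Suc p}. h' j - h j)"
    by (rule sum.mono_neutral_right) (use assms in auto)
  then show ?thesis by (simp add: sum_subtractf)
qed

lemma weight_change_column:
  assumes "Suc p < n"
  shows "weight F k n (\<lambda>i j. if j = Suc p then z i else A i j) = weight F k n A +
    (\<Sum>i<k. (F (Suc (Suc p)) (z i) - F (Suc p) (z i)) -
       (F (Suc (Suc p)) (A i (Suc p)) - F (Suc p) (A i (Suc p))))"
  unfolding weight_def sum.distrib[symmetric]
  by (intro sum.cong refl, subst sum_change_two[OF assms, where h = "\<lambda>j. F (Suc j) (A i j) - F (Suc j) (A i (Suc j))" for i]) auto

text \<open>The correction is that of the reflection identity on the interval from
  \<open>A i (Suc (Suc p))\<close> to \<open>A i p\<close>, evaluated at the entry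
  \<open>A i (Suc p)\<close>.\<close>

lemma weight_pitman:
  fixes F :: "nat \<Rightarrow> 'a::linorder \<Rightarrow> real"
  assumes "Suc p < n"
  defines "S \<equiv> running_max (\<lambda>x. F (Suc (Suc p)) x - F (Suc p) x)"
  shows "weight (pitman (Suc p) F) k n A = weight F k n A +
    (\<Sum>i<k. S (A i p) + S (A i (Suc (Suc p))) - 2 * S (A i (Suc p)))"
  unfolding weight_def sum.distrib[symmetric] pitman_def Let_def S_def[symmetric]
  by (intro sum.cong refl, subst sum_change_two[OF assms(1), where h = "\<lambda>j. F (Suc j) (A i j) - F (Suc j) (A i (Suc j))" for i]) auto

text \<open>With the other columns fixed, entry \<open>i\<close> of column \<open>Suc p\<close>
  ranges over its own interval from \<open>a i\<close> to \<open>b i\<close>. Since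
  \<open>b i\<close> and \<open>a (Suc i)\<close> are the minimum and the maximum of the same two
  entries, the boundary terms \<open>S (a i) + S (b i)\<close> have the same total as those of
  columns \<open>p\<close> and \<open>Suc (Suc p)\<close>, although the intervals differ.\<close>

lemma array_lpp_pitman_aux:
  fixes g h S :: "'a::linorder \<Rightarrow> real"
  assumes p: "Suc p < n" and A: "A \<in> path_arrays k n u v"
    and step: "\<And>a b x. a \<le> x \<Longrightarrow> x \<le> b \<Longrightarrow> \<exists>y. a \<le> y \<and> y \<le> b \<and> g x \<le> h y + S a + S b"
  obtains y where "(\<lambda>i j. if j = Suc p then y i else A i j) \<in> path_arrays k n u v"
    "(\<Sum>i<k. g (A i (Suc p))) \<le> (\<Sum>i<k. h (y i) + S (A i p) + S (A i (Suc (Suc p))))"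
proof (cases k)
  case 0
  show ?thesis by (rule that[of undefined]) (simp_all add: path_arrays_def 0)
next
  case (Suc k')
  note D = path_arraysD[OF A]
  define a where "a i = (if i = 0 then A 0 (Suc (Suc p)) else max (A i (Suc (Suc p))) (A (i - 1) p))" for i
  define b where "b i = (if Suc i = k then A i p else min (A i p) (A (Suc i) (Suc (Suc p))))" for i
  have ab: "a i \<le> A i (Suc p)" "A i (Suc p) \<le> b i" if "i < k" for i
    using D(3)[of i p] D(3)[of i "Suc p"] D(4)[of i "Suc p"] D(4)[of "i - 1" p] that p
    by (auto simp: a_def b_def)
  have "\<forall>i. \<exists>y. i < k \<longrightarrow> a i \<le> y \<and> y \<le> b i \<and> g (A i (Suc p)) \<le> h y + S (a i) + S (b i)"
    using step[OF ab] by metis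
  then obtain y where y: "\<And>i. i < k \<Longrightarrow> a i \<le> y i" "\<And>i. i < k \<Longrightarrow> y i \<le> b i"
      "\<And>i. i < k \<Longrightarrow> g (A i (Suc p)) \<le> h (y i) + S (a i) + S (b i)"
    by metis
  have mm: "S (max x x') + S (min x' x) = S x + S x'" for x x' :: 'a
    by (cases "x \<le> x'") (auto simp: min_def max_def)
  have "(\<Sum>i<k. S (a i) + S (b i)) = (\<Sum>i<k. S (a i)) + (\<Sum>i<k. S (b i))"
    by (simp add: sum.distrib)
  also have "(\<Sum>i<k. S (a i)) = S (A 0 (Suc (Suc p))) + (\<Sum>i<k'. S (a (Suc i)))"
    unfolding Suc sum.lessThan_Suc_shift by (simp add: a_def)
  also have "(\<Sum>i<k. S (b i)) = (\<Sum>i<k'. S (b i)) + S (A k' p)"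
    unfolding Suc by (simp add: b_def Suc)
  also have "S (A 0 (Suc (Suc p))) + (\<Sum>i<k'. S (a (Suc i))) + ((\<Sum>i<k'. S (b i)) + S (A k' p)) =
      S (A 0 (Suc (Suc p))) + S (A k' p) + (\<Sum>i<k'. S (a (Suc i)) + S (b i))"
    by (simp add: sum.distrib)
  also have "(\<Sum>i<k'. S (a (Suc i)) + S (b i)) = (\<Sum>i<k'. S (A (Suc i) (Suc (Suc p))) + S (A i p))"
    by (intro sum.cong refl) (use mm Suc in \<open>auto simp: a_def b_def\<close>)
  also have "S (A 0 (Suc (Suc p))) + S (A k' p) + \<dots> = (\<Sum>i<k. S (A i p) + S (A i (Suc (Suc p))))"
    unfolding sum.distrib Suc sum.lessThan_Suc_shift[of "\<lambda>i. S (A i (Suc (Suc p)))"] by simp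
  finally have S: "(\<Sum>i<k. S (a i) + S (b i)) = (\<Sum>i<k. S (A i p) + S (A i (Suc (Suc p))))" .
  show ?thesis
  proof (rule that[of y])
    have "a i \<le> y i" "A i (Suc (Suc p)) \<le> y i" if "i < k" for i
      using y(1)[OF that] D(4) by (auto simp: a_def split: if_splits)
    moreover have "A i p \<le> y (Suc i)" if "Suc i < k" for i
      using y(1)[OF that] by (auto simp: a_def)
    moreover have "y i \<le> A i p" "Suc i < k \<Longrightarrow> y i \<le> A (Suc i) (Suc (Suc p))" if "i < k" for i
      using y(2)[OF that] by (auto simp: b_def split: if_splits)
    ultimately show "(\<lambda>i j. if j = Suc p then y i else A i j) \<in> path_arrays k n u v"
      unfolding path_arrays_def mem_Collect_eq using D p by auto
    have "(\<Sum>i<k. g (A i (Suc p))) \<le> (\<Sum>i<k. h (y i) + S (a i) + S (b i))"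
      using y(3) by (intro sum_mono) auto
    also have "\<dots> = (\<Sum>i<k. h (y i)) + (\<Sum>i<k. S (a i) + S (b i))"
      by (simp add: sum.distrib)
    also have "\<dots> = (\<Sum>i<k. h (y i) + S (A i p) + S (A i (Suc (Suc p))))"
      unfolding S by (simp add: sum.distrib)
    finally show "(\<Sum>i<k. g (A i (Suc p))) \<le> (\<Sum>i<k. h (y i) + S (A i p) + S (A i (Suc (Suc p))))" .
  qed
qed

lemma array_lpp_pitman:
  fixes F :: "nat \<Rightarrow> 'a::linear_continuum_topology \<Rightarrow> real"
  assumes m: "1 \<le> m" "m < n"
    and cont: "continuous_on UNIV (F m)" "continuous_on UNIV (F (Suc m))"
    and zero: "\<And>x. x \<le> z \<Longrightarrow> F m x = 0" "\<And>x. x \<le> z \<Longrightarrow> F (Suc m) x = 0"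
  shows "array_lpp (pitman m F) k n u v = array_lpp F k n u v"
proof -
  obtain p where mp: "m = Suc p" using m by (cases m) auto
  have p: "Suc p < n" using m mp by simp
  define G where "G x = F (Suc m) x - F m x" for x
  define S where "S = running_max G"
  interpret running_maximum G z S
    by standard (use cont zero in \<open>auto simp: G_def S_def intro!: continuous_intros\<close>)
  have S_eq: "S = running_max (\<lambda>x. F (Suc (Suc p)) x - F (Suc p) x)"
    unfolding S_def G_def mp ..
  let ?upd = "\<lambda>A y. (\<lambda>i j. if j = Suc p then y i else A i j)"
  note wp = weight_pitman[OF p, of F k, folded S_eq]
  note wc = weight_change_column[OF p, of F k]
  show ?thesis
  proof (rule array_lpp_eqI)
    fix A assume A: "A \<in> path_arrays k n u v"
    \<comment> \<open>The auxiliary lemma is used here with \<open>- S\<close> in place of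
      \<open>S\<close>, because the boundary terms belong to the transformed ensemble, which is now
      on the smaller side.\<close>
    have step: "\<exists>y\<ge>a. y \<le> b \<and> G x - 2 * S x \<le> G y + - S a + - S b" if le: "a \<le> x" "x \<le> b" for a b x
    proof -
      obtain y where "a \<le> y" "y \<le> b" "G x - 2 * S x + S a + S b \<le> G y"
        by (rule reflection_le[OF le])
      then show ?thesis by (intro exI[of _ y]) simp
    qed
    obtain y where y: "?upd A y \<in> path_arrays k n u v"
      "(\<Sum>i<k. G (A i (Suc p)) - 2 * S (A i (Suc p))) \<le>
        (\<Sum>i<k. G (y i) + - S (A i p) + - S (A i (Suc (Suc p))))"
      by (rule array_lpp_pitman_aux[OF p A step])
    have "weight (pitman m F) k n A \<le> weight F k n (?upd A y)"
      unfolding mp wp wc using y(2) by (simp add: sum.distrib sum_subtractf G_def mp)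
    then show "\<exists>B\<in>path_arrays k n u v. weight (pitman m F) k n A \<le> weight F k n B"
      using y(1) by blast
  next
    fix A assume A: "A \<in> path_arrays k n u v"
    have step: "\<exists>y\<ge>a. y \<le> b \<and> G x \<le> G y - 2 * S y + S a + S b" if le: "a \<le> x" "x \<le> b" for a b x
    proof -
      obtain y where "a \<le> y" "y \<le> b" "G x \<le> G y - 2 * S y + S a + S b"
        by (rule reflection_ge[OF le])
      then show ?thesis by (intro exI[of _ y]) simp
    qed
    obtain y where y: "?upd A y \<in> path_arrays k n u v"
      "(\<Sum>i<k. G (A i (Suc p))) \<le> (\<Sum>i<k. G (y i) - 2 * S (y i) + S (A i p) + S (A i (Suc (Suc p))))"
      by (rule array_lpp_pitman_aux[OF p A step])
    have "weight F k n A \<le> weight (pitman m F) k n (?upd A y)"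
      unfolding mp wp wc using y(2) by (simp add: sum.distrib sum_subtractf G_def mp)
    then show "\<exists>B\<in>path_arrays k n u v. weight F k n A \<le> weight (pitman m F) k n B"
      using y(1) by blast
  qed
qed

text \<open>Inserting line \<open>m\<close> into the sorted lines \<open>m + 1, \<dots>, n\<close> by Pitman transforms of lines
  \<open>m, m + 1\<close>, then \<open>m + 1, m + 2\<close>, and so on. When line \<open>l\<close> is reached, it is its old value minus
  the running maximum \<open>S\<close> of the last step; the invariant says that the old value still separates
  lines \<open>l - 1\<close> and \<open>l + 1\<close>.\<close>

lemma pitman_insertion:
  fixes F :: "nat \<Rightarrow> 'a::linear_continuum_topology \<Rightarrow> real"
  assumes Q: "Q F" and Q_pitman: "\<And>F m. Q F \<Longrightarrow> 1 \<le> m \<Longrightarrow> m < n \<Longrightarrow> Q (pitman m F)"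
    and Q_cont: "\<And>F j. Q F \<Longrightarrow> continuous_on UNIV (F j)"
    and Q_zero: "\<And>F j x. Q F \<Longrightarrow> x \<le> z \<Longrightarrow> F j x = 0"
    and m: "1 \<le> m"
    and sorted: "\<And>j x. m < j \<Longrightarrow> j < n \<Longrightarrow> F (Suc j) x \<le> F j x"
    and l: "m \<le> l" "l \<le> n"
  shows "\<exists>H S. Q H \<and> (\<forall>k u v. array_lpp H k n u v = array_lpp F k n u v) \<and>
    (\<forall>j x. m \<le> j \<longrightarrow> j < n \<longrightarrow> j \<noteq> l \<longrightarrow> H (Suc j) x \<le> H j x) \<and> mono S \<and>
    (\<forall>x. m < l \<longrightarrow> H l x + S x \<le> H (l - 1) x) \<and> (\<forall>x. m < l \<longrightarrow> l < n \<longrightarrow> H (Suc l) x \<le> H l x + S x)"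
  using l
proof (induction l rule: dec_induct)
  case base
  show ?case
    by (intro exI[of _ F] exI[of _ "\<lambda>_. 0 :: real"]) (use Q sorted in \<open>auto simp: mono_def\<close>)
next
  case (step l)
  then obtain H S where H: "Q H" "\<And>k u v. array_lpp H k n u v = array_lpp F k n u v"
    "\<And>j x. m \<le> j \<Longrightarrow> j < n \<Longrightarrow> j \<noteq> l \<Longrightarrow> H (Suc j) x \<le> H j x" "mono S"
    "\<And>x. m < l \<Longrightarrow> H l x + S x \<le> H (l - 1) x" "\<And>x. m < l \<Longrightarrow> l < n \<Longrightarrow> H (Suc l) x \<le> H l x + S x"
    by (auto simp: less_imp_le)
  define G where "G x = H (Suc l) x - H l x" for x
  define T where "T = running_max G"
  interpret running_maximum G z T
    by standard (use Q_cont[OF H(1)] Q_zero[OF H(1)] in \<open>auto simp: G_def T_def intro!: continuous_intros\<close>)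
  define H' where "H' = pitman l H"
  have H'l: "H' l x = H l x + T x" and H'Sl: "H' (Suc l) x = H (Suc l) x - T x" for x
    unfolding H'_def pitman_def Let_def T_def G_def by auto
  have H'j: "H' j = H j" if "j \<noteq> l" "j \<noteq> Suc l" for j
    unfolding H'_def pitman_def Let_def using that by auto
  have GT: "H (Suc l) x - H l x \<le> T x" for x using upper[of x x] by (simp add: G_def)
  have 1: "H' (Suc j) x \<le> H' j x" if j: "m \<le> j" "j < n" "j \<noteq> Suc l" for j x
  proof -
    consider "j = l" | "Suc j = l" | "j \<noteq> l" "Suc j \<noteq> l" by blast
    then show ?thesis
    proof cases
      case 1
      then show ?thesis using GT[of x] S_nonneg[of x] by (simp add: H'l H'Sl)
    next
      case 2
      \<comment> \<open>The invariant bounds \<open>G\<close> by the previous running maximum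
        \<open>S\<close>. Hence \<open>T \<le> S\<close>, and the raised line \<open>l\<close> stays
        below line \<open>l - 1\<close>.\<close>
      obtain w where w: "w \<le> x" "T x = G w" using attained by blast
      have "T x \<le> S w" using H(6)[of w] 2 j step.prems w by (simp add: G_def)
      also have "S w \<le> S x" using H(4) w by (simp add: mono_def)
      finally have "H l x + T x \<le> H (l - 1) x" using H(5)[of x] 2 j by simp
      then show ?thesis using 2 H'j[of j] by (auto simp: H'l)
    next
      case 3
      then show ?thesis using H(3)[of j x] j H'j[of j] H'j[of "Suc j"] by simp
    qed
  qed
  have "Q H'" unfolding H'_def using H(1) m step by (intro Q_pitman) auto
  moreover have "array_lpp H' k n u v = array_lpp F k n u v" for k u v
    unfolding H'_def H(2)[symmetric]
    by (rule array_lpp_pitman[of _ _ _ z]) (use m step Q_cont[OF H(1)] Q_zero[OF H(1)] in auto)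
  moreover have "mono T" using mono by (simp add: mono_def)
  moreover have "H' (Suc l) x + T x \<le> H' l x" for x
    using GT[of x] by (simp add: H'l H'Sl)
  moreover have "H' (Suc (Suc l)) x \<le> H' (Suc l) x + T x" if "Suc l < n" for x
    using H(3)[of "Suc l" x] that step.hyps H'j[of "Suc (Suc l)"] by (simp add: H'Sl)
  ultimately show ?case using 1 by (intro exI[of _ H'] exI[of _ T]) simp
qed

text \<open>Insertion sort from the lowest line upwards: after \<open>d\<close> rounds the
  \<open>d\<close> lowest lines are sorted. \<open>Q\<close> stands for a class of ensembles that is
  closed under the transforms.\<close>

lemma pitman_sorting:
  fixes F :: "nat \<Rightarrow> 'a::linear_continuum_topology \<Rightarrow> real"
  assumes Q: "Q F" and Q_pitman: "\<And>F m. Q F \<Longrightarrow> 1 \<le> m \<Longrightarrow> m < n \<Longrightarrow> Q (pitman m F)"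
    and Q_cont: "\<And>F j. Q F \<Longrightarrow> continuous_on UNIV (F j)"
    and Q_zero: "\<And>F j x. Q F \<Longrightarrow> x \<le> z \<Longrightarrow> F j x = 0"
  obtains H where "Q H" "\<And>k u v. array_lpp H k n u v = array_lpp F k n u v"
    "\<And>j x. 1 \<le> j \<Longrightarrow> j < n \<Longrightarrow> H (Suc j) x \<le> H j x"
proof -
  have "\<exists>H. Q H \<and> (\<forall>k u v. array_lpp H k n u v = array_lpp F k n u v) \<and>
      (\<forall>j x. Suc n - d \<le> j \<longrightarrow> 1 \<le> j \<longrightarrow> j < n \<longrightarrow> H (Suc j) x \<le> H j x)" if "d \<le> n" for d
    using that
  proof (induction d)
    case 0
    then show ?case using Q by auto
  next
    case (Suc d)
    then obtain H where H: "Q H" "\<And>k u v. array_lpp H k n u v = array_lpp F k n u v"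
      "\<And>j x. Suc n - d \<le> j \<Longrightarrow> 1 \<le> j \<Longrightarrow> j < n \<Longrightarrow> H (Suc j) x \<le> H j x"
      by auto
    define m where "m = n - d"
    have m: "1 \<le> m" "m \<le> n" using Suc.prems by (auto simp: m_def)
    obtain H' S where H': "Q H'" "\<forall>k u v. array_lpp H' k n u v = array_lpp H k n u v"
      "\<forall>j x. m \<le> j \<longrightarrow> j < n \<longrightarrow> j \<noteq> n \<longrightarrow> H' (Suc j) x \<le> H' j x"
      using pitman_insertion[where Q = Q and F = H and n = n and z = z and m = m and l = n]
        H(1) Q_pitman Q_cont Q_zero m H(3) by (auto simp: m_def)
    then show ?case using H(2) by (intro exI[of _ H']) (auto simp: m_def)
  qed
  from this[of n] obtain H where "Q H" "\<forall>k u v. array_lpp H k n u v = array_lpp F k n u v"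
    "\<forall>j x. 1 \<le> j \<longrightarrow> j < n \<longrightarrow> H (Suc j) x \<le> H j x"
    by auto
  then show thesis by (intro that[of H]) auto
qed

section \<open>Splitting jump times\<close>

typedef split_real = "(UNIV :: real set) \<times> {0..1 :: real}"
  by auto

definition base :: "split_real \<Rightarrow> real" where "base x = fst (Rep_split_real x)"
definition phase :: "split_real \<Rightarrow> real" where "phase x = snd (Rep_split_real x)"
text \<open>Clamping the phase to the unit interval makes \<open>spt\<close> total. The ends
  \<open>spt s 0\<close> and \<open>spt s 1\<close> of a fibre store the left limit and the value at
  \<open>s\<close>.\<close>

definition spt :: "real \<Rightarrow> real \<Rightarrow> split_real" where
  "spt s c = Abs_split_real (s, max 0 (min 1 c))"

lemma base_spt [simp]: "base (spt s c) = s"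
  and phase_spt [simp]: "phase (spt s c) = max 0 (min 1 c)"
  by (auto simp: base_def phase_def spt_def Abs_split_real_inverse)

lemma phase_bounds [simp]: "0 \<le> phase x" "phase x \<le> 1"
  using Rep_split_real[of x] by (auto simp: phase_def mem_Times_iff)

lemma split_real_eq_iff: "x = y \<longleftrightarrow> base x = base y \<and> phase x = phase y"
  by (metis Rep_split_real_inject base_def phase_def prod_eqI)

lemma spt_base_phase [simp]: "spt (base x) (phase x) = x"
  by (simp add: split_real_eq_iff)

instantiation split_real :: linorder
begin

definition less_eq_split_real :: "split_real \<Rightarrow> split_real \<Rightarrow> bool" where
  "x \<le> y \<longleftrightarrow> base x < base y \<or> base x = base y \<and> phase x \<le> phase y"
definition less_split_real :: "split_real \<Rightarrow> split_real \<Rightarrow> bool" where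
  "x < y \<longleftrightarrow> base x < base y \<or> base x = base y \<and> phase x < phase y"

instance
  by standard (auto simp: less_eq_split_real_def less_split_real_def split_real_eq_iff)

end

instantiation split_real :: linear_continuum_topology
begin

definition inf_split_real :: "split_real \<Rightarrow> split_real \<Rightarrow> split_real" where
  "inf_split_real x y = (if x \<le> y then x else y)"
definition sup_split_real :: "split_real \<Rightarrow> split_real \<Rightarrow> split_real" where
  "sup_split_real x y = (if x \<le> y then y else x)"
definition Sup_split_real :: "split_real set \<Rightarrow> split_real" where
  "Sup_split_real X = (THE z. (\<forall>x\<in>X. x \<le> z) \<and> (\<forall>y. (\<forall>x\<in>X. x \<le> y) \<longrightarrow> z \<le> y))"
definition Inf_split_real :: "split_real set \<Rightarrow> split_real" where
  "Inf_split_real X = Sup {z. \<forall>x\<in>X. z \<le> x}"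
definition open_split_real :: "split_real set \<Rightarrow> bool" where
  "open_split_real = generate_topology (range (\<lambda>a. {..<a}) \<union> range (\<lambda>a. {a<..}))"

instance
proof -
  have lub: "\<exists>z. (\<forall>x\<in>X. x \<le> z) \<and> (\<forall>y. (\<forall>x\<in>X. x \<le> y) \<longrightarrow> z \<le> y)"
    if ne: "X \<noteq> {}" and ub: "\<forall>x\<in>X. x \<le> b" for X :: "split_real set" and b
  proof -
    define s where "s = Sup (base ` X)"
    have bdd: "bdd_above (base ` X)"
      by (rule bdd_aboveI[of _ "base b"]) (use ub in \<open>auto simp: less_eq_split_real_def\<close>)
    have le_s: "base x \<le> s" if "x \<in> X" for x
      unfolding s_def using cSup_upper[OF _ bdd] that by auto
    have s_le: "s \<le> base y" if "\<forall>x\<in>X. x \<le> y" for y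
      unfolding s_def by (rule cSup_least) (use that ne in \<open>auto simp: less_eq_split_real_def\<close>)
    \<comment> \<open>If the supremum \<open>s\<close> of the bases is not attained, the least upper
      bound is the bottom of the fibre over \<open>s\<close>; otherwise it is the supremum of the
      phases within that fibre.\<close>
    show ?thesis
    proof (cases "s \<in> base ` X")
      case False
      show ?thesis
      proof (intro exI[of _ "spt s 0"] conjI ballI allI impI)
        fix x assume "x \<in> X"
        then show "x \<le> spt s 0" using le_s[of x] False by (auto simp: less_eq_split_real_def)
      next
        fix y assume "\<forall>x\<in>X. x \<le> y"
        then show "spt s 0 \<le> y" using s_le[of y] by (auto simp: less_eq_split_real_def)
      qed
    next
      case True
      define P where "P = phase ` {x\<in>X. base x = s}"
      have P: "P \<noteq> {}" "bdd_above P"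
        using True by (auto simp: P_def intro!: bdd_aboveI[of _ 1])
      define c where "c = Sup P"
      have c01: "0 \<le> c" "c \<le> 1"
      proof -
        obtain p where "p \<in> P" using P by blast
        then show "0 \<le> c" using cSup_upper[OF _ P(2), of p]
          by (auto simp: c_def P_def intro: order.trans[OF phase_bounds(1)])
        show "c \<le> 1" unfolding c_def by (rule cSup_least) (use P in \<open>auto simp: P_def\<close>)
      qed
      show ?thesis
      proof (intro exI[of _ "spt s c"] conjI ballI allI impI)
        fix x assume x: "x \<in> X"
        show "x \<le> spt s c"
        proof (cases "base x = s")
          case True
          then have "phase x \<le> c" unfolding c_def using x by (intro cSup_upper P(2)) (auto simp: P_def)
          then show ?thesis using True c01 by (auto simp: less_eq_split_real_def)
        next
          case False
          then show ?thesis using le_s[OF x] by (auto simp: less_eq_split_real_def)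
        qed
      next
        fix y assume y: "\<forall>x\<in>X. x \<le> y"
        show "spt s c \<le> y"
        proof (cases "base y = s")
          case True
          have "c \<le> phase y" unfolding c_def
            by (rule cSup_least[OF P(1)]) (use y True in \<open>auto simp: P_def less_eq_split_real_def\<close>)
          then show ?thesis using True c01 by (auto simp: less_eq_split_real_def)
        next
          case False
          then show ?thesis using s_le[OF y] by (auto simp: less_eq_split_real_def)
        qed
      qed
    qed
  qed
  have Sup: "(\<forall>x\<in>X. x \<le> Sup X) \<and> (\<forall>y. (\<forall>x\<in>X. x \<le> y) \<longrightarrow> Sup X \<le> y)"
    if ne: "X \<noteq> {}" and ub: "\<forall>x\<in>X. x \<le> b" for X :: "split_real set" and b
    unfolding Sup_split_real_def
  proof (rule theI')
    show "\<exists>!z. (\<forall>x\<in>X. x \<le> z) \<and> (\<forall>y. (\<forall>x\<in>X. x \<le> y) \<longrightarrow> z \<le> y)"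
      using lub[OF that] by (blast intro: order.antisym)
  qed
  show "OFCLASS(split_real, linear_continuum_topology_class)"
  proof
    fix x y z :: split_real and X :: "split_real set"
    show "inf x y \<le> x" "inf x y \<le> y" "x \<le> y \<Longrightarrow> x \<le> z \<Longrightarrow> x \<le> inf y z"
      "x \<le> sup x y" "y \<le> sup x y" "y \<le> x \<Longrightarrow> z \<le> x \<Longrightarrow> sup y z \<le> x"
      by (auto simp: inf_split_real_def sup_split_real_def less_eq_split_real_def)
    show "x \<le> Sup X" if x: "x \<in> X" "bdd_above X"
    proof -
      obtain b where "\<forall>x\<in>X. x \<le> b" using x(2) unfolding bdd_above_def by blast
      then show ?thesis using Sup[of X b] x(1) by blast
    qed
    show "Sup X \<le> z" if "X \<noteq> {}" "\<And>x. x \<in> X \<Longrightarrow> x \<le> z"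
      using Sup[of X z] that by blast
    show "Inf X \<le> x" if x: "x \<in> X" "bdd_below X"
    proof -
      obtain b where b: "\<forall>x\<in>X. b \<le> x" using x(2) unfolding bdd_below_def by blast
      then have "{z. \<forall>x\<in>X. z \<le> x} \<noteq> {}" by blast
      then show ?thesis using Sup[of "{z. \<forall>x\<in>X. z \<le> x}" x] x(1) unfolding Inf_split_real_def by blast
    qed
    show "z \<le> Inf X" if ne: "X \<noteq> {}" and lb: "\<And>x. x \<in> X \<Longrightarrow> z \<le> x"
    proof -
      obtain x where "x \<in> X" using ne by blast
      then have "\<forall>y\<in>{z. \<forall>x\<in>X. z \<le> x}. y \<le> x" by blast
      moreover have "z \<in> {z. \<forall>x\<in>X. z \<le> x}" using lb by blast
      ultimately show ?thesis using Sup[of "{z. \<forall>x\<in>X. z \<le> x}" x] unfolding Inf_split_real_def by blast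
    qed
    show "\<exists>a b :: split_real. a \<noteq> b"
      by (intro exI[of _ "spt 0 0"] exI[of _ "spt 1 0"]) (simp add: split_real_eq_iff)
    show "\<exists>z. x < z \<and> z < y" if "x < y"
    proof (cases "base x = base y")
      case True
      then have "phase x < (phase x + phase y) / 2" "(phase x + phase y) / 2 < phase y"
        using that by (auto simp: less_split_real_def)
      moreover have "0 \<le> (phase x + phase y) / 2 \<and> (phase x + phase y) / 2 \<le> 1"
        using add_mono[OF phase_bounds(2)[of x] phase_bounds(2)[of y]] by simp
      ultimately show ?thesis using True
        by (intro exI[of _ "spt (base x) ((phase x + phase y) / 2)"]) (auto simp: less_split_real_def)
    next
      case False
      then show ?thesis using that
        by (intro exI[of _ "spt ((base x + base y) / 2) 0"]) (auto simp: less_split_real_def)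
    qed
    show "open = generate_topology (range (\<lambda>a :: split_real. {..<a}) \<union> range (\<lambda>a. {a<..}))"
      unfolding open_split_real_def ..
  qed
qed

end

instance split_real :: no_top
proof
  fix x :: split_real
  show "\<exists>y. x < y" by (intro exI[of _ "spt (base x + 1) 0"]) (simp add: less_split_real_def)
qed

instance split_real :: no_bot
proof
  fix x :: split_real
  show "\<exists>y. y < x" by (intro exI[of _ "spt (base x - 1) 0"]) (simp add: less_split_real_def)
qed

lemma base_mono: "u \<le> v \<Longrightarrow> base u \<le> base v"
  by (auto simp: less_eq_split_real_def)

lemma le_spt_1_iff [simp]: "u \<le> spt s 1 \<longleftrightarrow> base u \<le> s"
  and spt_0_le_iff [simp]: "spt s 0 \<le> u \<longleftrightarrow> s \<le> base u"
  and spt_1_less_iff [simp]: "spt s 1 < u \<longleftrightarrow> s < base u"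
  and less_spt_0_iff [simp]: "u < spt s 0 \<longleftrightarrow> base u < s"
  using phase_bounds[of u]
  by (auto simp: less_eq_split_real_def less_split_real_def simp del: phase_bounds)

lemma continuous_on_nhds_splitI:
  fixes F :: "'a::linorder_topology \<Rightarrow> real"
  assumes l: "\<And>u e. 0 < e \<Longrightarrow> \<exists>a<u. \<forall>w. a < w \<longrightarrow> w \<le> u \<longrightarrow> \<bar>F w - F u\<bar> < e"
    and r: "\<And>u e. 0 < e \<Longrightarrow> \<exists>b>u. \<forall>w. u \<le> w \<longrightarrow> w < b \<longrightarrow> \<bar>F w - F u\<bar> < e"
  shows "continuous_on UNIV F"
  unfolding continuous_on_def
proof (intro ballI tendstoI)
  fix u and e :: real assume "0 < e"
  obtain a where a: "a < u" "\<forall>w. a < w \<longrightarrow> w \<le> u \<longrightarrow> \<bar>F w - F u\<bar> < e" using l[OF \<open>0 < e\<close>] by blast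
  obtain b where b: "u < b" "\<forall>w. u \<le> w \<longrightarrow> w < b \<longrightarrow> \<bar>F w - F u\<bar> < e" using r[OF \<open>0 < e\<close>] by blast
  have "eventually (\<lambda>w. w \<in> {a<..<b}) (nhds u)"
    using a b by (intro eventually_nhds_in_open) auto
  then have "eventually (\<lambda>w. dist (F w) (F u) < e) (nhds u)"
  proof (rule eventually_mono)
    fix w assume "w \<in> {a<..<b}"
    then show "dist (F w) (F u) < e" using a(2) b(2) linear[of u w] by (auto simp: dist_real_def)
  qed
  then show "eventually (\<lambda>w. dist (F w) (F u) < e) (at u within UNIV)"
    using eventually_nhds_conv_at by auto
qed

lemma continuous_on_nhds_splitD:
  fixes F :: "'a::{linorder_topology, no_top, no_bot} \<Rightarrow> real"
  assumes "continuous_on UNIV F" "0 < e"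
  obtains a b where "a < u" "u < b" "\<And>w. a < w \<Longrightarrow> w < b \<Longrightarrow> \<bar>F w - F u\<bar> < e"
proof -
  have op: "open {w. \<bar>F w - F u\<bar> < e}"
    using assms by (intro open_Collect_less continuous_intros) auto
  have u: "u \<in> {w. \<bar>F w - F u\<bar> < e}" using assms by simp
  obtain x y where "x < u" "u < y" using lt_ex gt_ex by blast
  obtain a where a: "a < u" "{a<..u} \<subseteq> {w. \<bar>F w - F u\<bar> < e}" using open_left[OF op u \<open>x < u\<close>] by blast
  obtain b where b: "u < b" "{u..<b} \<subseteq> {w. \<bar>F w - F u\<bar> < e}" using open_right[OF op u \<open>u < y\<close>] by blast
  have "\<bar>F w - F u\<bar> < e" if "a < w" "w < b" for w
  proof (cases "w \<le> u")
    case True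
    then have "w \<in> {a<..u}" using that by simp
    then show ?thesis using a(2) by blast
  next
    case False
    then have "w \<in> {u..<b}" using that by simp
    then show ?thesis using b(2) by blast
  qed
  then show thesis using that[of a b] a(1) b(1) by blast
qed

text \<open>Every neighbourhood of \<open>spt s 0\<close> contains all fibres over some interval to
  the left of \<open>s\<close>, so the phase \<open>c\<close> has no influence on the limit.\<close>

lemma tendsto_spt_left:
  fixes F :: "split_real \<Rightarrow> real"
  assumes "continuous_on UNIV F"
  shows "((\<lambda>x. F (spt x c)) \<longlongrightarrow> F (spt s 0)) (at_left s)"
proof (rule tendstoI)
  fix e :: real assume "0 < e"
  obtain a b where ab: "a < spt s 0" "spt s 0 < b" "\<And>w. a < w \<Longrightarrow> w < b \<Longrightarrow> \<bar>F w - F (spt s 0)\<bar> < e"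
    by (rule continuous_on_nhds_splitD[OF assms \<open>0 < e\<close>, of "spt s 0"]) blast
  have "eventually (\<lambda>x. x \<in> {base a<..<s}) (at_left s)"
    using ab(1) by (intro eventually_at_left_real) simp
  then show "eventually (\<lambda>x. dist (F (spt x c)) (F (spt s 0)) < e) (at_left s)"
  proof (rule eventually_mono)
    fix x assume x: "x \<in> {base a<..<s}"
    have "a < spt x c" using x by (simp add: less_split_real_def)
    moreover have "spt x c < b"
      by (rule less_trans[OF _ ab(2)]) (use x in simp)
    ultimately show "dist (F (spt x c)) (F (spt s 0)) < e" using ab(3) by (simp add: dist_real_def)
  qed
qed

lemma tendsto_spt_right:
  fixes F :: "split_real \<Rightarrow> real"
  assumes "continuous_on UNIV F"
  shows "((\<lambda>x. F (spt x c)) \<longlongrightarrow> F (spt s 1)) (at_right s)"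
proof (rule tendstoI)
  fix e :: real assume "0 < e"
  obtain a b where ab: "a < spt s 1" "spt s 1 < b" "\<And>w. a < w \<Longrightarrow> w < b \<Longrightarrow> \<bar>F w - F (spt s 1)\<bar> < e"
    by (rule continuous_on_nhds_splitD[OF assms \<open>0 < e\<close>, of "spt s 1"]) blast
  have "eventually (\<lambda>x. x \<in> {s<..<base b}) (at_right s)"
    using ab(2) by (intro eventually_at_right_real) simp
  then show "eventually (\<lambda>x. dist (F (spt x c)) (F (spt s 1)) < e) (at_right s)"
  proof (rule eventually_mono)
    fix x assume x: "x \<in> {s<..<base b}"
    have "spt x c < b" using x by (simp add: less_split_real_def)
    moreover have "a < spt x c"
      by (rule less_trans[OF ab(1)]) (use x in simp)
    ultimately show "dist (F (spt x c)) (F (spt s 1)) < e" using ab(3) by (simp add: dist_real_def)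
  qed
qed

lemma left_lim_eqI:
  assumes "continuous_on UNIV F" "eventually (\<lambda>x. f x = F (spt x 1)) (at_left s)"
  shows "left_lim f s = F (spt s 0)"
proof -
  have "(f \<longlongrightarrow> F (spt s 0)) (at_left s)"
    using tendsto_cong[OF assms(2)] tendsto_spt_left[OF assms(1), of 1] by simp
  then show ?thesis unfolding left_lim_def by (intro tendsto_Lim) auto
qed

text \<open>By the last clause, a line only starts its ramp after all lower lines have finished theirs, so
  that paths, which run from low lines to high ones, can collect all simultaneous jumps.\<close>

definition line_ensemble :: "nat \<Rightarrow> (nat \<Rightarrow> split_real \<Rightarrow> real) \<Rightarrow> bool" where
  "line_ensemble n F \<longleftrightarrow> (\<forall>j. continuous_on UNIV (F j)) \<and> (\<forall>j u. u \<le> spt 0 0 \<longrightarrow> F j u = 0) \<and>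
     (\<forall>j u. j \<notin> {1..n} \<longrightarrow> F j u = 0) \<and>
     (\<forall>j u v. base u = base v \<longrightarrow> u \<le> v \<longrightarrow> F j u \<le> F j v) \<and>
     (\<forall>i j u. i < j \<longrightarrow> F i u = F i (spt (base u) 0) \<or> F j u = F j (spt (base u) 1))"

lemma line_ensembleD:
  assumes "line_ensemble n F"
  shows "continuous_on UNIV (F j)" "u \<le> spt 0 0 \<Longrightarrow> F j u = 0" "j \<notin> {1..n} \<Longrightarrow> F j u = 0"
    "base u = base v \<Longrightarrow> u \<le> v \<Longrightarrow> F j u \<le> F j v"
    "i < j \<Longrightarrow> F i u = F i (spt (base u) 0) \<or> F j u = F j (spt (base u) 1)"
  using assms unfolding line_ensemble_def by auto

text \<open>\<open>d j\<close> is the last point of the fibre at which the lines up to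
  \<open>j\<close> are still at rest. If line \<open>j + 1\<close> had not finished there, it would
  be unfinished slightly later as well; the ramp order would then keep the higher lines at rest
  beyond \<open>d j\<close>.\<close>

lemma line_ensemble_cuts:
  assumes "line_ensemble n F"
  obtains d where "\<And>j. base (d j) = s" "\<And>j. d (Suc j) \<le> d j"
    "\<And>j. F j (d j) = F j (spt s 0)" "\<And>j. F (Suc j) (d j) = F (Suc j) (spt s 1)"
proof -
  note D = line_ensembleD[OF assms]
  define K where "K j = {spt s 0..spt s 1} \<inter> {w. \<forall>i. i \<le> j \<longrightarrow> F i w = F i (spt s 0)}" for j
  have "compact (K j)" for j
    unfolding K_def
    by (intro compact_Int_closed compact_Icc_linear_continuum closed_Collect_all closed_Collect_imp closed_Collect_eq
        open_Collect_const D(1))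
       auto
  moreover have lo: "spt s 0 \<in> K j" for j by (auto simp: K_def)
  ultimately have "\<forall>j. \<exists>d\<in>K j. \<forall>w\<in>K j. w \<le> d"
    by (metis compact_attains_sup empty_iff)
  then obtain d where d: "\<And>j. d j \<in> K j" "\<And>j w. w \<in> K j \<Longrightarrow> w \<le> d j" by metis
  have base: "base w = s" if "spt s 0 \<le> w" "w \<le> spt s 1" for w using that by simp
  have bd: "base (d j) = s" for j using d(1)[of j] base by (auto simp: K_def)
  have ini: "F i (d j) = F i (spt s 0)" if "i \<le> j" for i j using d(1)[of j] that by (auto simp: K_def)
  show thesis
  proof (rule that[of d])
    show "base (d j) = s" "F j (d j) = F j (spt s 0)" for j using bd ini by auto
    show "d (Suc j) \<le> d j" for j
      by (rule d(2)) (use d(1)[of "Suc j"] in \<open>auto simp: K_def\<close>)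
    show "F (Suc j) (d j) = F (Suc j) (spt s 1)" for j
    proof (rule ccontr)
      assume neq: "F (Suc j) (d j) \<noteq> F (Suc j) (spt s 1)"
      then have "d j \<noteq> spt s 1" by auto
      then have lt: "d j < spt s 1" using bd[of j] by (simp add: order.strict_iff_order)
      have "open {w. F (Suc j) w \<noteq> F (Suc j) (spt s 1)}"
        by (intro open_Collect_neq D(1)) auto
      then obtain b where b: "d j < b" "{d j..<b} \<subseteq> {w. F (Suc j) w \<noteq> F (Suc j) (spt s 1)}"
        using open_right[OF _ _ lt] neq by blast
      obtain w where w: "d j < w" "w < min b (spt s 1)"
        using dense[of "d j" "min b (spt s 1)"] b(1) lt by auto
      then have wd: "w \<in> {d j..<b}" by auto
      have "s \<le> base w" using bd[of j] base_mono[of "d j" w] w by auto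
      moreover have "base w \<le> s" using le_spt_1_iff[THEN iffD1, OF less_imp_le, of w s] w by simp
      ultimately have bw: "base w = s" by simp
      have fin: "F (Suc j) w \<noteq> F (Suc j) (spt s 1)" using wd b(2) by blast
      have "F i w = F i (spt s 0)" if "i \<le> j" for i
        using D(5)[of i "Suc j" w] fin bw that by auto
      then have "w \<in> K j" using bw by (auto simp: K_def)
      then show False using d(2)[of w j] w(1) by auto
    qed
  qed
qed

lemma line_ensemble_pitman:
  assumes le: "line_ensemble n F" and m: "1 \<le> m" "m < n"
  shows "line_ensemble n (pitman m F)"
proof -
  note D = line_ensembleD[OF le]
  define G where "G x = F (Suc m) x - F m x" for x
  define S where "S = running_max G"
  interpret running_maximum G "spt 0 0" S
    by standard (use D in \<open>auto simp: G_def S_def intro!: continuous_intros\<close>)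
  define H where "H = pitman m F"
  have Hm: "H m x = F m x + S x" and HSm: "H (Suc m) x = F (Suc m) x - S x" for x
    unfolding H_def pitman_def Let_def S_def G_def by auto
  have Hj: "H j = F j" if "j \<noteq> m" "j \<noteq> Suc m" for j
    unfolding H_def pitman_def Let_def using that by auto
  have mid: "base w = base u" if "u \<le> w" "w \<le> v" "base u = base v" for u v w
    using base_mono[OF that(1)] base_mono[OF that(2)] that(3) by simp
  \<comment> \<open>This settles the comparison with a third line: while that line moves, lines
    \<open>m\<close> and \<open>Suc m\<close> rest, and then so does \<open>S\<close>.\<close>
  have S_const: "S u = S v"
    if uv: "base u = base v" "u \<le> v" and eq: "F m u = F m v" "F (Suc m) u = F (Suc m) v" for u v
  proof (rule ccontr)
    assume "S u \<noteq> S v"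
    then have "S u < S v" using mono[OF uv(2)] by simp
    then obtain w where w: "u < w" "w \<le> v" "S v = G w" using attained_between uv(2) by blast
    have bw: "base w = base u" using mid[of u w v] w uv by simp
    have "F m w = F m u" "F (Suc m) w = F (Suc m) u"
      using D(4)[of u w] D(4)[of w v] w uv bw eq by (metis less_imp_le order.antisym)+
    then have "S v = G u" using w by (simp add: G_def)
    then show False using upper[of u u] \<open>S u < S v\<close> by simp
  qed
  have lo: "base (spt (base u) 0) = base u" "spt (base u) 0 \<le> u" for u by auto
  have hi: "base u = base (spt (base u) 1)" "u \<le> spt (base u) 1" for u by auto
  have mono': "H j u \<le> H j v" if uv: "base u = base v" "u \<le> v" for j u v
  proof -
    consider "j = m" | "j = Suc m" | "j \<noteq> m" "j \<noteq> Suc m" by blast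
    then show ?thesis
    proof cases
      case 1
      then show ?thesis using D(4)[OF uv, of m] mono[OF uv(2)] by (simp add: Hm)
    next
      case 2
      show ?thesis
      proof (cases "S u < S v")
        case True
        \<comment> \<open>At \<open>w\<close> the new line \<open>Suc m\<close> equals
          \<open>F m\<close>, which is nondecreasing in the fibre; at \<open>u\<close> it is at most
          \<open>F m\<close>, because \<open>G \<le> S\<close>.\<close>
        then obtain w where w: "u < w" "w \<le> v" "S v = G w" using attained_between uv(2) by blast
        have bw: "base w = base u" using mid[of u w v] w uv by simp
        have "F (Suc m) w \<le> F (Suc m) v" "F m u \<le> F m w"
          using D(4)[of w v "Suc m"] D(4)[of u w m] w uv bw by auto
        then show ?thesis using upper[of u u] w(3) 2 by (simp add: HSm G_def)
      next
        case False
        then show ?thesis using D(4)[OF uv, of "Suc m"] 2 mono[OF uv(2)] by (simp add: HSm)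
      qed
    next
      case 3
      then show ?thesis using D(4)[OF uv] by (simp add: Hj)
    qed
  qed
  have seq: "H i u = H i (spt (base u) 0) \<or> H j u = H j (spt (base u) 1)" if ij: "i < j" for i j u
  proof -
    let ?lo = "spt (base u) 0" and ?hi = "spt (base u) 1"
    consider "j \<noteq> m" "j \<noteq> Suc m" "i \<noteq> m" "i \<noteq> Suc m" | "i < m" "j = m \<or> j = Suc m"
      | "Suc m < j" "i = m \<or> i = Suc m" | "i = m" "j = Suc m" using ij by linarith
    then show ?thesis
    proof cases
      case 1
      then show ?thesis using D(5)[OF ij] by (simp add: Hj)
    next
      case 2
      show ?thesis
      proof (cases "F i u = F i ?lo")
        case True
        then show ?thesis using 2 by (simp add: Hj)
      next
        case False
        then have "F m u = F m ?hi" "F (Suc m) u = F (Suc m) ?hi"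
          using D(5)[of i m u] D(5)[of i "Suc m" u] 2 by auto
        then show ?thesis using S_const[OF hi[of u]] 2 by (auto simp: Hm HSm)
      qed
    next
      case 3
      show ?thesis
      proof (cases "F j u = F j ?hi")
        case True
        then show ?thesis using 3 by (simp add: Hj)
      next
        case False
        then have "F m u = F m ?lo" "F (Suc m) u = F (Suc m) ?lo"
          using D(5)[of m j u] D(5)[of "Suc m" j u] 3 by auto
        then show ?thesis using S_const[OF lo[of u]] 3 by (auto simp: Hm HSm)
      qed
    next
      case 4
      obtain d where d: "\<And>j. base (d j) = base u" "\<And>j. F j (d j) = F j ?lo"
        "\<And>j. F (Suc j) (d j) = F (Suc j) ?hi"
        by (rule line_ensemble_cuts[OF le, of "base u"]) blast
      \<comment> \<open>Up to the cut only line \<open>Suc m\<close> moves and \<open>G\<close>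
        increases; beyond it only line \<open>m\<close> moves and \<open>G\<close> decreases. So
        once \<open>S\<close> starts to grow it follows \<open>G\<close> up to the cut and then
        stops. From that start on the new line \<open>Suc m\<close> is frozen, and before it the new
        line \<open>m\<close> rests.\<close>
      let ?d = "d m"
      show ?thesis
      proof (cases "?d \<le> u")
        case True
        have fin: "F (Suc m) w = F (Suc m) ?hi" if "?d \<le> w" "base w = base u" for w
          using D(4)[of ?d w "Suc m"] D(4)[of w ?hi "Suc m"] that d(3)[of m] d(1)[of m] by simp
        have "S ?hi \<le> S u"
        proof (rule ccontr)
          assume "\<not> S ?hi \<le> S u"
          then obtain w where w: "u < w" "w \<le> ?hi" "S ?hi = G w"
            using attained_between[of u ?hi] hi by auto
          have bw: "base w = base u" using mid[of u w ?hi] w by simp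
          have "G w \<le> G u"
            using fin[of w] fin[of u] D(4)[of u w m] w bw True by (simp add: G_def)
          then show False using upper[of u u] w \<open>\<not> S ?hi \<le> S u\<close> by simp
        qed
        then have "S u = S ?hi" using mono[of u ?hi] by simp
        then show ?thesis using fin[OF True refl] 4 by (simp add: HSm)
      next
        case False
        then have ud: "u \<le> ?d" by simp
        have ini: "F m w = F m ?lo" if "w \<le> ?d" "base w = base u" for w
          using D(4)[of w ?d m] D(4)[of ?lo w m] that d(1,2)[of m] by simp
        show ?thesis
        proof (cases "S ?lo < S u")
          case False
          then have "S u = S ?lo" using mono[of ?lo u] by simp
          then show ?thesis using ini[OF ud refl] 4 by (simp add: Hm)
        next
          case True
          have *: "H (Suc m) w = F m ?lo" if w: "u \<le> w" "w \<le> ?d" for w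
          proof -
            have bw: "base w = base u" using mid[of u w ?d] w d(1) by simp
            have "S ?lo < S w" using True mono[OF w(1)] by simp
            then obtain y where y: "?lo < y" "y \<le> w" "S w = G y"
              using attained_between[of ?lo w] bw by auto
            have by': "base y = base u" using mid[OF less_imp_le[OF y(1)] y(2)] bw by simp
            have "G y \<le> G w"
              using ini[of w] ini[of y] D(4)[of y w "Suc m"] y by' bw w by (simp add: G_def)
            then have "S w = G w" using upper[of w w] y by simp
            then show ?thesis using ini[OF w(2) bw] by (simp add: HSm G_def)
          qed
          have "H (Suc m) ?d = H (Suc m) ?hi"
          proof (rule antisym)
            show "H (Suc m) ?d \<le> H (Suc m) ?hi" using mono'[of ?d ?hi] d(1) by simp
            show "H (Suc m) ?hi \<le> H (Suc m) ?d"
              using d(3)[of m] mono[of ?d ?hi] d(1) by (simp add: HSm)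
          qed
          then show ?thesis using *[of u] *[of ?d] ud 4 by simp
        qed
      qed
    qed
  qed
  have "H m = (\<lambda>x. F m x + S x)" "H (Suc m) = (\<lambda>x. F (Suc m) x - S x)"
    using Hm HSm by auto
  then have "continuous_on UNIV (H j)" for j
    using D(1) continuous Hj[of j]
    by (cases "j = m"; cases "j = Suc m") (simp_all add: continuous_on_add continuous_on_diff)
  moreover have "H j u = 0" if "u \<le> spt 0 0" for j u
    using D(2)[OF that] S_zero[OF that] Hj[of j] Hm[of u] HSm[of u]
    by (cases "j = m"; cases "j = Suc m") auto
  moreover have "H j u = 0" if "j \<notin> {1..n}" for j u
    using D(3)[OF that] Hj[of j] that m by auto
  ultimately show ?thesis
    unfolding line_ensemble_def H_def[symmetric] using mono' seq by blast
qed

section \<open>Cadlag functions and their extensions into the fibres\<close>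

definition sample :: "(nat \<Rightarrow> split_real \<Rightarrow> real) \<Rightarrow> nat \<Rightarrow> real \<Rightarrow> real" where
  "sample F = (\<lambda>i x. F i (spt x 1))"

lemma left_lim_sample:
  assumes "line_ensemble n F"
  shows "left_lim (sample F i) s = F i (spt s 0)"
  by (rule left_lim_eqI[OF line_ensembleD(1)[OF assms]]) (simp add: sample_def)

lemma spt_mono: "s < s' \<Longrightarrow> spt s c \<le> spt s' c'"
  by (simp add: less_eq_split_real_def)

lemma sample_in_Dn:
  assumes "line_ensemble n F"
  shows "sample F \<in> Dn n"
proof -
  note D = line_ensembleD[OF assms]
  have "continuous (at_right x) (sample F i)" for i x
    using tendsto_spt_right[OF D(1), of i 1 x]
    by (simp add: continuous_within sample_def)
  moreover have "(sample F i \<longlongrightarrow> F i (spt x 0)) (at_left x)" for i x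
    using tendsto_spt_left[OF D(1), of i 1 x] by (simp add: sample_def)
  ultimately have "cadlag (sample F i)" for i unfolding cadlag_def by blast
  moreover have "left_lim (sample F i) x \<le> sample F i x" for i x
    unfolding left_lim_sample[OF assms] using D(4)[of "spt x 0" "spt x 1" i] by (simp add: sample_def)
  moreover have "0 \<le> sample F i 0" for i
    using D(4)[of "spt 0 0" "spt 0 1" i] D(2)[of "spt 0 0" i] by (simp add: sample_def)
  moreover have "sample F i x = 0" if "i \<notin> {1..n} \<or> x < 0" for i x
    using that D(2)[of "spt x 1" i] D(3)[of i "spt x 1"] spt_mono[of x 0 1 0]
    by (auto simp: sample_def)
  ultimately show ?thesis unfolding Dn_def by blast
qed

lemma DnD:
  assumes "f \<in> Dn n"
  shows "i \<notin> {1..n} \<Longrightarrow> f i x = 0" "x < 0 \<Longrightarrow> f i x = 0"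
    "(f i \<longlongrightarrow> left_lim (f i) s) (at_left s)" "(f i \<longlongrightarrow> f i s) (at_right s)"
    "left_lim (f i) s \<le> f i s" "s \<le> 0 \<Longrightarrow> left_lim (f i) s = 0"
proof -
  show 1: "f i x = 0" if "i \<notin> {1..n}" for i x using assms that unfolding Dn_def by blast
  show 2: "f i x = 0" if "x < 0" for i x using assms that unfolding Dn_def by blast
  have cad: "cadlag (f i)" if "i \<in> {1..n}" for i using assms that unfolding Dn_def by blast
  have const: "(f i \<longlongrightarrow> 0) (at_left s)" "left_lim (f i) s = 0" if "i \<notin> {1..n} \<or> s \<le> 0" for i s
  proof -
    have "eventually (\<lambda>x. f i x = 0) (at_left s)"
      by (rule eventually_mono[OF eventually_at_left_real[of "s - 1"]]) (use that 1 2 in auto)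
    then show "(f i \<longlongrightarrow> 0) (at_left s)" by (rule tendsto_eventually)
    then show "left_lim (f i) s = 0" unfolding left_lim_def by (intro tendsto_Lim) auto
  qed
  show "s \<le> 0 \<Longrightarrow> left_lim (f i) s = 0" using const by blast
  show "(f i \<longlongrightarrow> left_lim (f i) s) (at_left s)"
  proof (cases "i \<notin> {1..n} \<or> s \<le> 0")
    case True
    then show ?thesis using const by metis
  next
    case False
    then have "cadlag (f i)" "0 \<le> s" using cad[of i] by auto
    then obtain l where "(f i \<longlongrightarrow> l) (at_left s)" unfolding cadlag_def by blast
    moreover from this have "left_lim (f i) s = l" unfolding left_lim_def by (intro tendsto_Lim) auto
    ultimately show ?thesis by simp
  qed
  show "(f i \<longlongrightarrow> f i s) (at_right s)"
  proof (cases "i \<notin> {1..n} \<or> s < 0")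
    case True
    have "eventually (\<lambda>x. f i x = 0) (at_right s)"
    proof (cases "s < 0")
      case True
      then show ?thesis
        by (intro eventually_mono[OF eventually_at_right_real]) (use 2 in auto)
    next
      case False
      then show ?thesis using 1 True by simp
    qed
    then have "(f i \<longlongrightarrow> 0) (at_right s)" by (rule tendsto_eventually)
    then show ?thesis using 1 2 True by (metis)
  next
    case False
    then have "cadlag (f i)" "0 \<le> s" using cad[of i] by auto
    then show ?thesis unfolding cadlag_def continuous_within by blast
  qed
  show "left_lim (f i) s \<le> f i s"
  proof (cases "i \<notin> {1..n} \<or> s < 0")
    case True
    then show ?thesis using const[of i s] 1 2 by auto
  next
    case False
    then show ?thesis using assms unfolding Dn_def by auto
  qed
qed

definition ramp :: "nat \<Rightarrow> nat \<Rightarrow> real \<Rightarrow> real" where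
  "ramp n j c = max 0 (min 1 (real n * c - (real n - real j)))"

definition unfold_jumps :: "nat \<Rightarrow> (nat \<Rightarrow> real \<Rightarrow> real) \<Rightarrow> nat \<Rightarrow> split_real \<Rightarrow> real" where
  "unfold_jumps n f j u = left_lim (f j) (base u) +
     ramp n j (phase u) * (f j (base u) - left_lim (f j) (base u))"

lemma ramp_bounds: "0 \<le> ramp n j c" "ramp n j c \<le> 1"
  by (auto simp: ramp_def)

lemma ramp_mono: "c \<le> c' \<Longrightarrow> ramp n j c \<le> ramp n j c'"
proof -
  assume "c \<le> c'"
  then have "real n * c \<le> real n * c'" by (intro mult_left_mono) auto
  then show ?thesis unfolding ramp_def by linarith
qed

lemma ramp_0: "j \<le> n \<Longrightarrow> ramp n j 0 = 0" and ramp_1: "1 \<le> j \<Longrightarrow> ramp n j 1 = 1"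
  by (auto simp: ramp_def)

lemma ramp_sequential: "i < j \<Longrightarrow> ramp n i c = 0 \<or> ramp n j c = 1"
proof -
  assume "i < j"
  then have "real i + 1 \<le> real j" by linarith
  then show ?thesis unfolding ramp_def by linarith
qed

lemma unfold_jumps_bounds:
  assumes "f \<in> Dn n"
  shows "left_lim (f j) (base u) \<le> unfold_jumps n f j u" "unfold_jumps n f j u \<le> f j (base u)"
proof -
  have d: "0 \<le> f j (base u) - left_lim (f j) (base u)" using DnD(5)[OF assms, of j "base u"] by simp
  show "left_lim (f j) (base u) \<le> unfold_jumps n f j u"
    unfolding unfold_jumps_def using mult_nonneg_nonneg[OF ramp_bounds(1) d, of n j "phase u"] by simp
  show "unfold_jumps n f j u \<le> f j (base u)"
    unfolding unfold_jumps_def using mult_right_mono[OF ramp_bounds(2) d, of n j "phase u"] by simp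
qed

lemma unfold_jumps_spt:
  assumes "f \<in> Dn n"
  shows "unfold_jumps n f j (spt s 0) = left_lim (f j) s" "unfold_jumps n f j (spt s 1) = f j s"
proof -
  have 0: "f j s = 0" "left_lim (f j) s = 0" if "j \<notin> {1..n}"
    using DnD(1)[OF assms that] by (auto simp: left_lim_def fun_eq_iff[symmetric] intro!: tendsto_Lim tendsto_eventually)
  show "unfold_jumps n f j (spt s 0) = left_lim (f j) s" "unfold_jumps n f j (spt s 1) = f j s"
    using 0 ramp_0[of j n] ramp_1[of j n] by (cases "j \<in> {1..n}"; simp add: unfold_jumps_def)+
qed

lemma sample_unfold_jumps: "f \<in> Dn n \<Longrightarrow> sample (unfold_jumps n f) = f"
  by (intro ext) (simp add: sample_def unfold_jumps_spt)

lemma left_lim_close: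
  fixes g :: "real \<Rightarrow> real"
  assumes "(g \<longlongrightarrow> left_lim g s) (at_left s)" "\<And>x. a < x \<Longrightarrow> x < s \<Longrightarrow> \<bar>g x - c\<bar> \<le> e" "a < s"
  shows "\<bar>left_lim g s - c\<bar> \<le> e"
proof (rule tendsto_upperbound)
  show "((\<lambda>x. \<bar>g x - c\<bar>) \<longlongrightarrow> \<bar>left_lim g s - c\<bar>) (at_left s)"
    by (intro tendsto_intros assms(1))
  show "eventually (\<lambda>x. \<bar>g x - c\<bar> \<le> e) (at_left s)"
    using eventually_at_left_real[OF assms(3)] by (rule eventually_mono) (use assms(2) in auto)
qed simp

lemma line_ensemble_unfold_jumps:
  assumes f: "f \<in> Dn n"
  shows "line_ensemble n (unfold_jumps n f)"
proof -
  note D = DnD[OF f] and B = unfold_jumps_bounds[OF f]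
  let ?F = "unfold_jumps n f"
  have cont: "continuous_on UNIV (?F j)" for j
  proof (rule continuous_on_nhds_splitI)
    fix u and e :: real assume e: "0 < e"
    define s where "s = base u"
    define J where "J = f j s - left_lim (f j) s"
    have J: "0 \<le> J" using D(5)[of j s] by (simp add: J_def)
    \<comment> \<open>A ramp has slope at most \<open>n\<close>, so the line is Lipschitz in the
      phase with constant \<open>n * J\<close>; the added 1 covers the case without a jump.\<close>
    define d where "d = e / (real n * J + 1)"
    have d: "0 < d" "d * (real n * J) < e"
    proof -
      have pos: "0 < real n * J + 1" using J by (simp add: add_nonneg_pos)
      then show "0 < d" using e by (simp add: d_def)
      have "d * (real n * J) < d * (real n * J + 1)" using \<open>0 < d\<close> by simp
      also have "\<dots> = e" using pos by (simp add: d_def)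
      finally show "d * (real n * J) < e" .
    qed
    have fibre: "\<bar>?F j w - ?F j u\<bar> < e" if w: "base w = s" "\<bar>phase w - phase u\<bar> < d" for w
    proof -
      have "?F j w - ?F j u = (ramp n j (phase w) - ramp n j (phase u)) * J"
        unfolding unfold_jumps_def J_def w(1) s_def[symmetric] by (simp add: algebra_simps)
      moreover have "\<bar>ramp n j (phase w) - ramp n j (phase u)\<bar> \<le> \<bar>real n * phase w - real n * phase u\<bar>"
        unfolding ramp_def by linarith
      then have "\<bar>ramp n j (phase w) - ramp n j (phase u)\<bar> \<le> real n * \<bar>phase w - phase u\<bar>"
        by (simp add: abs_mult flip: right_diff_distrib)
      then have "\<bar>ramp n j (phase w) - ramp n j (phase u)\<bar> \<le> real n * d"
        using w(2) by (smt (verit) mult_left_mono of_nat_0_le_iff)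
      then have "\<bar>ramp n j (phase w) - ramp n j (phase u)\<bar> * J \<le> real n * d * J"
        using J by (intro mult_right_mono)
      ultimately show ?thesis using d(2) J by (simp add: abs_mult mult_ac)
    qed
    \<comment> \<open>In every fibre the extension lies between the left limit and the value, so
      closeness of these two controls the whole fibre.\<close>
    have near: "\<bar>?F j w - c\<bar> < e" if "\<bar>f j (base w) - c\<bar> \<le> e / 2" "\<bar>left_lim (f j) (base w) - c\<bar> \<le> e / 2" for w c
      using B[of j w] that e by linarith
    show "\<exists>a<u. \<forall>w. a < w \<longrightarrow> w \<le> u \<longrightarrow> \<bar>?F j w - ?F j u\<bar> < e"
    proof (cases "phase u = 0")
      case False
      then have pu: "0 < phase u" by (simp add: less_le)
      show ?thesis
      proof (intro exI[of _ "spt s (phase u - d)"] conjI allI impI)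
        show "spt s (phase u - d) < u" using pu d(1) by (auto simp: less_split_real_def s_def)
        fix w assume w: "spt s (phase u - d) < w" "w \<le> u"
        then have bw: "base w = s"
          by (auto simp: less_split_real_def less_eq_split_real_def s_def)
        then have "max 0 (min 1 (phase u - d)) < phase w" "phase w \<le> phase u"
          using w by (auto simp: less_split_real_def less_eq_split_real_def s_def)
        then show "\<bar>?F j w - ?F j u\<bar> < e"
          using d(1) phase_bounds(2)[of u] by (intro fibre bw) linarith
      qed
    next
      case True
      then have Fu: "?F j u = left_lim (f j) s" and us: "u = spt s 0"
        using unfold_jumps_spt(1)[OF f, of j s] spt_base_phase[of u] by (auto simp: s_def)
      have "eventually (\<lambda>x. dist (f j x) (left_lim (f j) s) < e / 2) (at_left s)"
        using tendstoD[OF D(3)[of j s], of "e / 2"] e by simp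
      then obtain a where a: "a < s" "\<And>x. a < x \<Longrightarrow> x < s \<Longrightarrow> \<bar>f j x - left_lim (f j) s\<bar> < e / 2"
        unfolding eventually_at_left_field dist_real_def by blast
      show ?thesis
      proof (intro exI[of _ "spt a 1"] conjI allI impI)
        show "spt a 1 < u" using a(1) us by simp
        fix w assume w: "spt a 1 < w" "w \<le> u"
        show "\<bar>?F j w - ?F j u\<bar> < e"
        proof (cases "w = u")
          case False
          then have "w < u" using w by simp
          then have "a < base w" "base w < s" using w us by simp_all
          then show ?thesis unfolding Fu
            by (intro near left_lim_close[OF D(3), of a]) (use a in \<open>auto intro: less_imp_le\<close>)
        qed (use e in simp)
      qed
    qed
    show "\<exists>b>u. \<forall>w. u \<le> w \<longrightarrow> w < b \<longrightarrow> \<bar>?F j w - ?F j u\<bar> < e"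
    proof (cases "phase u = 1")
      case False
      then have pu: "phase u < 1" by (simp add: less_le)
      show ?thesis
      proof (intro exI[of _ "spt s (phase u + d)"] conjI allI impI)
        have "0 \<le> phase u + d" using d(1) by (simp add: add_nonneg_nonneg less_imp_le)
        then show "u < spt s (phase u + d)" using pu d(1) by (auto simp: less_split_real_def s_def)
        fix w assume w: "u \<le> w" "w < spt s (phase u + d)"
        then have bw: "base w = s"
          by (auto simp: less_split_real_def less_eq_split_real_def s_def)
        then have "phase w < max 0 (min 1 (phase u + d))" "phase u \<le> phase w"
          using w by (auto simp: less_split_real_def less_eq_split_real_def s_def)
        then show "\<bar>?F j w - ?F j u\<bar> < e"
          using d(1) phase_bounds(1)[of u] by (intro fibre bw) linarith
      qed
    next
      case True
      then have Fu: "?F j u = f j s" and us: "u = spt s 1"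
        using unfold_jumps_spt(2)[OF f, of j s] spt_base_phase[of u] by (auto simp: s_def)
      have "eventually (\<lambda>x. dist (f j x) (f j s) < e / 2) (at_right s)"
        using tendstoD[OF D(4)[of j s], of "e / 2"] e by simp
      then obtain b where b: "s < b" "\<And>x. s < x \<Longrightarrow> x < b \<Longrightarrow> \<bar>f j x - f j s\<bar> < e / 2"
        unfolding eventually_at_right_field dist_real_def by blast
      show ?thesis
      proof (intro exI[of _ "spt b 0"] conjI allI impI)
        show "u < spt b 0" using b(1) us by simp
        fix w assume w: "u \<le> w" "w < spt b 0"
        show "\<bar>?F j w - ?F j u\<bar> < e"
        proof (cases "w = u")
          case False
          then have "u < w" using w by simp
          then have "base w < b" "s < base w" using w us by simp_all
          then show ?thesis unfolding Fu
            by (intro near left_lim_close[OF D(3), of s]) (use b in \<open>auto intro: less_imp_le\<close>)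
        qed (use e in simp)
      qed
    qed
  qed
  have zero: "?F j u = 0" if "u \<le> spt 0 0" for j u
  proof -
    consider "base u < 0" | "u = spt 0 0" using \<open>u \<le> spt 0 0\<close> by (auto simp: order.order_iff_strict)
    then show ?thesis
    proof cases
      case 1
      then show ?thesis using D(2,6)[of "base u"] by (simp add: unfold_jumps_def)
    next
      case 2
      then show ?thesis using D(6)[of 0] unfold_jumps_spt(1)[OF f] by simp
    qed
  qed
  have out: "?F j u = 0" if "j \<notin> {1..n}" for j u
    using B[of j u] D(1)[OF that] unfold_jumps_spt(1)[OF f, of j] D(3)[of j] D(5)[of j "base u"]
      left_lim_close[OF D(3), of "base u - 1" "base u" j 0 0] by simp
  have mono: "?F j u \<le> ?F j v" if "base u = base v" "u \<le> v" for j u v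
    using that D(5)[of j "base v"] ramp_mono[of "phase u" "phase v" n j]
    by (auto simp: unfold_jumps_def less_eq_split_real_def intro!: mult_right_mono)
  have seq: "?F i u = ?F i (spt (base u) 0) \<or> ?F j u = ?F j (spt (base u) 1)" if "i < j" for i j u
    using ramp_sequential[OF that, of n "phase u"]
    by (auto simp: unfold_jumps_spt[OF f]) (auto simp: unfold_jumps_def)
  show ?thesis unfolding line_ensemble_def
    by (intro conjI allI impI, rule cont, erule zero, erule out, erule (1) mono, erule seq)
qed

text \<open>In a fibre, line \<open>j + 1\<close> is at most its value and line \<open>j\<close> at
  least its left limit, and membership in \<open>Dn_up\<close> compares exactly these two.\<close>

lemma unfold_jumps_sorted:
  assumes f: "f \<in> Dn_up n" and j: "1 \<le> j" "j < n"
  shows "unfold_jumps n f (Suc j) u \<le> unfold_jumps n f j u"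
proof -
  have fD: "f \<in> Dn n" using f by (simp add: Dn_up_def)
  have "f (Suc j) (base u) \<le> left_lim (f j) (base u)"
  proof (cases "0 \<le> base u")
    case True
    have "\<forall>i\<in>{2..n}. \<forall>y\<ge>0. f i y \<le> left_lim (f (i - 1)) y" using f by (simp add: Dn_up_def)
    from this[rule_format, of "Suc j" "base u"] show ?thesis using j True by simp
  next
    case False
    then show ?thesis using DnD(2,6)[OF fD, of "base u"] by simp
  qed
  then show ?thesis using unfold_jumps_bounds[OF fD, of "Suc j" u] unfold_jumps_bounds[OF fD, of j u] by simp
qed

text \<open>Both functions use the same ramp, so the difference of the extensions is a convex
  combination of the difference of the left limits and that of the values.\<close>

lemma unfold_jumps_close:
  assumes f: "f \<in> Dn n" and g: "g \<in> Dn n" and e: "\<And>x. 0 \<le> x \<Longrightarrow> \<bar>f j x - g j x\<bar> \<le> e"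
  shows "\<bar>unfold_jumps n f j u - unfold_jumps n g j u\<bar> \<le> e"
proof -
  define s where "s = base u"
  have e': "\<bar>f j x - g j x\<bar> \<le> e" for x
    using e[of x] e[of 0] DnD(2)[OF f, of x j] DnD(2)[OF g, of x j] by (cases "0 \<le> x") auto
  have "\<bar>left_lim (f j) s - left_lim (g j) s\<bar> \<le> e"
  proof (rule tendsto_upperbound)
    show "((\<lambda>x. \<bar>f j x - g j x\<bar>) \<longlongrightarrow> \<bar>left_lim (f j) s - left_lim (g j) s\<bar>) (at_left s)"
      by (intro tendsto_intros DnD(3)[OF f] DnD(3)[OF g])
  qed (use e' in auto)
  moreover define c where "c = ramp n j (phase u)"
  ultimately have "\<bar>(1 - c) * (left_lim (f j) s - left_lim (g j) s) + c * (f j s - g j s)\<bar>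
      \<le> (1 - c) * e + c * e"
    using e'[of s] ramp_bounds[of n j "phase u"]
    by (intro order.trans[OF abs_triangle_ineq] add_mono) (auto simp: abs_mult intro!: mult_left_mono)
  then show ?thesis
    unfolding unfold_jumps_def s_def[symmetric] c_def[symmetric] by (simp add: algebra_simps)
qed

section \<open>Paths and arrays\<close>

lemma sorting_permutation:
  fixes t :: "nat \<Rightarrow> real"
  obtains p where "p permutes {..<k}" "\<And>i j. i \<le> j \<Longrightarrow> j < k \<Longrightarrow> t (p i) \<le> t (p j)"
proof -
  define xs where "xs = map t [0..<k]"
  obtain p where p: "p permutes {..<length xs}" "permute_list p xs = sort xs"
    by (rule mset_eq_permutation[of "sort xs" xs]) simp
  have len: "length xs = k" by (simp add: xs_def)
  have nth: "sort xs ! i = t (p i)" if "i < k" for i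
    using permute_list_nth[OF p(1), of i] p(2) that len permutes_in_image[OF p(1), of i]
    by (simp add: xs_def)
  show thesis
  proof (rule that[of p])
    show "p permutes {..<k}" using p(1) len by simp
    show "t (p i) \<le> t (p j)" if "i \<le> j" "j < k" for i j
      using sorted_nth_mono[OF sorted_sort, of i j xs] nth[of i] nth[of j] that len by simp
  qed
qed

text \<open>The values satisfying a downward closed condition are an initial segment of the sorted
  list, so the position \<open>i\<close> (counted from 0) is among them iff more than
  \<open>i\<close> values satisfy it.\<close>

lemma order_statistic_iff:
  fixes t :: "nat \<Rightarrow> real"
  assumes p: "p permutes {..<k}" "\<And>i j. i \<le> j \<Longrightarrow> j < k \<Longrightarrow> t (p i) \<le> t (p j)"
    and P: "\<And>a b. a \<le> b \<Longrightarrow> P b \<Longrightarrow> P a" and i: "i < k"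
  shows "P (t (p i)) \<longleftrightarrow> i < card {j. j < k \<and> P (t j)}"
proof -
  define D where "D = {i. i < k \<and> P (t (p i))}"
  have bij: "bij_betw p {..<k} {..<k}" using permutes_imp_bij[OF p(1)] .
  have "p ` D = {j. j < k \<and> P (t j)}"
  proof (rule set_eqI)
    fix x
    have "x < k \<Longrightarrow> \<exists>i<k. x = p i" using bij unfolding bij_betw_def by (metis imageE lessThan_iff)
    moreover have "i < k \<Longrightarrow> p i < k" for i using permutes_in_image[OF p(1), of i] by simp
    ultimately show "x \<in> p ` D \<longleftrightarrow> x \<in> {j. j < k \<and> P (t j)}" by (auto simp: D_def)
  qed
  moreover have "inj_on p D" using permutes_inj_on[OF p(1)] .
  ultimately have card: "card {j. j < k \<and> P (t j)} = card D" by (metis card_image)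
  have fin: "finite D" by (simp add: D_def)
  have down: "l \<in> D" if "l \<le> m" "m \<in> D" for l m
    using that p(2)[of l m] P[of "t (p l)" "t (p m)"] by (auto simp: D_def)
  have "i \<in> D \<longleftrightarrow> i < card D"
  proof
    assume "i \<in> D"
    then have "{..i} \<subseteq> D" using down by auto
    then show "i < card D" using card_mono[OF fin, of "{..i}"] by simp
  next
    assume a: "i < card D"
    show "i \<in> D"
    proof (rule ccontr)
      assume "i \<notin> D"
      then have "D \<subseteq> {..<i}" using down[of i] by (auto simp: not_less[symmetric])
      then show False using card_mono[of "{..<i}" D] a by simp
    qed
  qed
  then show ?thesis using i unfolding card by (simp add: D_def)
qed

lemma card_less_iff_neq: "finite B \<Longrightarrow> A \<subseteq> B \<Longrightarrow> card A < card B \<longleftrightarrow> A \<noteq> B"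
  by (auto intro: psubset_card_mono)

text \<open>Left and right ends are sorted separately, and everything is decided by counting: a
  point \<open>x\<close> is covered iff fewer right ends lie strictly before \<open>x\<close> than
  left ends lie at or before \<open>x\<close>, and these counts do not change under sorting.\<close>

lemma sorted_intervals:
  fixes l r :: "nat \<Rightarrow> real"
  assumes p: "p permutes {..<k}" "\<And>i j. i \<le> j \<Longrightarrow> j < k \<Longrightarrow> l (p i) \<le> l (p j)"
    and q: "q permutes {..<k}" "\<And>i j. i \<le> j \<Longrightarrow> j < k \<Longrightarrow> r (q i) \<le> r (q j)"
    and lr: "\<And>i. i < k \<Longrightarrow> l i \<le> r i"
  shows "i < k \<Longrightarrow> l (p i) \<le> r (q i)"
    and "(\<And>i j. i < k \<Longrightarrow> j < k \<Longrightarrow> i \<noteq> j \<Longrightarrow> finite ({l i..r i} \<inter> {l j..r j})) \<Longrightarrow>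
      Suc i < k \<Longrightarrow> r (q i) \<le> l (p (Suc i))"
    and "(\<Union>i<k. {l (p i)..r (q i)}) = (\<Union>i<k. {l i..r i})"
proof -
  have pl: "l (p i) \<le> z \<longleftrightarrow> i < card {j. j < k \<and> l j \<le> z}" if "i < k" for i z
    by (rule order_statistic_iff[of p k l "\<lambda>a. a \<le> z"]) (use p that in auto)
  have qr: "r (q i) \<le> z \<longleftrightarrow> i < card {j. j < k \<and> r j \<le> z}" if "i < k" for i z
    by (rule order_statistic_iff[of q k r "\<lambda>a. a \<le> z"]) (use q that in auto)
  have qs: "r (q i) < z \<longleftrightarrow> i < card {j. j < k \<and> r j < z}" if "i < k" for i z
    by (rule order_statistic_iff[of q k r "\<lambda>a. a < z"]) (use q that in auto)
  let ?L = "\<lambda>z. {j. j < k \<and> l j \<le> z}" and ?R = "\<lambda>z. {j. j < k \<and> r j \<le> z}" and ?S = "\<lambda>z. {j. j < k \<and> r j < z}"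
  show "l (p i) \<le> r (q i)" if "i < k"
  proof -
    have "card (?R (r (q i))) \<le> card (?L (r (q i)))"
      by (rule card_mono) (use lr in \<open>auto intro: order.trans\<close>)
    then show ?thesis using pl[OF that, of "r (q i)"] qr[OF that, of "r (q i)"] by simp
  qed
  show "r (q i) \<le> l (p (Suc i))"
    if fin: "\<And>i j. i < k \<Longrightarrow> j < k \<Longrightarrow> i \<noteq> j \<Longrightarrow> finite ({l i..r i} \<inter> {l j..r j})" and i: "Suc i < k"
  proof (rule ccontr)
    define z where "z = l (p (Suc i))"
    assume "\<not> r (q i) \<le> l (p (Suc i))"
    then have "\<not> i < card (?R z)" "Suc i < card (?L z)"
      using pl[OF i, of z] qr[of i z] i by (auto simp: z_def)
    moreover have "card (?L z) \<le> card (?R z) + card (?L z - ?R z)"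
      by (rule order.trans[OF card_mono card_Un_le]) auto
    ultimately have "2 \<le> card (?L z - ?R z)" by linarith
    then have "\<not> card (?L z - ?R z) \<le> Suc 0" by simp
    moreover have "finite (?L z - ?R z)" by simp
    \<comment> \<open>Two different intervals contain \<open>z\<close> and continue beyond it, so
      they overlap in infinitely many points.\<close>
    ultimately obtain a b where ab: "a \<in> ?L z - ?R z" "b \<in> ?L z - ?R z" "a \<noteq> b"
      using card_le_Suc0_iff_eq[of "?L z - ?R z"] by blast
    have "{z..min (r a) (r b)} \<subseteq> {l a..r a} \<inter> {l b..r b}" using ab by auto
    moreover have "finite ({l a..r a} \<inter> {l b..r b})" by (rule fin) (use ab in auto)
    ultimately have "finite {z..min (r a) (r b)}" by (rule finite_subset)
    moreover have "z < min (r a) (r b)" using ab by auto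
    ultimately show False using infinite_Icc by blast
  qed
  show "(\<Union>i<k. {l (p i)..r (q i)}) = (\<Union>i<k. {l i..r i})"
  proof (rule set_eqI)
    fix x
    have fin: "finite (?L x)" "finite (?S x)" by auto
    have sub: "?S x \<subseteq> ?L x" using lr by (auto intro: order.trans less_imp_le)
    have le_k: "card (?L x) \<le> k" using card_mono[of "{..<k}" "?L x"] by auto
    have "x \<in> (\<Union>i<k. {l (p i)..r (q i)}) \<longleftrightarrow> (\<exists>i<k. i < card (?L x) \<and> \<not> i < card (?S x))"
      using pl[of _ x] qs[of _ x] by (simp add: not_less[symmetric] Bex_def)
    also have "\<dots> \<longleftrightarrow> card (?S x) < card (?L x)"
    proof
      assume "card (?S x) < card (?L x)"
      then show "\<exists>i<k. i < card (?L x) \<and> \<not> i < card (?S x)"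
        using le_k by (intro exI[of _ "card (?S x)"] conjI) linarith+
    next
      assume "\<exists>i<k. i < card (?L x) \<and> \<not> i < card (?S x)"
      then show "card (?S x) < card (?L x)" by (elim exE conjE) linarith
    qed
    also have "\<dots> \<longleftrightarrow> ?S x \<noteq> ?L x"
      by (rule card_less_iff_neq[OF fin(1) sub])
    also have "\<dots> \<longleftrightarrow> (\<exists>j. j \<in> ?L x \<and> j \<notin> ?S x)" using sub by blast
    also have "\<dots> \<longleftrightarrow> x \<in> (\<Union>i<k. {l i..r i})" by (auto simp: not_less)
    finally show "x \<in> (\<Union>i<k. {l (p i)..r (q i)}) \<longleftrightarrow> x \<in> (\<Union>i<k. {l i..r i})" .
  qed
qed

section \<open>The measure of a tuple of paths\<close>

definition line_measure :: "(real \<Rightarrow> real) \<Rightarrow> real set \<Rightarrow> real" where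
  "line_measure g A = (\<Sum>C\<in>components A. g (Sup C) - left_lim g (Inf C))"

lemma line_measure_Un_Icc:
  assumes V: "closed V" "finite (components V)" "\<forall>v\<in>V. v < c" and "c \<le> r"
  shows "line_measure g (V \<union> {c..r}) = line_measure g V + (g r - left_lim g c)"
    "finite (components (V \<union> {c..r}))"
proof -
  have disj: "V \<inter> {c..r} = {}" using V(3) by force
  have I: "components {c..r} = {{c..r}}" using \<open>c \<le> r\<close> by (simp add: components_eq_sing_iff)
  have U: "components (V \<union> {c..r}) = components V \<union> {{c..r}}"
    using components_Un_disjoint_closed[OF V(1) _ disj] I by simp
  then show "finite (components (V \<union> {c..r}))" using V(2) by simp
  have "components V \<inter> {{c..r}} = {}"
  proof (rule ccontr)
    assume "components V \<inter> {{c..r}} \<noteq> {}"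
    then have "{c..r} \<subseteq> V" by (auto dest: in_components_subset)
    then have "c \<in> V" using \<open>c \<le> r\<close> by auto
    then show False using V(3) by blast
  qed
  then show "line_measure g (V \<union> {c..r}) = line_measure g V + (g r - left_lim g c)"
    unfolding line_measure_def U using V(2) \<open>c \<le> r\<close> by (subst sum.union_disjoint) auto
qed

lemma line_measure_intervals:
  assumes lr: "\<And>i. i \<le> k \<Longrightarrow> l i \<le> r i" and rl: "\<And>i. i < k \<Longrightarrow> r i \<le> l (Suc i)"
  shows "line_measure g (\<Union>i\<le>k. {l i..r i}) = g (r k) - left_lim g (l 0) +
    (\<Sum>i<k. if r i = l (Suc i) then 0 else g (r i) - left_lim g (l (Suc i)))"
proof -
  let ?sum = "\<lambda>k. \<Sum>i<k. if r i = l (Suc i) then 0 else g (r i) - left_lim g (l (Suc i))"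
  \<comment> \<open>\<open>{c..r k}\<close> is the rightmost component built so far and
    \<open>V\<close> the part strictly before it. An interval that touches it only lengthens this
    component; otherwise a new component starts.\<close>
  let ?P = "\<lambda>k V c. closed V \<and> finite (components V) \<and> (\<forall>v\<in>V. v < c) \<and> c \<le> r k \<and>
      (\<Union>i\<le>k. {l i..r i}) = V \<union> {c..r k} \<and>
      line_measure g V + (g (r k) - left_lim g c) = g (r k) - left_lim g (l 0) + ?sum k"
  have "\<exists>V c. ?P k V c"
    using lr rl
  proof (induction k)
    case 0
    show ?case
      by (rule exI[of _ "{}"], rule exI[of _ "l 0"]) (use 0 in \<open>simp add: line_measure_def\<close>)
  next
    case (Suc k)
    have "\<exists>V c. ?P k V c"
      by (rule Suc.IH) (use Suc.prems in auto)
    then obtain V c where V: "closed V" "finite (components V)" "\<forall>v\<in>V. v < c" "c \<le> r k"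
      "(\<Union>i\<le>k. {l i..r i}) = V \<union> {c..r k}"
      "line_measure g V + (g (r k) - left_lim g c) = g (r k) - left_lim g (l 0) + ?sum k"
      by (elim exE conjE) (rule that)
    have le: "r k \<le> l (Suc k)" "l (Suc k) \<le> r (Suc k)" using Suc.prems by auto
    have un: "(\<Union>i\<le>Suc k. {l i..r i}) = V \<union> {c..r k} \<union> {l (Suc k)..r (Suc k)}"
      unfolding atMost_Suc V(5)[symmetric] by auto
    show ?case
    proof (cases "r k = l (Suc k)")
      case True
      have "{c..r k} \<union> {l (Suc k)..r (Suc k)} = {c..r (Suc k)}" using True le V(4) by auto
      then have "(\<Union>i\<le>Suc k. {l i..r i}) = V \<union> {c..r (Suc k)}" using un by auto
      then show ?thesis using V True le by (intro exI[of _ V] exI[of _ c]) auto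
    next
      case False
      let ?V = "V \<union> {c..r k}"
      have "closed ?V" using V(1) by auto
      moreover have "v < l (Suc k)" if "v \<in> ?V" for v using that V(3) V(4) le False by auto
      ultimately show ?thesis
        using line_measure_Un_Icc(1)[OF V(1,2,3,4), of g] line_measure_Un_Icc(2)[OF V(1,2,3,4)] un V(6) False le
        by (intro exI[of _ ?V] exI[of _ "l (Suc k)"]) auto
    qed
  qed
  then obtain V c where V: "closed V" "finite (components V)" "\<forall>v\<in>V. v < c" "c \<le> r k"
    "(\<Union>i\<le>k. {l i..r i}) = V \<union> {c..r k}"
    "line_measure g V + (g (r k) - left_lim g c) = g (r k) - left_lim g (l 0) + ?sum k"
    by (elim exE conjE) (rule that)
  show ?thesis using line_measure_Un_Icc(1)[OF V(1-4), of g] V(5,6) by simp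
qed

definition array_path :: "nat \<Rightarrow> (nat \<Rightarrow> nat \<Rightarrow> real) \<Rightarrow> nat \<Rightarrow> (real \<times> nat) set" where
  "array_path n s i = (\<Union>j<n. {s i (Suc j)..s i j} \<times> {Suc j})"

lemma mem_array_path:
  "(x, m) \<in> array_path n s i \<longleftrightarrow> (\<exists>j<n. m = Suc j \<and> s i (Suc j) \<le> x \<and> x \<le> s i j)"
  by (auto simp: array_path_def)

text \<open>Where two consecutive paths touch on a line, the measure of their union counts the common
  point only once.\<close>

definition cadlag_weight :: "(nat \<Rightarrow> real \<Rightarrow> real) \<Rightarrow> nat \<Rightarrow> nat \<Rightarrow> (nat \<Rightarrow> nat \<Rightarrow> real) \<Rightarrow> real" where
  "cadlag_weight f k n s = (\<Sum>j<n. f (Suc j) (s (k - 1) j) - left_lim (f (Suc j)) (s 0 (Suc j)) +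
     (\<Sum>i<k - 1. if s i j = s (Suc i) (Suc j) then 0
       else f (Suc j) (s i j) - left_lim (f (Suc j)) (s (Suc i) (Suc j))))"

lemma dmeas_array:
  assumes s: "s \<in> path_arrays k n x y" and k: "1 \<le> k"
  shows "dmeas f (\<Union>i<k. array_path n s i) = cadlag_weight f k n s"
proof -
  obtain k' where k': "k = Suc k'" using k by (cases k) auto
  let ?U = "\<Union>i<k. array_path n s i"
  note D = path_arraysD[OF s]
  have "snd ` ?U = {Suc 0..n}"
  proof (intro equalityI subsetI)
    fix m assume "m \<in> {Suc 0..n}"
    then obtain j where j: "m = Suc j" "j < n" by (cases m) auto
    then have "(s 0 j, m) \<in> ?U" using k D(3)[of 0 j] by (auto simp: mem_array_path intro!: bexI[of _ 0])
    then show "m \<in> snd ` ?U" by force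
  qed (auto simp: mem_array_path)
  then have "dmeas f ?U = (\<Sum>m\<in>{Suc 0..n}. line_measure (f m) {x. (x, m) \<in> ?U})"
    unfolding dmeas_def line_measure_def by simp
  also have "\<dots> = (\<Sum>j<n. line_measure (f (Suc j)) {x. (x, Suc j) \<in> ?U})"
    by (rule sum.atLeast1_atMost_eq)
  also have "\<dots> = cadlag_weight f k n s"
    unfolding cadlag_weight_def
  proof (rule sum.cong)
    fix j assume j: "j \<in> {..<n}"
    have "{x. (x, Suc j) \<in> ?U} = (\<Union>i\<le>k'. {s i (Suc j)..s i j})"
      using j k' by (simp add: mem_array_path lessThan_Suc_atMost set_eq_iff)
    then show "line_measure (f (Suc j)) {x. (x, Suc j) \<in> ?U} =
      f (Suc j) (s (k - 1) j) - left_lim (f (Suc j)) (s 0 (Suc j)) +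
      (\<Sum>i<k - 1. if s i j = s (Suc i) (Suc j) then 0
       else f (Suc j) (s i j) - left_lim (f (Suc j)) (s (Suc i) (Suc j)))"
      using line_measure_intervals[of k' "\<lambda>i. s i (Suc j)" "\<lambda>i. s i j" "f (Suc j)"] D(3,4) j k' by simp
  qed simp
  finally show ?thesis .
qed

lemma is_path_iff:
  assumes "1 \<le> n"
  shows "is_path (x, n) (y, 1) \<pi> \<longleftrightarrow> 0 \<le> x \<and> x \<le> y \<and>
    (\<exists>t. t n = x \<and> t 0 = y \<and> (\<forall>j<n. t (Suc j) \<le> t j) \<and> \<pi> = (\<Union>j<n. {t (Suc j)..t j} \<times> {Suc j}))"
proof -
  have *: "{1..n} = Suc ` {..<n}" by (simp add: image_Suc_lessThan)
  have "(\<Union>i\<in>{1..n}. {t i..t (i - 1)} \<times> {i}) = (\<Union>j<n. {t (Suc j)..t j} \<times> {Suc j})" for t :: "nat \<Rightarrow> real"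
    unfolding * by auto
  moreover have "(\<forall>i\<in>{1..n}. t i \<le> t (i - 1)) \<longleftrightarrow> (\<forall>j<n. t (Suc j) \<le> t j)" for t :: "nat \<Rightarrow> real"
    unfolding * by auto
  ultimately show ?thesis using assms by (simp add: is_path_def)
qed

lemma array_path_disjoint:
  assumes s: "s \<in> path_arrays k n x y" and ij: "i < j" "j < k"
  shows "finite (array_path n s i \<inter> array_path n s j)" "left_of (array_path n s i) (array_path n s j)"
proof -
  note D = path_arraysD[OF s]
  have cross: "s i m \<le> s j (Suc m)" if "m < n" for m
  proof -
    have "s i m \<le> s (Suc i) (Suc m)" using D(4)[of i m] ij that by simp
    also have "s (Suc i) (Suc m) \<le> s j (Suc m)"
      using \<open>i < j\<close>[THEN Suc_leI] \<open>j < k\<close>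
    proof (induction j rule: dec_induct)
      case (step j)
      then have "s j (Suc m) \<le> s j m" "s j m \<le> s (Suc j) (Suc m)" using D(3)[of j m] D(4)[of j m] that by auto
      then show ?case using step by simp
    qed simp
    finally show ?thesis .
  qed
  have "array_path n s i \<inter> array_path n s j \<subseteq> (\<lambda>m. (s i m, Suc m)) ` {..<n}"
    using cross by (force simp: mem_array_path)
  then show "finite (array_path n s i \<inter> array_path n s j)" by (rule finite_subset) simp
  show "left_of (array_path n s i) (array_path n s j)"
    unfolding left_of_def
  proof (intro ballI, clarify)
    fix a m b m' assume a: "(a, m) \<in> array_path n s i" and b: "(b, m') \<in> array_path n s j" and "\<not> a \<le> b"
    obtain p where p: "p < n" "m = Suc p" "a \<le> s i p" using a by (auto simp: mem_array_path)
    obtain q where q: "q < n" "m' = Suc q" "s j (Suc q) \<le> b" using b by (auto simp: mem_array_path)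
    show "m \<le> m'"
    proof (rule ccontr)
      assume "\<not> m \<le> m'"
      then have "s i p \<le> s j (Suc q)"
        using cross[of p] path_arrays_antimono[OF s, of j "Suc q" "Suc p"] ij p q by simp
      then show False using p q \<open>\<not> a \<le> b\<close> by simp
    qed
  qed
qed

lemma disjoint_paths_array:
  assumes s: "s \<in> path_arrays k n x y" and n: "1 \<le> n" and xy: "0 \<le> x" "x \<le> y"
  shows "disjoint_paths k (x, n) (y, 1) (\<lambda>i. array_path n s (i - 1))"
  unfolding disjoint_paths_def
proof (intro conjI ballI impI)
  note D = path_arraysD[OF s]
  fix i assume i: "i \<in> {1..k}"
  show "is_path (x, n) (y, 1) (array_path n s (i - 1))"
    unfolding is_path_iff[OF n]
    using D[of "i - 1"] i xy by (auto simp: array_path_def intro!: exI[of _ "s (i - 1)"])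
  fix j assume j: "j \<in> {1..k}" "i \<noteq> j"
  have "i - 1 < j - 1 \<and> j - 1 < k \<or> j - 1 < i - 1 \<and> i - 1 < k" using i j by auto
  then show "ess_disjoint (array_path n s (i - 1)) (array_path n s (j - 1))"
    unfolding ess_disjoint_def using array_path_disjoint(1)[OF s] by (metis inf_commute)
qed

lemma UN_atLeast1_atMost: "(\<Union>i\<in>{1..k}. g i) = (\<Union>i<k. g (Suc i))"
proof -
  have "{1..k} = Suc ` {..<k}" by (simp add: image_Suc_lessThan)
  then show ?thesis by (simp add: image_image)
qed

text \<open>Essentially disjoint paths may still cross at a single time, so the tuple itself need not be
  ordered; sorting the jump times of each column uncrosses the paths without changing their union.\<close>

lemma disjoint_paths_sort:
  assumes dp: "disjoint_paths k (x, n) (y, 1) \<pi>" and n: "1 \<le> n"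
  obtains t s where "\<And>i. i < k \<Longrightarrow> \<pi> (Suc i) = array_path n t i" "s \<in> path_arrays k n x y"
    "(\<Union>i\<in>{1..k}. \<pi> i) = (\<Union>i<k. array_path n s i)"
    "\<And>i j. i < k \<Longrightarrow> j < n \<Longrightarrow> t i (Suc j) \<le> t i j"
    "\<And>i j c. i < k \<Longrightarrow> s i j < c \<longleftrightarrow> i < card {l. l < k \<and> t l j < c}"
proof -
  define P where "P i t \<longleftrightarrow> t n = x \<and> t 0 = y \<and> (\<forall>j<n. t (Suc j) \<le> t j) \<and>
      \<pi> (Suc i) = (\<Union>j<n. {t (Suc j)..t j} \<times> {Suc j})" for i t
  have "\<exists>t. P i t" if "i < k" for i
  proof -
    have "is_path (x, n) (y, 1) (\<pi> (Suc i))" using dp that unfolding disjoint_paths_def by simp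
    then show ?thesis unfolding is_path_iff[OF n] P_def by blast
  qed
  then obtain t where "\<And>i. i < k \<Longrightarrow> P i (t i)" by metis
  then have t: "\<And>i. i < k \<Longrightarrow> t i n = x" "\<And>i. i < k \<Longrightarrow> t i 0 = y"
    "\<And>i j. i < k \<Longrightarrow> j < n \<Longrightarrow> t i (Suc j) \<le> t i j" "\<And>i. i < k \<Longrightarrow> \<pi> (Suc i) = array_path n t i"
    by (simp_all add: P_def array_path_def)
  define srt where "srt j p \<longleftrightarrow> p permutes {..<k} \<and> (\<forall>i l. i \<le> l \<longrightarrow> l < k \<longrightarrow> t (p i) j \<le> t (p l) j)" for j p
  have "\<exists>p. srt j p" for j
    by (rule sorting_permutation[of k "\<lambda>i. t i j"]) (auto simp: srt_def)
  then obtain p where "\<And>j. srt j (p j)" by metis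
  then have p: "\<And>j. p j permutes {..<k}" "\<And>j i l. i \<le> l \<Longrightarrow> l < k \<Longrightarrow> t (p j i) j \<le> t (p j l) j"
    by (simp_all add: srt_def)
  have pk: "p j i < k" if "i < k" for i j using permutes_in_image[OF p(1), of j i] that by simp
  define s where "s i j = t (p j i) j" for i j
  have fin: "finite ({t i (Suc j)..t i j} \<inter> {t l (Suc j)..t l j})" if "i < k" "l < k" "i \<noteq> l" "j < n" for i l j
  proof -
    have "finite (\<pi> (Suc i) \<inter> \<pi> (Suc l))"
      using dp that unfolding disjoint_paths_def ess_disjoint_def by auto
    moreover have "({t i (Suc j)..t i j} \<inter> {t l (Suc j)..t l j}) \<times> {Suc j} \<subseteq> \<pi> (Suc i) \<inter> \<pi> (Suc l)"
      using t(4) that by (auto simp: mem_array_path)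
    ultimately show ?thesis using finite_subset finite_cartesian_productD1 by blast
  qed
  have srt1: "s i (Suc j) \<le> s i j" if "i < k" "j < n" for i j
    unfolding s_def
    by (rule sorted_intervals(1)[of "p (Suc j)" k "\<lambda>i. t i (Suc j)" "p j" "\<lambda>i. t i j"])
      (use p t(3) that in auto)
  have srt2: "s i j \<le> s (Suc i) (Suc j)" if "Suc i < k" "j < n" for i j
    unfolding s_def
    by (rule sorted_intervals(2)[of "p (Suc j)" k "\<lambda>i. t i (Suc j)" "p j" "\<lambda>i. t i j"])
      (use p t(3) fin that in auto)
  have srt3: "(\<Union>i<k. {s i (Suc j)..s i j}) = (\<Union>i<k. {t i (Suc j)..t i j})" if "j < n" for j
    unfolding s_def
    by (rule sorted_intervals(3)[of "p (Suc j)" k "\<lambda>i. t i (Suc j)" "p j" "\<lambda>i. t i j"])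
      (use p t(3) that in auto)
  show thesis
  proof (rule that[of t s])
    show "s \<in> path_arrays k n x y"
      unfolding path_arrays_def using srt1 srt2 t(1,2) pk by (auto simp: s_def)
    have "\<Union> (\<pi> ` {1..k}) = (\<Union>i<k. \<pi> (Suc i))"
      by (rule UN_atLeast1_atMost)
    also have "\<dots> = (\<Union>i<k. array_path n t i)" using t(4) by auto
    also have "\<dots> = (\<Union>j<n. (\<Union>i<k. {t i (Suc j)..t i j}) \<times> {Suc j})" by (auto simp: array_path_def)
    also have "\<dots> = (\<Union>j<n. (\<Union>i<k. {s i (Suc j)..s i j}) \<times> {Suc j})" using srt3 by simp
    also have "\<dots> = (\<Union>i<k. array_path n s i)" by (auto simp: array_path_def)
    finally show "(\<Union>i\<in>{1..k}. \<pi> i) = (\<Union>i<k. array_path n s i)" .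
    show "s i j < c \<longleftrightarrow> i < card {l. l < k \<and> t l j < c}" if "i < k" for i j c
      unfolding s_def using order_statistic_iff[of "p j" k "\<lambda>i. t i j" "\<lambda>a. a < c" i] p that by auto
  qed (use t in auto)
qed

section \<open>Comparing cadlag paths with arrays in the fibres\<close>

lemma sum_regroup:
  fixes a b :: "nat \<Rightarrow> real"
  assumes "1 \<le> k"
  shows "(\<Sum>i<k. a i - b i) = a (k - 1) - b 0 + (\<Sum>i<k - 1. a i - b (Suc i))"
proof -
  obtain k' where k: "k = Suc k'" using assms by (cases k) auto
  have "(\<Sum>i<k. a i - b i) = (\<Sum>i<Suc k'. a i) - (\<Sum>i<Suc k'. b i)"
    unfolding k by (simp add: sum_subtractf)
  also have "\<dots> = (\<Sum>i<k'. a i) + a k' - (b 0 + (\<Sum>i<k'. b (Suc i)))"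
    unfolding sum.lessThan_Suc_shift[of b] by simp
  finally show ?thesis by (simp add: k sum_subtractf)
qed

text \<open>The minimum of \<open>q (i + l) (j + l)\<close> over \<open>l \<le> c\<close>. The
  interlacing inequalities compare neighbours on such diagonals, so this is the least change
  downwards that enforces them.\<close>

primrec diagonal_min :: "(nat \<Rightarrow> nat \<Rightarrow> 'a::linorder) \<Rightarrow> nat \<Rightarrow> nat \<Rightarrow> nat \<Rightarrow> 'a" where
  "diagonal_min q 0 i j = q i j"
| "diagonal_min q (Suc c) i j = min (q i j) (diagonal_min q c (Suc i) (Suc j))"

text \<open>Only the ends of fibres are compared, and only over \<open>[x,y]\<close>: a rotated
  function is set to 0 after time \<open>t\<close>, while the rotated ensemble stays constant
  there.\<close>

definition matches :: "nat \<Rightarrow> (nat \<Rightarrow> real \<Rightarrow> real) \<Rightarrow> (nat \<Rightarrow> split_real \<Rightarrow> real) \<Rightarrow> real \<Rightarrow> real \<Rightarrow> bool" where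
  "matches n f F x y \<longleftrightarrow> (\<forall>j\<in>{1..n}. \<forall>s\<in>{x..y}. F j (spt s 1) = f j s \<and> F j (spt s 0) = left_lim (f j) s)"

lemma base_array:
  assumes A: "A \<in> path_arrays k n (spt x 0) (spt y 1)"
  shows "(\<lambda>i j. base (A i j)) \<in> path_arrays k n x y"
  using path_arraysD[OF A] base_mono unfolding path_arrays_def by auto

text \<open>After regrouping into gaps between consecutive paths, a gap within one fibre contributes
  at most 0 by monotonicity in the fibre, and any other gap at most a value minus a left
  limit.\<close>

lemma weight_le_cadlag_weight:
  assumes F: "line_ensemble n F" and m: "matches n f F x y" and k: "1 \<le> k"
    and A: "A \<in> path_arrays k n (spt x 0) (spt y 1)"
  shows "weight F k n A \<le> cadlag_weight f k n (\<lambda>i j. base (A i j))"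
  unfolding weight_alt cadlag_weight_def sum_regroup[OF k]
proof (rule sum_mono, rule add_mono)
  note D = line_ensembleD[OF F]
  fix j assume "j \<in> {..<n}"
  then have j: "j < n" by simp
  have up: "F (Suc j) u \<le> f (Suc j) (base u)" and lo: "left_lim (f (Suc j)) (base u) \<le> F (Suc j) u"
    if "x \<le> base u" "base u \<le> y" for u
    using D(4)[of u "spt (base u) 1" "Suc j"] D(4)[of "spt (base u) 0" u "Suc j"] m j that
    by (auto simp: matches_def)
  have bd: "x \<le> base (A i l)" "base (A i l) \<le> y" if "i < k" "l \<le> n" for i l
    using path_arrays_bounds[OF A that] by simp_all
  show "F (Suc j) (A (k - 1) j) - F (Suc j) (A 0 (Suc j)) \<le>
      f (Suc j) (base (A (k - 1) j)) - left_lim (f (Suc j)) (base (A 0 (Suc j)))"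
    using up[OF bd[of "k - 1" j]] lo[OF bd[of 0 "Suc j"]] j k by simp
  show "(\<Sum>i<k - 1. F (Suc j) (A i j) - F (Suc j) (A (Suc i) (Suc j))) \<le>
      (\<Sum>i<k - 1. if base (A i j) = base (A (Suc i) (Suc j)) then 0
        else f (Suc j) (base (A i j)) - left_lim (f (Suc j)) (base (A (Suc i) (Suc j))))"
  proof (rule sum_mono)
    fix i assume "i \<in> {..<k - 1}"
    then have i: "i < k" "Suc i < k" by auto
    show "F (Suc j) (A i j) - F (Suc j) (A (Suc i) (Suc j)) \<le>
        (if base (A i j) = base (A (Suc i) (Suc j)) then 0
         else f (Suc j) (base (A i j)) - left_lim (f (Suc j)) (base (A (Suc i) (Suc j))))"
      using D(4)[of "A i j" "A (Suc i) (Suc j)" "Suc j"] path_arraysD(4)[OF A i(1) j i(2)]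
        up[OF bd[of i j]] lo[OF bd[of "Suc i" "Suc j"]] i j by simp
  qed
qed

text \<open>Lifting an array of jump times into the fibres: in the fibre of its jump time, a path changes
  lines at the cut between the ramps of the two lines. Where this makes consecutive paths overlap,
  the earlier path is moved back, so that the later one collects the common jump.\<close>

lemma lift_array:
  assumes F: "line_ensemble n F" and m: "matches n f F x y" and k: "1 \<le> k" "k \<le> n"
    and s: "s \<in> path_arrays k n x y" and xy: "x \<le> y"
  obtains A where "A \<in> path_arrays k n (spt x 0) (spt y 1)" "weight F k n A = cadlag_weight f k n s"
    "\<And>i j. i < k \<Longrightarrow> j \<le> n \<Longrightarrow> base (A i j) = s i j"
proof -
  note D = line_ensembleD[OF F] and S = path_arraysD[OF s] and Sb = path_arrays_bounds[OF s]
  define cut where "cut z d \<longleftrightarrow> (\<forall>j. base (d j) = z \<and> d (Suc j) \<le> d j \<and> F j (d j) = F j (spt z 0) \<and>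
      F (Suc j) (d j) = F (Suc j) (spt z 1))" for z d
  have "\<exists>d. cut z d" for z
  proof -
    obtain d where "\<And>j. base (d j) = z" "\<And>j. d (Suc j) \<le> d j"
      "\<And>j. F j (d j) = F j (spt z 0)" "\<And>j. F (Suc j) (d j) = F (Suc j) (spt z 1)"
      by (rule line_ensemble_cuts[OF F, of z]) blast
    then show ?thesis by (intro exI[of _ d]) (simp add: cut_def)
  qed
  then obtain d where "\<And>z. cut z (d z)" by metis
  then have d: "base (d z j) = z" "d z (Suc j) \<le> d z j" "F j (d z j) = F j (spt z 0)"
      "F (Suc j) (d z j) = F (Suc j) (spt z 1)" for z j
    by (simp_all add: cut_def)
  \<comment> \<open>These are the cuts before the correction of overlaps. The column
    \<open>n\<close> is not a change of lines but the common starting point.\<close>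
  define q where "q i j = (if n \<le> j then spt x 0 else d (s i j) j)" for i j
  have d_mono: "d z (Suc j) \<le> d z' j" if "z \<le> z'" for z z' j
    using that d(1,2) by (cases "z = z'") (auto simp: less_eq_split_real_def)
  have q_anti: "q i (Suc j) \<le> q i j" if "i < k" for i j
    using S(3)[OF that, of j] d_mono[of "s i (Suc j)" "s i j" j] Sb[OF that, of j] d(1)
    by (auto simp: q_def)
  define Q where "Q c = diagonal_min q c" for c
  have Q_anti: "Q c i (Suc j) \<le> Q c i j" if "i + c < k" for c i j
    using that unfolding Q_def
  proof (induction c arbitrary: i j)
    case 0
    then show ?case using q_anti by simp
  next
    case (Suc c)
    then show ?case
      using q_anti[of i j] Suc.IH[of "Suc i" "Suc j"] by (auto intro: min.mono simp del: min.bounded_iff)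
  qed
  have Q_n: "Q c i j = spt x 0" if "n \<le> j" for c i j
    using that unfolding Q_def by (induction c arbitrary: i j) (auto simp: q_def)
  have Q_base: "base (Q c i j) = s i j" if "i + c < k" "j \<le> n" for c i j
  proof (cases "j = n")
    case True
    then show ?thesis using Q_n S(1)[of i] that by simp
  next
    case False
    then have "j < n" using that by simp
    have "i + c < k \<Longrightarrow> j < n \<Longrightarrow> base (Q c i j) = s i j" for i j
      unfolding Q_def
    proof (induction c arbitrary: i j)
      case 0
      then show ?case by (simp add: q_def d)
    next
      case (Suc c)
      have "s i j \<le> s (Suc i) (Suc j)" using S(4)[of i j] Suc.prems by simp
      moreover have "base (diagonal_min q c (Suc i) (Suc j)) = s (Suc i) (Suc j)"
        using Suc.IH[of "Suc i" "Suc j"] Suc.prems Q_n[of "Suc j" c "Suc i"] S(1)[of "Suc i"]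
        by (cases "Suc j = n") (auto simp: Q_def)
      moreover have "base (q i j) = s i j" using Suc.prems by (simp add: q_def d)
      ultimately show ?case by (auto simp: min_def less_eq_split_real_def)
    qed
    then show ?thesis using that \<open>j < n\<close> by simp
  qed
  \<comment> \<open>Entries with \<open>j \<le> i\<close> have base \<open>y\<close> in any case and
    are put at the very end of its fibre. The minimum extends over the \<open>k - 1 - i\<close>
    later paths.\<close>
  define A where "A i j = (if j \<le> i then spt y 1 else Q (k - 1 - i) i j)" for i j
  have A_step: "A i j = min (q i j) (A (Suc i) (Suc j))" if "Suc i < k" "i < j" for i j
  proof -
    have "k - 1 - i = Suc (k - 1 - Suc i)" using that by simp
    then show ?thesis using that by (simp add: A_def Q_def)
  qed
  have A_last: "A (k - 1) j = q (k - 1) j" if "k - 1 < j" for j using that by (simp add: A_def Q_def)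
  have A_q: "A i j \<le> q i j" if "i < k" "i < j" for i j
    using A_step[of i j] A_last[of j] that by (cases "Suc i < k") (auto simp: not_less le_Suc_eq less_Suc_eq_le)
  have A_base: "base (A i j) = s i j" if "i < k" "j \<le> n" for i j
    using path_arrays_top[OF s that(1), of j] Q_base[of i "k - 1 - i" j] that by (auto simp: A_def)
  have A_arr: "A \<in> path_arrays k n (spt x 0) (spt y 1)"
    unfolding path_arrays_def mem_Collect_eq
  proof (intro allI impI conjI)
    fix i assume i: "i < k"
    show "A i n = spt x 0" using i k Q_n by (simp add: A_def)
    show "A i 0 = spt y 1" by (simp add: A_def)
    fix j assume j: "j < n"
    show "A i (Suc j) \<le> A i j"
    proof (cases "j \<le> i")
      case True
      then show ?thesis using A_base[OF i, of "Suc j"] Sb[OF i, of "Suc j"] j by (simp add: A_def[of i j])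
    next
      case False
      then show ?thesis using Q_anti[of i "k - 1 - i" j] i by (simp add: A_def)
    qed
    assume i': "Suc i < k"
    show "A i j \<le> A (Suc i) (Suc j)"
    proof (cases "j \<le> i")
      case False
      then show ?thesis using A_step[of i j] i' by simp
    qed (simp add: A_def)
  qed
  have f_eq: "F (Suc j) (spt (s i l) 1) = f (Suc j) (s i l)" "F (Suc j) (spt (s i l) 0) = left_lim (f (Suc j)) (s i l)"
    if "i < k" "j < n" "l \<le> n" for i j l
    using m Sb[OF that(1,3)] that by (auto simp: matches_def)
  have q_final: "F (Suc j) (q i j) = f (Suc j) (s i j)" if "i < k" "j < n" for i j
    using d(4)[of j "s i j"] f_eq(1)[OF that, of j] that by (simp add: q_def)
  have q_initial: "F (Suc j) (q i (Suc j)) = left_lim (f (Suc j)) (s i (Suc j))" if "i < k" "j < n" for i j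
    using d(3)[of "Suc j" "s i (Suc j)"] f_eq(2)[OF that, of "Suc j"] that S(1)[OF that(1)]
    by (cases "Suc j = n") (auto simp: q_def)
  have q_base: "base (q i j) = s i j" if "i < k" "j \<le> n" for i j
    using that d(1) S(1)[OF that(1)] by (auto simp: q_def)
  \<comment> \<open>Moving an entry back within its fibre does no harm on the line being entered:
    before the cut that line is still at its left limit.\<close>
  have A_initial: "F (Suc j) (A i (Suc j)) = left_lim (f (Suc j)) (s i (Suc j))" if "i < k" "j < n" "i \<le> j" for i j
  proof (rule antisym)
    show "F (Suc j) (A i (Suc j)) \<le> left_lim (f (Suc j)) (s i (Suc j))"
      using D(4)[of "A i (Suc j)" "q i (Suc j)" "Suc j"] A_q[of i "Suc j"] A_base[of i "Suc j"]
        q_base[of i "Suc j"] q_initial[of i j] that by simp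
    show "left_lim (f (Suc j)) (s i (Suc j)) \<le> F (Suc j) (A i (Suc j))"
      using D(4)[of "spt (s i (Suc j)) 0" "A i (Suc j)" "Suc j"] A_base[of i "Suc j"]
        f_eq(2)[of i j "Suc j"] that by simp
  qed
  have "weight F k n A = cadlag_weight f k n s"
    unfolding weight_alt cadlag_weight_def sum_regroup[OF k(1)]
  proof (intro sum.cong refl arg_cong2[of _ _ _ _ "(+)"] arg_cong2[of _ _ _ _ "(-)"])
    fix j assume "j \<in> {..<n}"
    then have j: "j < n" by simp
    show "F (Suc j) (A (k - 1) j) = f (Suc j) (s (k - 1) j)"
    proof (cases "k - 1 < j")
      case True
      then show ?thesis using A_last q_final[of "k - 1" j] j k by simp
    next
      case False
      then have "s (k - 1) j = y" "A (k - 1) j = spt y 1"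
        using path_arrays_top[OF s, of "k - 1" j] j k by (auto simp: A_def)
      then show ?thesis using f_eq(1)[of "k - 1" j j] j k by simp
    qed
    show "F (Suc j) (A 0 (Suc j)) = left_lim (f (Suc j)) (s 0 (Suc j))" using A_initial[of 0 j] k j by simp
    fix i assume "i \<in> {..<k - 1}"
    then have i: "i < k" "Suc i < k" by auto
    show "F (Suc j) (A i j) - F (Suc j) (A (Suc i) (Suc j)) = (if s i j = s (Suc i) (Suc j) then 0
        else f (Suc j) (s i j) - left_lim (f (Suc j)) (s (Suc i) (Suc j)))"
    proof (cases "j \<le> i")
      case True
      then have "s i j = y" "s (Suc i) (Suc j) = y" "A i j = A (Suc i) (Suc j)"
        using path_arrays_top[OF s, of i j] path_arrays_top[OF s, of "Suc i" "Suc j"] i j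
        by (auto simp: A_def)
      then show ?thesis by simp
    next
      case False
      then have step: "A i j = min (q i j) (A (Suc i) (Suc j))" using A_step[OF i(2)] by simp
      have b: "base (q i j) = s i j" "base (A (Suc i) (Suc j)) = s (Suc i) (Suc j)"
        using q_base[of i j] A_base[of "Suc i" "Suc j"] i j by auto
      show ?thesis
      proof (cases "s i j = s (Suc i) (Suc j)")
        case True
        \<comment> \<open>Line \<open>Suc j\<close> has finished its jump at \<open>q i j\<close>,
          so even if a gap remains within the fibre, it contributes 0, as required at a common
          point.\<close>
        have "F (Suc j) (q i j) = F (Suc j) (A (Suc i) (Suc j))" if "q i j \<le> A (Suc i) (Suc j)"
        proof (rule antisym)
          show "F (Suc j) (q i j) \<le> F (Suc j) (A (Suc i) (Suc j))" using D(4) that b True by simp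
          show "F (Suc j) (A (Suc i) (Suc j)) \<le> F (Suc j) (q i j)"
            using D(4)[of "A (Suc i) (Suc j)" "spt (s (Suc i) (Suc j)) 1" "Suc j"] b
              f_eq(1)[of "Suc i" j "Suc j"] q_final[of i j] True i j by simp
        qed
        then show ?thesis using True step by (auto simp: min_def)
      next
        case neq: False
        have "s i j < s (Suc i) (Suc j)" using S(4)[OF i(1) j i(2)] neq by simp
        then have "q i j \<le> A (Suc i) (Suc j)" using b by (simp add: less_eq_split_real_def)
        then have "A i j = q i j" using step by simp
        then show ?thesis using neq q_final[of i j] A_initial[of "Suc i" j] i j False by simp
      qed
    qed
  qed
  with A_arr A_base show thesis by (intro that[of A]) auto
qed

lemma multi_lpp_eq_array_lpp:
  assumes F: "line_ensemble n F" and m: "matches n f F x y" and k: "k \<le> n"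
    and xy: "0 \<le> x" "x \<le> y"
  shows "multi_lpp f k (x, n) (y, 1) = array_lpp F k n (spt x 0) (spt y 1)"
proof (cases "k = 0")
  case True
  then show ?thesis by (simp add: multi_lpp_def array_lpp_0)
next
  case False
  then have k1: "1 \<le> k" and n: "1 \<le> n" using k by auto
  let ?P = "{\<pi>. disjoint_paths k (x, n) (y, 1) \<pi>}" and ?v = "\<lambda>\<pi>. dmeas f (\<Union>i\<in>{1..k}. \<pi> i)"
  let ?A = "path_arrays k n (spt x 0) (spt y 1)"
  have 1: "\<exists>A\<in>?A. ?v \<pi> \<le> weight F k n A" if \<pi>: "\<pi> \<in> ?P" for \<pi>
  proof -
    from \<pi> have dp: "disjoint_paths k (x, n) (y, 1) \<pi>" by simp
    obtain s where s: "s \<in> path_arrays k n x y" "(\<Union>i\<in>{1..k}. \<pi> i) = (\<Union>i<k. array_path n s i)"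
      by (rule disjoint_paths_sort[OF dp n])
    obtain A where "A \<in> ?A" "weight F k n A = cadlag_weight f k n s"
      by (rule lift_array[OF F m k1 k s(1) xy(2)])
    then show ?thesis using dmeas_array[OF s(1) k1, of f] s(2) by (intro bexI[of _ A]) simp_all
  qed
  have 2: "\<exists>\<pi>\<in>?P. weight F k n A \<le> ?v \<pi>" if A: "A \<in> ?A" for A
  proof -
    let ?s = "\<lambda>i j. base (A i j)"
    note s = base_array[OF A]
    have "weight F k n A \<le> dmeas f (\<Union>i\<in>{1..k}. array_path n ?s (i - 1))"
      using weight_le_cadlag_weight[OF F m k1 A] dmeas_array[OF s k1, of f] unfolding UN_atLeast1_atMost by simp
    then show ?thesis using disjoint_paths_array[OF s n xy] by (intro bexI[of _ "\<lambda>i. array_path n ?s (i - 1)"]) simp_all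
  qed
  have "Sup (?v ` ?P) = Sup (weight F k n ` ?A)"
    by (rule Sup_eq_mutual) (use 1 2 in auto)
  then show ?thesis using False unfolding multi_lpp_def array_lpp_def by simp
qed

text \<open>Projecting to base times does not lower the weight, and lifting the projected array
  shows that its measure cannot exceed the optimum. The projected paths are ordered from left to
  right.\<close>

lemma optimizer_of_array:
  assumes F: "line_ensemble n F" and m: "matches n f F 0 y" and k: "1 \<le> k" "k \<le> n" and y: "0 \<le> y"
    and A: "A \<in> path_arrays k n (spt 0 0) (spt y 1)" "weight F k n A = array_lpp F k n (spt 0 0) (spt y 1)"
  shows "optimizer n f k y (\<lambda>i. array_path n (\<lambda>i j. base (A i j)) (i - 1))"
  unfolding optimizer_def
proof (intro conjI ballI impI)
  let ?s = "\<lambda>i j. base (A i j)"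
  have n: "1 \<le> n" using k by simp
  note s = base_array[OF A(1)]
  show dp: "disjoint_paths k (0, n) (y, 1) (\<lambda>i. array_path n ?s (i - 1))"
    by (rule disjoint_paths_array[OF s n _ y]) simp
  fix i j assume "i \<in> {1..k}" "j \<in> {1..k}" "i < j"
  then show "left_of (array_path n ?s (i - 1)) (array_path n ?s (j - 1))"
    by (intro array_path_disjoint(2)[OF s]) auto
next
  let ?s = "\<lambda>i j. base (A i j)"
  have n: "1 \<le> n" using k by simp
  note s = base_array[OF A(1)]
  have ml: "multi_lpp f k (0, n) (y, 1) = array_lpp F k n (spt 0 0) (spt y 1)"
    by (rule multi_lpp_eq_array_lpp[OF F m k(2) _ y]) simp
  have eq: "dmeas f (\<Union>i\<in>{1..k}. array_path n ?s (i - 1)) = cadlag_weight f k n ?s"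
    unfolding UN_atLeast1_atMost using dmeas_array[OF s k(1)] by simp
  obtain B where B: "B \<in> path_arrays k n (spt 0 0) (spt y 1)" "weight F k n B = cadlag_weight f k n ?s"
    by (rule lift_array[OF F m k s y])
  have "\<forall>j\<in>{1..n}. continuous_on UNIV (F j)" using line_ensembleD(1)[OF F] by blast
  then have "weight F k n B \<le> array_lpp F k n (spt 0 0) (spt y 1)"
    by (rule array_lpp_upper[OF _ k(2) _ B(1)]) (use y in simp)
  then show "dmeas f (\<Union>i\<in>{1..k}. array_path n ?s (i - 1)) = multi_lpp f k (0, n) (y, 1)"
    using weight_le_cadlag_weight[OF F m k(1) A(1)] A(2) B(2) eq ml by simp
qed

text \<open>The paths of an optimizer are sorted columnwise and lifted. The point is that late
  changes of line survive the sorting.\<close>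

lemma array_of_optimizer:
  assumes F: "line_ensemble n F" and m: "matches n f F 0 y" and k: "1 \<le> k" "k \<le> n" and y: "0 \<le> y"
    and opt: "optimizer n f k y \<pi>" and T: "0 < T" "\<And>i. i \<in> {1..k} \<Longrightarrow> {0..T} \<times> {n - k + i} \<subseteq> \<pi> i"
  obtains A where "A \<in> path_arrays k n (spt 0 0) (spt y 1)"
    "weight F k n A = array_lpp F k n (spt 0 0) (spt y 1)"
    "\<And>i j. i < k \<Longrightarrow> j \<le> n - k + i \<Longrightarrow> T \<le> base (A i j)"
proof -
  have n: "1 \<le> n" using k by simp
  have dp: "disjoint_paths k (0, n) (y, 1) \<pi>" using opt by (simp add: optimizer_def)
  obtain t s where t: "\<And>i. i < k \<Longrightarrow> \<pi> (Suc i) = array_path n t i" and s: "s \<in> path_arrays k n 0 y"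
    "(\<Union>i\<in>{1..k}. \<pi> i) = (\<Union>i<k. array_path n s i)"
    and t0: "\<And>i j. i < k \<Longrightarrow> j < n \<Longrightarrow> t i (Suc j) \<le> t i j"
    and os: "\<And>i j c. i < k \<Longrightarrow> s i j < c \<longleftrightarrow> i < card {l. l < k \<and> t l j < c}"
    by (rule disjoint_paths_sort[OF dp n]) (rule that; assumption)
  obtain A where A: "A \<in> path_arrays k n (spt 0 0) (spt y 1)" "weight F k n A = cadlag_weight f k n s"
    "\<And>i j. i < k \<Longrightarrow> j \<le> n \<Longrightarrow> base (A i j) = s i j"
    by (rule lift_array[OF F m k s(1) y]) (rule that; assumption)
  have "weight F k n A = multi_lpp f k (0, n) (y, 1)"
    using opt A(2) dmeas_array[OF s(1) k(1), of f] s(2) by (simp add: optimizer_def)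
  then have w: "weight F k n A = array_lpp F k n (spt 0 0) (spt y 1)"
    using multi_lpp_eq_array_lpp[OF F m k(2) _ y] by simp
  have tT: "T \<le> t i j" if i: "i < k" and j: "j \<le> n - k + i" for i j
  proof -
    have "(T, n - k + Suc i) \<in> {0..T} \<times> {n - k + Suc i}" using T(1) by simp
    then have "(T, Suc (n - k + i)) \<in> \<pi> (Suc i)" using T(2)[of "Suc i"] i by auto
    then have le: "T \<le> t i (n - k + i)" using t[OF i] by (auto simp: mem_array_path)
    have anti: "t i l \<le> t i j" if "j \<le> l" "l < n" for l
      using that
    proof (induction l rule: dec_induct)
      case (step l)
      then show ?case using t0[OF i, of l] by simp
    qed simp
    have "n - k + i < n" using i k by linarith
    then show ?thesis using le anti[OF j] by simp
  qed
  have "T \<le> base (A i j)" if i: "i < k" and j: "j \<le> n - k + i" for i j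
  proof (rule ccontr)
    assume "\<not> T \<le> base (A i j)"
    then have "s i j < T" using A(3)[of i j] i j k by simp
    then have "i < card {l. l < k \<and> t l j < T}" using os[OF i] by simp
    moreover have "{l. l < k \<and> t l j < T} \<subseteq> {..<i}"
    proof
      fix l assume "l \<in> {l. l < k \<and> t l j < T}"
      then show "l \<in> {..<i}" using tT[of l j] j by (cases "l < i") auto
    qed
    then have "card {l. l < k \<and> t l j < T} \<le> card {..<i}" by (intro card_mono) simp_all
    ultimately show False by simp
  qed
  with A(1) w show thesis by (intro that[of A]) auto
qed

section \<open>Rotation\<close>

definition flip :: "real \<Rightarrow> split_real \<Rightarrow> split_real" where
  "flip t u = spt (t - base u) (1 - phase u)"

lemma base_flip [simp]: "base (flip t u) = t - base u"
  by (simp add: flip_def)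

lemma phase_flip [simp]: "phase (flip t u) = 1 - phase u"
  by (auto simp: flip_def max_def min_def intro: order.antisym)

lemma flip_flip [simp]: "flip t (flip t u) = u"
  by (simp add: split_real_eq_iff)

lemma flip_le_iff [simp]: "flip t u \<le> flip t v \<longleftrightarrow> v \<le> u"
  by (auto simp: less_eq_split_real_def)

lemma flip_less_iff [simp]: "flip t u < flip t v \<longleftrightarrow> v < u"
  by (auto simp: less_split_real_def)

lemma flip_spt [simp]: "flip t (spt s 0) = spt (t - s) 1" "flip t (spt s 1) = spt (t - s) 0"
  by (simp_all add: split_real_eq_iff)

lemma continuous_on_flip:
  fixes F :: "split_real \<Rightarrow> real"
  assumes "continuous_on UNIV F"
  shows "continuous_on UNIV (\<lambda>u. F (flip t u))"
proof (rule continuous_on_nhds_splitI)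
  fix u and e :: real assume e: "0 < e"
  obtain a b where ab: "a < flip t u" "flip t u < b" "\<And>w. a < w \<Longrightarrow> w < b \<Longrightarrow> \<bar>F w - F (flip t u)\<bar> < e"
    by (rule continuous_on_nhds_splitD[OF assms e, of "flip t u"]) blast
  have *: "flip t b < u" "u < flip t a"
    using ab flip_less_iff[of t u "flip t b"] flip_less_iff[of t "flip t a" u] by simp_all
  have close: "\<bar>F (flip t w) - F (flip t u)\<bar> < e" if "flip t b < w" "w < flip t a" for w
    using that flip_less_iff[of t w "flip t b"] flip_less_iff[of t "flip t a" w] by (intro ab(3)) simp_all
  show "\<exists>a<u. \<forall>w. a < w \<longrightarrow> w \<le> u \<longrightarrow> \<bar>F (flip t w) - F (flip t u)\<bar> < e"
    using * close by (intro exI[of _ "flip t b"]) (auto intro: le_less_trans)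
  show "\<exists>b>u. \<forall>w. u \<le> w \<longrightarrow> w < b \<longrightarrow> \<bar>F (flip t w) - F (flip t u)\<bar> < e"
    using * close by (intro exI[of _ "flip t a"]) (auto intro: less_le_trans)
qed

text \<open>The cap at \<open>spt t 1\<close> makes the rotated lines vanish before time 0. Since
  \<open>flip\<close> exchanges the two ends of a fibre, the left limit in \<open>Rt\<close> appears
  at phase 1.\<close>

definition rotate_lines :: "nat \<Rightarrow> real \<Rightarrow> (nat \<Rightarrow> split_real \<Rightarrow> real) \<Rightarrow> nat \<Rightarrow> split_real \<Rightarrow> real" where
  "rotate_lines n t F = (\<lambda>j u. if j \<in> {1..n}
     then F (n + 1 - j) (spt t 1) - F (n + 1 - j) (min (spt t 1) (flip t u)) else 0)"

text \<open>Reversing the phase alone would let higher lines ramp first; renumbering the lines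
  reverses this order once more.\<close>

lemma line_ensemble_rotate:
  assumes F: "line_ensemble n F"
  shows "line_ensemble n (rotate_lines n t F)"
proof -
  note D = line_ensembleD[OF F]
  let ?R = "rotate_lines n t F"
  have c: "continuous_on UNIV (\<lambda>u. F l (min (spt t 1) (flip t u)))" for l
  proof -
    have "continuous_on UNIV (\<lambda>w. F l (min (spt t 1) w))"
      by (rule continuous_on_compose2[OF D(1)]) (auto intro: continuous_intros)
    then show ?thesis by (rule continuous_on_flip)
  qed
  have "continuous_on UNIV (?R j)" for j
  proof (cases "j \<in> {1..n}")
    case False
    then have "?R j = (\<lambda>_. 0)" by (auto simp: rotate_lines_def)
    then show ?thesis by simp
  qed (simp add: rotate_lines_def c continuous_on_diff)
  moreover have "?R j u = 0" if "u \<le> spt 0 0" for j u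
  proof -
    have "spt t 1 \<le> flip t u" using that flip_le_iff[of t "spt 0 0" u] by simp
    then show ?thesis by (simp add: rotate_lines_def min_absorb1)
  qed
  moreover have "?R j u = 0" if "j \<notin> {1..n}" for j u unfolding rotate_lines_def by (rule if_not_P[OF that])
  moreover have "?R j u \<le> ?R j v" if "base u = base v" "u \<le> v" for j u v
  proof -
    have "F l (min (spt t 1) (flip t v)) \<le> F l (min (spt t 1) (flip t u))" for l
    proof (cases "0 \<le> base u")
      case True
      then have "min (spt t 1) (flip t v) = flip t v" "min (spt t 1) (flip t u) = flip t u"
        using that by (auto simp: min_absorb2)
      then show ?thesis using D(4)[of "flip t v" "flip t u"] that by simp
    next
      case False
      then have "min (spt t 1) (flip t v) = spt t 1" "min (spt t 1) (flip t u) = spt t 1"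
        using that by (auto intro!: min_absorb1 less_imp_le)
      then show ?thesis by simp
    qed
    then show ?thesis by (simp add: rotate_lines_def)
  qed
  moreover have "?R i u = ?R i (spt (base u) 0) \<or> ?R j u = ?R j (spt (base u) 1)" if ij: "i < j" for i j u
  proof (cases "i \<in> {1..n} \<and> j \<in> {1..n}")
    case True
    show ?thesis
    proof (cases "0 \<le> base u")
      case nonneg: True
      have "F (n + 1 - j) (flip t u) = F (n + 1 - j) (spt (t - base u) 0) \<or>
          F (n + 1 - i) (flip t u) = F (n + 1 - i) (spt (t - base u) 1)"
        using D(5)[of "n + 1 - j" "n + 1 - i" "flip t u"] True ij by auto
      then show ?thesis using nonneg True by (auto simp: rotate_lines_def min_absorb2)
    next
      case False
      then have "min (spt t 1) (flip t u) = spt t 1" "min (spt t 1) (flip t (spt (base u) 0)) = spt t 1"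
        by (auto intro!: min_absorb1 less_imp_le)
      then show ?thesis by (simp add: rotate_lines_def)
    qed
  next
    case False
    then have "(\<forall>w. ?R i w = 0) \<or> (\<forall>w. ?R j w = 0)" by (auto simp: rotate_lines_def)
    then show ?thesis by metis
  qed
  ultimately show ?thesis unfolding line_ensemble_def by simp
qed

text \<open>Rotation reverses the order of the paths and of the columns as well as time; the
  interlacing inequalities are invariant under all three together.\<close>

lemma rotate_array:
  fixes t :: real
  assumes A: "A \<in> path_arrays k n u v" and u: "spt 0 0 \<le> u"
  defines "B \<equiv> \<lambda>i j. flip t (A (k - Suc i) (n - j))"
  shows "B \<in> path_arrays k n (flip t v) (flip t u)" "weight F k n B = weight (rotate_lines n t F) k n A"
proof -
  note D = path_arraysD[OF A] and Ab = path_arrays_bounds[OF A]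
  show "B \<in> path_arrays k n (flip t v) (flip t u)"
    unfolding path_arrays_def mem_Collect_eq
  proof (intro allI impI conjI)
    fix i assume i: "i < k"
    show "B i n = flip t v" "B i 0 = flip t u" using D(1,2)[of "k - Suc i"] i by (auto simp: B_def)
    fix j assume j: "j < n"
    have nj: "n - j = Suc (n - Suc j)" using j by simp
    show "B i (Suc j) \<le> B i j" using D(3)[of "k - Suc i" "n - Suc j"] i j unfolding B_def nj by simp
    assume i': "Suc i < k"
    have ki: "k - Suc i = Suc (k - Suc (Suc i))" using i' by simp
    show "B i j \<le> B (Suc i) (Suc j)"
      using D(4)[of "k - Suc (Suc i)" "n - Suc j"] i' j unfolding B_def nj ki by simp
  qed
  have min_eq: "min (spt t 1) (flip t (A i j)) = flip t (A i j)" if "i < k" "j \<le> n" for i j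
  proof -
    have "spt 0 0 \<le> A i j" using order.trans[OF u Ab(1)[OF that]] .
    then show ?thesis by (auto simp: min_absorb2)
  qed
  have "weight F k n B = (\<Sum>i<k. \<Sum>j<n. F (Suc (n - Suc j)) (B (k - Suc i) (n - Suc j)) -
      F (Suc (n - Suc j)) (B (k - Suc i) (Suc (n - Suc j))))"
    unfolding weight_def
    by (subst (1) sum.nat_diff_reindex[symmetric], subst (2) sum.nat_diff_reindex[symmetric]) simp
  also have "\<dots> = weight (rotate_lines n t F) k n A"
    unfolding weight_def
  proof (intro sum.cong refl)
    fix i j assume "i \<in> {..<k}" "j \<in> {..<n}"
    then have ij: "i < k" "j < n" by auto
    have e: "Suc (n - Suc j) = n - j" "k - Suc (k - Suc i) = i" "n - (n - Suc j) = Suc j" "n - (n - j) = j"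
      using ij by auto
    show "F (Suc (n - Suc j)) (B (k - Suc i) (n - Suc j)) - F (Suc (n - Suc j)) (B (k - Suc i) (Suc (n - Suc j)))
      = rotate_lines n t F (Suc j) (A i j) - rotate_lines n t F (Suc j) (A i (Suc j))"
      unfolding e B_def rotate_lines_def using ij min_eq[of i j] min_eq[of i "Suc j"] by simp
  qed
  finally show "weight F k n B = weight (rotate_lines n t F) k n A" .
qed

lemma array_lpp_rotate:
  assumes u: "spt 0 0 \<le> u" and v: "v \<le> spt t 1"
  shows "array_lpp (rotate_lines n t F) k n u v = array_lpp F k n (flip t v) (flip t u)"
proof (rule array_lpp_eqI)
  fix A assume A: "A \<in> path_arrays k n u v"
  show "\<exists>B\<in>path_arrays k n (flip t v) (flip t u). weight (rotate_lines n t F) k n A \<le> weight F k n B"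
    using rotate_array(1)[OF A u, of t] rotate_array(2)[OF A u, where t = t and F = F]
    by (intro bexI[of _ "\<lambda>i j. flip t (A (k - Suc i) (n - j))"]) simp_all
next
  fix B assume B: "B \<in> path_arrays k n (flip t v) (flip t u)"
  have "spt 0 0 \<le> flip t v" using v by (auto dest: base_mono)
  define A where "A = (\<lambda>i j. flip t (B (k - Suc i) (n - j)))"
  have A: "A \<in> path_arrays k n u v"
    using rotate_array(1)[OF B \<open>spt 0 0 \<le> flip t v\<close>, of t] by (simp add: A_def)
  have "weight (rotate_lines n t F) k n A = weight F k n (\<lambda>i j. flip t (A (k - Suc i) (n - j)))"
    using rotate_array(2)[OF A u, where t = t and F = F] by simp
  also have "\<dots> = weight F k n B"
    by (rule weight_cong) (auto simp: A_def)
  finally show "\<exists>A\<in>path_arrays k n u v. weight F k n B \<le> weight (rotate_lines n t F) k n A"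
    using A by (intro bexI[of _ A]) auto
qed

section \<open>Melons\<close>

text \<open>Any choice serves, since a sorted ensemble is determined by its array values from
  \<open>spt 0 0\<close>.\<close>

definition melon :: "nat \<Rightarrow> (nat \<Rightarrow> split_real \<Rightarrow> real) \<Rightarrow> nat \<Rightarrow> split_real \<Rightarrow> real" where
  "melon n F = (SOME H. line_ensemble n H \<and> (\<forall>k u v. array_lpp H k n u v = array_lpp F k n u v) \<and>
     (\<forall>j x. 1 \<le> j \<longrightarrow> j < n \<longrightarrow> H (Suc j) x \<le> H j x))"

lemma melon:
  assumes F: "line_ensemble n F"
  shows line_ensemble_melon: "line_ensemble n (melon n F)"
    and array_lpp_melon: "array_lpp (melon n F) k n u v = array_lpp F k n u v"
    and melon_sorted: "1 \<le> j \<Longrightarrow> j < n \<Longrightarrow> melon n F (Suc j) x \<le> melon n F j x"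
proof -
  have "\<exists>H. line_ensemble n H \<and> (\<forall>k u v. array_lpp H k n u v = array_lpp F k n u v) \<and>
     (\<forall>j x. 1 \<le> j \<longrightarrow> j < n \<longrightarrow> H (Suc j) x \<le> H j x)"
  proof -
    obtain H where "line_ensemble n H" "\<And>k u v. array_lpp H k n u v = array_lpp F k n u v"
      "\<And>j x. 1 \<le> j \<Longrightarrow> j < n \<Longrightarrow> H (Suc j) x \<le> H j x"
      by (rule pitman_sorting[where Q = "line_ensemble n" and F = F and n = n and z = "spt 0 0"])
        (use F line_ensemble_pitman line_ensembleD in \<open>blast+\<close>)
    then show ?thesis by (intro exI[of _ H]) simp
  qed
  from someI_ex[OF this] show "line_ensemble n (melon n F)"
    "array_lpp (melon n F) k n u v = array_lpp F k n u v"
    "1 \<le> j \<Longrightarrow> j < n \<Longrightarrow> melon n F (Suc j) x \<le> melon n F j x"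
    unfolding melon_def[symmetric] by simp_all
qed

lemma sum_sorted_ensemble:
  assumes F: "line_ensemble n F" and sorted: "\<And>j x. 1 \<le> j \<Longrightarrow> j < n \<Longrightarrow> F (Suc j) x \<le> F j x"
    and "k \<le> n" "spt 0 0 \<le> v"
  shows "(\<Sum>i<k. F (Suc i) v) = array_lpp F k n (spt 0 0) v"
  by (rule array_lpp_sorted[symmetric]) (use assms line_ensembleD[OF F] in auto)

lemma sum_melon:
  assumes F: "line_ensemble n F" and "k \<le> n" "spt 0 0 \<le> v"
  shows "(\<Sum>i<k. melon n F (Suc i) v) = array_lpp F k n (spt 0 0) v"
  using sum_sorted_ensemble[OF line_ensemble_melon[OF F] melon_sorted[OF F] assms(2,3)]
  by (simp add: array_lpp_melon[OF F])

lemma melon_diff: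
  assumes F: "line_ensemble n F" and "k \<in> {1..n}" "spt 0 0 \<le> v"
  shows "melon n F k v = array_lpp F k n (spt 0 0) v - array_lpp F (k - 1) n (spt 0 0) v"
proof -
  obtain l where l: "k = Suc l" using assms(2) by (cases k) auto
  show ?thesis using sum_melon[OF F _ assms(3), of k] sum_melon[OF F _ assms(3), of l] assms(2) l by simp
qed

lemma melon_of_sorted:
  assumes F: "line_ensemble n F" and sorted: "\<And>j x. 1 \<le> j \<Longrightarrow> j < n \<Longrightarrow> F (Suc j) x \<le> F j x"
  shows "melon n F = F"
proof (intro ext)
  fix k v
  show "melon n F k v = F k v"
  proof (cases "k \<in> {1..n} \<and> spt 0 0 \<le> v")
    case True
    then obtain l where l: "k = Suc l" by (cases k) auto
    show ?thesis
      using melon_diff[OF F, of k v] sum_sorted_ensemble[OF F sorted, of k v]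
        sum_sorted_ensemble[OF F sorted, of l v] True l by simp
  next
    case False
    then have "k \<notin> {1..n} \<or> v \<le> spt 0 0" by (meson linear)
    then show ?thesis
      using line_ensembleD(2,3)[OF F] line_ensembleD(2,3)[OF line_ensemble_melon[OF F]] by metis
  qed
qed

lemma W_eq_melon:
  assumes F: "line_ensemble n F" and m: "matches n f F 0 y" and "0 \<le> y" "k \<in> {1..n}"
  shows "W n f k y = melon n F k (spt y 1)"
  using assms(3,4) melon_diff[OF F assms(4), of "spt y 1"]
    multi_lpp_eq_array_lpp[OF F m, of k] multi_lpp_eq_array_lpp[OF F m, of "k - 1"]
  by (auto simp: W_def)

lemma matches_sample: "line_ensemble n F \<Longrightarrow> matches n (sample F) F x y"
  unfolding matches_def by (simp add: left_lim_sample) (simp add: sample_def)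

lemma sample_eqI:
  assumes "\<And>i x. i \<in> {1..n} \<Longrightarrow> 0 \<le> x \<Longrightarrow> f i x = F i (spt x 1)" and F: "line_ensemble n F"
    "\<And>i x. i \<notin> {1..n} \<or> x < 0 \<Longrightarrow> f i x = 0"
  shows "f = sample F"
proof (intro ext)
  fix i x
  show "f i x = sample F i x"
  proof (cases "i \<in> {1..n} \<and> 0 \<le> x")
    case False
    then have "sample F i x = 0" using sample_in_Dn[OF F(1)] by (auto simp: Dn_def)
    then show ?thesis using assms(3)[of i x] False by auto
  qed (use assms(1) in \<open>simp add: sample_def\<close>)
qed

lemma W_sample:
  assumes F: "line_ensemble n F"
  shows "W n (sample F) = sample (melon n F)"
proof (rule sample_eqI[OF _ line_ensemble_melon[OF F]])
  show "W n (sample F) i x = melon n F i (spt x 1)" if "i \<in> {1..n}" "0 \<le> x" for i x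
    by (rule W_eq_melon[OF F matches_sample[OF F] that(2,1)])
qed (auto simp: W_def)

text \<open>Sortedness is evaluated at the cut between the two ramps, where the lower line has
  reached its value and the upper one is still at its left limit.\<close>

lemma sample_melon_in_Dn_up:
  assumes F: "line_ensemble n F"
  shows "sample (melon n F) \<in> Dn_up n"
proof -
  let ?H = "melon n F"
  note le = line_ensemble_melon[OF F]
  have "sample ?H i y \<le> left_lim (sample ?H (i - 1)) y" if i: "i \<in> {2..n}" for i y
  proof -
    obtain j where j: "i = Suc j" "1 \<le> j" "j < n" using i by (cases i) auto
    obtain d where d: "\<And>j. ?H j (d j) = ?H j (spt y 0)" "\<And>j. ?H (Suc j) (d j) = ?H (Suc j) (spt y 1)"
      by (rule line_ensemble_cuts[OF le, of y]) blast
    show ?thesis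
      using melon_sorted[OF F j(2,3), of "d j"] d[of j] j
      by (simp add: left_lim_sample[OF le]) (simp add: sample_def)
  qed
  then show ?thesis using sample_in_Dn[OF le] by (simp add: Dn_up_def)
qed

lemma Rt_restr:
  assumes G: "line_ensemble n G" and g: "\<And>j y. j \<in> {1..n} \<Longrightarrow> 0 \<le> y \<Longrightarrow> y \<le> t \<Longrightarrow> g j y = G j (spt y 1)"
    and j: "j \<in> {1..n}" and x: "x \<le> t" and t: "0 \<le> t"
  shows "Rt n t (restr t g) j x = rotate_lines n t G j (spt x 1)"
proof (cases "0 \<le> x")
  case True
  let ?j = "n + 1 - j"
  have j': "?j \<in> {1..n}" using j by auto
  have "left_lim (restr t g ?j) (t - x) = G ?j (spt (t - x) 0)"
  proof (rule left_lim_eqI[OF line_ensembleD(1)[OF G]])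
    have "restr t g ?j y = G ?j (spt y 1)" if "y < t - x" for y
    proof (cases "0 \<le> y")
      case False
      then have "G ?j (spt y 1) = 0" by (intro line_ensembleD(2)[OF G]) (simp add: less_eq_split_real_def)
      then show ?thesis using False by (simp add: restr_def)
    qed (use that True g[OF j'] in \<open>simp add: restr_def\<close>)
    then show "eventually (\<lambda>y. restr t g ?j y = G ?j (spt y 1)) (at_left (t - x))"
      by (intro eventually_mono[OF eventually_at_left_real[of "t - x - 1"]]) auto
  qed
  moreover have "restr t g ?j t = G ?j (spt t 1)" using g[OF j', of t] t by (simp add: restr_def)
  ultimately show ?thesis
    using True j x by (simp add: Rt_def rotate_lines_def min_absorb2)
next
  case False
  then have "rotate_lines n t G j (spt x 1) = 0"
    by (intro line_ensembleD(2)[OF line_ensemble_rotate[OF G]]) (simp add: less_eq_split_real_def)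
  then show ?thesis using False by (simp add: Rt_def)
qed

lemma M_approx_sample:
  assumes F: "line_ensemble n F" and i: "i \<in> {1..n}" and x: "0 \<le> x" "x \<le> t"
  shows "M_approx n (sample F) t i x = rotate_lines n t (melon n (rotate_lines n t F)) i (spt x 1)"
proof -
  have t: "0 \<le> t" using x by simp
  let ?H = "rotate_lines n t F" and ?h = "Rt n t (restr t (sample F))"
  note H = line_ensemble_rotate[OF F, of t]
  have h: "?h j y = ?H j (spt y 1)" if "j \<in> {1..n}" "y \<le> t" for j y
    by (rule Rt_restr[OF F _ that t]) (simp add: sample_def)
  have m: "matches n ?h ?H 0 y" if y: "y \<le> t" for y
    unfolding matches_def
  proof (intro ballI conjI)
    fix j s assume j: "j \<in> {1..n}" and s: "s \<in> {0..y}"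
    show "?H j (spt s 1) = ?h j s" using h[OF j, of s] s y by simp
    have "eventually (\<lambda>x. ?h j x = ?H j (spt x 1)) (at_left s)"
      by (rule eventually_mono[OF eventually_at_left_real[of "s - 1"]]) (use h[OF j] s y in auto)
    then show "?H j (spt s 0) = left_lim (?h j) s"
      using left_lim_eqI[OF line_ensembleD(1)[OF H]] by simp
  qed
  have "W n ?h k y = melon n ?H k (spt y 1)" if "k \<in> {1..n}" "0 \<le> y" "y \<le> t" for k y
    using W_eq_melon[OF H m] that by simp
  then show ?thesis
    unfolding M_approx_def Wt_def by (intro Rt_restr[OF line_ensemble_melon[OF H] _ i x(2) t])
qed

definition finite_melon :: "nat \<Rightarrow> (nat \<Rightarrow> split_real \<Rightarrow> real) \<Rightarrow> real \<Rightarrow> nat \<Rightarrow> split_real \<Rightarrow> real" where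
  "finite_melon n F t = rotate_lines n t (melon n (rotate_lines n t F))"

lemma line_ensemble_finite_melon: "line_ensemble n F \<Longrightarrow> line_ensemble n (finite_melon n F t)"
  unfolding finite_melon_def by (intro line_ensemble_rotate line_ensemble_melon)

text \<open>Rotation exchanges the roles of start and end, so preservation of the values between two
  arbitrary points, not only from time 0, is what makes the two rotations cancel.\<close>

lemma array_lpp_finite_melon:
  assumes F: "line_ensemble n F" and uv: "spt 0 0 \<le> u" "u \<le> v" "v \<le> spt t 1"
  shows "array_lpp (finite_melon n F t) k n u v = array_lpp F k n u v"
proof -
  have "spt 0 0 \<le> flip t v" "flip t u \<le> spt t 1"
    using uv base_mono[of u v] by (auto dest: base_mono)
  then show ?thesis
    using array_lpp_rotate[OF uv(1,3), of n "melon n (rotate_lines n t F)" k]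
      array_lpp_melon[OF line_ensemble_rotate[OF F, of t], of k "flip t v" "flip t u"]
      array_lpp_rotate[of "flip t v" "flip t u" t n F k]
    by (simp add: finite_melon_def)
qed

lemma sum_finite_melon:
  assumes F: "line_ensemble n F" and u: "spt 0 0 \<le> u" "u \<le> spt t 1" and k: "k \<le> n"
  shows "(\<Sum>i<k. finite_melon n F t (n - i) u) =
    array_lpp F k n (spt 0 0) (spt t 1) - array_lpp F k n u (spt t 1)"
proof -
  let ?H = "rotate_lines n t F"
  note H = line_ensemble_rotate[OF F, of t]
  have t: "0 \<le> t" using u by (auto dest: base_mono)
  have fu: "flip t u \<le> spt t 1" "spt 0 0 \<le> flip t u" using u by auto
  have "(\<Sum>i<k. finite_melon n F t (n - i) u) =
      (\<Sum>i<k. melon n ?H (Suc i) (spt t 1) - melon n ?H (Suc i) (flip t u))"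
  proof (intro sum.cong refl)
    fix i assume "i \<in> {..<k}"
    then have "n - i \<in> {1..n}" "n + 1 - (n - i) = Suc i" using k by auto
    then show "finite_melon n F t (n - i) u = melon n ?H (Suc i) (spt t 1) - melon n ?H (Suc i) (flip t u)"
      using fu by (simp add: finite_melon_def rotate_lines_def min_absorb2)
  qed
  also have "\<dots> = array_lpp ?H k n (spt 0 0) (spt t 1) - array_lpp ?H k n (spt 0 0) (flip t u)"
    using sum_melon[OF H k, of "spt t 1"] sum_melon[OF H k, of "flip t u"] fu t
    by (simp add: sum_subtractf)
  also have "\<dots> = array_lpp F k n (spt 0 0) (spt t 1) - array_lpp F k n u (spt t 1)"
    using array_lpp_rotate[of "spt 0 0" "spt t 1" t n F k] array_lpp_rotate[of "spt 0 0" "flip t u" t n F k] fu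
    by simp
  finally show ?thesis .
qed

section \<open>The limit of rotated melons\<close>

lemma tendsto_at_top_antimono:
  fixes g :: "real \<Rightarrow> real"
  assumes anti: "\<And>s t. a \<le> s \<Longrightarrow> s \<le> t \<Longrightarrow> g t \<le> g s" and lb: "\<And>t. a \<le> t \<Longrightarrow> c \<le> g t"
  shows "(g \<longlongrightarrow> Inf (g ` {a..})) at_top"
proof (rule tendstoI)
  fix e :: real assume e: "0 < e"
  have bdd: "bdd_below (g ` {a..})" by (rule bdd_belowI[of _ c]) (use lb in auto)
  have "Inf (g ` {a..}) < Inf (g ` {a..}) + e" using e by simp
  then obtain s where s: "a \<le> s" "g s < Inf (g ` {a..}) + e"
    using cInf_lessD[of "g ` {a..}" "Inf (g ` {a..}) + e"] by auto
  have "dist (g t) (Inf (g ` {a..})) < e" if t: "s \<le> t" for t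
  proof -
    have "Inf (g ` {a..}) \<le> g t" by (rule cInf_lower[OF _ bdd]) (use s t in auto)
    then show ?thesis using anti[OF s(1) t] s(2) by (simp add: dist_real_def)
  qed
  then show "eventually (\<lambda>t. dist (g t) (Inf (g ` {a..})) < e) at_top"
    by (auto simp: eventually_at_top_linorder)
qed

section \<open>Busemann functions of last passage values\<close>

definition lpp_increment :: "nat \<Rightarrow> (nat \<Rightarrow> split_real \<Rightarrow> real) \<Rightarrow> nat \<Rightarrow> real \<Rightarrow> split_real \<Rightarrow> real" where
  "lpp_increment n F k t u = array_lpp F k n (spt 0 0) (spt t 1) - array_lpp F k n u (spt t 1)"

definition busemann :: "nat \<Rightarrow> (nat \<Rightarrow> split_real \<Rightarrow> real) \<Rightarrow> nat \<Rightarrow> split_real \<Rightarrow> real" where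
  "busemann n F k u = Inf ((\<lambda>t. lpp_increment n F k t u) ` {base u..})"

definition limit_melon :: "nat \<Rightarrow> (nat \<Rightarrow> split_real \<Rightarrow> real) \<Rightarrow> nat \<Rightarrow> split_real \<Rightarrow> real" where
  "limit_melon n F j u = (if j \<in> {1..n} \<and> spt 0 0 \<le> u
     then busemann n F (n + 1 - j) u - busemann n F (n - j) u else 0)"

context
  fixes n :: nat and F :: "nat \<Rightarrow> split_real \<Rightarrow> real"
  assumes F: "line_ensemble n F"
begin

lemma ensemble_cont: "\<forall>j\<in>{1..n}. continuous_on UNIV (F j)"
  using line_ensembleD(1)[OF F] by blast

lemma lpp_increment_diff_antimono:
  assumes "k \<le> n" "u \<le> v" "base v \<le> t" "t \<le> t'"
  shows "lpp_increment n F k t' v - lpp_increment n F k t' u \<le> lpp_increment n F k t v - lpp_increment n F k t u"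
proof -
  have "v \<le> spt t 1" "spt t 1 \<le> spt t' 1" using assms by auto
  then show ?thesis
    using array_lpp_quadrangle[OF ensemble_cont assms(1,2), of "spt t 1" "spt t' 1"]
    by (simp add: lpp_increment_def)
qed

lemma lpp_increment_0: "lpp_increment n F k t (spt 0 0) = 0"
  by (simp add: lpp_increment_def)

text \<open>Following the \<open>k\<close> lowest lines up to \<open>u\<close> is one way to start.
  This bound does not involve \<open>t\<close>, so the decreasing limit is finite.\<close>

lemma lpp_increment_lower:
  assumes "k \<le> n" "spt 0 0 \<le> u" "base u \<le> t"
  shows "(\<Sum>i<k. F (Suc (n - k + i)) u) \<le> lpp_increment n F k t u"
proof -
  have "u \<le> spt t 1" using assms by simp
  then show ?thesis
    using array_lpp_prepend[OF ensemble_cont assms(1,2), of "spt t 1"] line_ensembleD(2)[OF F, of "spt 0 0"]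
    by (simp add: lpp_increment_def)
qed

lemma busemann:
  assumes "k \<le> n" "spt 0 0 \<le> u"
  shows tendsto_busemann: "((\<lambda>t. lpp_increment n F k t u) \<longlongrightarrow> busemann n F k u) at_top"
    and busemann_le: "base u \<le> t \<Longrightarrow> busemann n F k u \<le> lpp_increment n F k t u"
proof -
  show "((\<lambda>t. lpp_increment n F k t u) \<longlongrightarrow> busemann n F k u) at_top"
    unfolding busemann_def
  proof (rule tendsto_at_top_antimono)
    fix s t assume "base u \<le> s" "s \<le> t"
    then show "lpp_increment n F k t u \<le> lpp_increment n F k s u"
      using lpp_increment_diff_antimono[OF assms, of s t] by (simp add: lpp_increment_0)
  qed (rule lpp_increment_lower[OF assms])
  have bdd: "bdd_below ((\<lambda>t. lpp_increment n F k t u) ` {base u..})"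
    by (rule bdd_belowI2) (use lpp_increment_lower[OF assms] in auto)
  show "busemann n F k u \<le> lpp_increment n F k t u" if "base u \<le> t"
    unfolding busemann_def by (rule cInf_lower[OF _ bdd]) (use that in auto)
qed

lemma busemann_gap_mono:
  assumes "k \<le> n" "spt 0 0 \<le> u" "u \<le> v" "base v \<le> t"
  shows "lpp_increment n F k t u - busemann n F k u \<le> lpp_increment n F k t v - busemann n F k v"
proof -
  have v: "spt 0 0 \<le> v" using assms by (meson order.trans)
  have "busemann n F k v - busemann n F k u \<le> lpp_increment n F k t v - lpp_increment n F k t u"
  proof (rule tendsto_upperbound)
    show "((\<lambda>t. lpp_increment n F k t v - lpp_increment n F k t u) \<longlongrightarrow> busemann n F k v - busemann n F k u) at_top"
      by (intro tendsto_diff tendsto_busemann assms v)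
    show "eventually (\<lambda>t'. lpp_increment n F k t' v - lpp_increment n F k t' u
        \<le> lpp_increment n F k t v - lpp_increment n F k t u) at_top"
      using eventually_ge_at_top[of t]
      by (rule eventually_mono) (rule lpp_increment_diff_antimono[OF assms(1,3,4)])
  qed simp
  then show ?thesis by simp
qed

lemma finite_melon_increment:
  assumes "j \<in> {1..n}" "spt 0 0 \<le> u" "base u \<le> t"
  shows "finite_melon n F t j u = lpp_increment n F (n + 1 - j) t u - lpp_increment n F (n - j) t u"
proof -
  have u: "u \<le> spt t 1" using assms by simp
  define m where "m = n - j"
  have m: "n + 1 - j = Suc m" "n - m = j" "Suc m \<le> n" "m \<le> n" using assms(1) by (auto simp: m_def)
  have "finite_melon n F t (n - m) u = lpp_increment n F (Suc m) t u - lpp_increment n F m t u"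
    using sum_finite_melon[OF F assms(2) u m(3)] sum_finite_melon[OF F assms(2) u m(4)]
    by (simp add: lpp_increment_def)
  then show ?thesis unfolding m(1,2) m_def[symmetric] .
qed

text \<open>The two gaps at \<open>u\<close> are nonnegative and enter with opposite signs, so their
  sum bounds the difference; as gaps grow along the line, those at \<open>v\<close> serve all
  \<open>u \<le> v\<close> at once.\<close>

lemma finite_melon_close:
  assumes "spt 0 0 \<le> v" "u \<le> v" "base v \<le> t" "j \<in> {1..n}"
  shows "\<bar>finite_melon n F t j u - limit_melon n F j u\<bar> \<le>
    (lpp_increment n F (n + 1 - j) t v - busemann n F (n + 1 - j) v) +
    (lpp_increment n F (n - j) t v - busemann n F (n - j) v)"
proof -
  have k: "n + 1 - j \<le> n" "n - j \<le> n" using assms(4) by auto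
  show ?thesis
  proof (cases "spt 0 0 \<le> u")
    case True
    have ut: "base u \<le> t" using assms base_mono[of u v] by simp
    note g = busemann_gap_mono[OF k(1) True assms(2,3)] busemann_gap_mono[OF k(2) True assms(2,3)]
    note p = busemann_le[OF k(1) True ut] busemann_le[OF k(2) True ut]
    have "limit_melon n F j u = busemann n F (n + 1 - j) u - busemann n F (n - j) u"
      using True assms(4) by (simp only: limit_melon_def if_True simp_thms)
    then show ?thesis using g p finite_melon_increment[OF assms(4) True ut] by linarith
  next
    case False
    then have "finite_melon n F t j u = 0"
      by (intro line_ensembleD(2)[OF line_ensemble_finite_melon[OF F]]) (meson linear)
    moreover have "limit_melon n F j u = 0" using False by (simp only: limit_melon_def if_False simp_thms)
    ultimately show ?thesis
      using busemann_le[OF k(1) assms(1,3)] busemann_le[OF k(2) assms(1,3)] by simp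
  qed
qed

lemma uniform_limit_melon:
  assumes "spt 0 0 \<le> v" "j \<in> {1..n}"
  shows "uniform_limit {..v} (\<lambda>t. finite_melon n F t j) (limit_melon n F j) at_top"
proof (rule uniform_limitI)
  fix e :: real assume e: "0 < e"
  let ?g = "\<lambda>t. (lpp_increment n F (n + 1 - j) t v - busemann n F (n + 1 - j) v) +
    (lpp_increment n F (n - j) t v - busemann n F (n - j) v)"
  have k: "n + 1 - j \<le> n" "n - j \<le> n" using assms(2) by auto
  have "(?g \<longlongrightarrow> (busemann n F (n + 1 - j) v - busemann n F (n + 1 - j) v) + (busemann n F (n - j) v - busemann n F (n - j) v)) at_top"
    by (intro tendsto_intros tendsto_busemann k assms)
  then have "eventually (\<lambda>t. ?g t < e) at_top" using e by (intro order_tendstoD(2)) simp_all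
  then show "eventually (\<lambda>t. \<forall>u\<in>{..v}. dist (finite_melon n F t j u) (limit_melon n F j u) < e) at_top"
    using eventually_ge_at_top[of "base v"]
  proof eventually_elim
    case (elim t)
    then show ?case
      using finite_melon_close[OF assms(1) _ _ assms(2), of _ t] by (auto simp: dist_real_def intro: le_less_trans)
  qed
qed

lemma tendsto_limit_melon: "((\<lambda>t. finite_melon n F t j u) \<longlongrightarrow> limit_melon n F j u) at_top"
proof (cases "j \<in> {1..n}")
  case True
  have "uniform_limit {..max u (spt 0 0)} (\<lambda>t. finite_melon n F t j) (limit_melon n F j) at_top"
    by (rule uniform_limit_melon[OF _ True]) simp
  then show ?thesis by (rule tendsto_uniform_limitI) simp
next
  case False
  then have "limit_melon n F j u = 0" by (auto simp: limit_melon_def)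
  then show ?thesis using line_ensembleD(3)[OF line_ensemble_finite_melon[OF F] False] by simp
qed

lemma line_ensemble_limit_melon: "line_ensemble n (limit_melon n F)"
proof -
  note D = line_ensembleD[OF line_ensemble_finite_melon[OF F]]
  have cont: "continuous_on UNIV (limit_melon n F j)" for j
  proof (cases "j \<in> {1..n}")
    case True
    have "isCont (limit_melon n F j) u" for u
    proof -
      define v where "v = spt (max 0 (base u + 1)) 0"
      have "continuous_on {..v} (limit_melon n F j)"
      proof (rule uniform_limit_theorem)
        show "uniform_limit {..v} (\<lambda>t. finite_melon n F t j) (limit_melon n F j) at_top"
          by (rule uniform_limit_melon[OF _ True]) (simp add: v_def)
        show "eventually (\<lambda>t. continuous_on {..v} (finite_melon n F t j)) at_top"
          using D(1) by (intro always_eventually allI) (rule continuous_on_subset, auto)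
      qed simp
      then have "continuous_on {..<v} (limit_melon n F j)" by (rule continuous_on_subset) auto
      moreover have "u \<in> {..<v}" by (simp add: v_def)
      ultimately show ?thesis by (meson continuous_on_eq_continuous_at open_lessThan)
    qed
    then show ?thesis by (simp add: continuous_on_eq_continuous_at)
  next
    case False
    then have "limit_melon n F j = (\<lambda>_. 0)" unfolding limit_melon_def by auto
    then show ?thesis by simp
  qed
  have zero: "limit_melon n F j u = 0" if "u \<le> spt 0 0" for j u
    by (rule tendsto_unique[OF _ tendsto_limit_melon]) (use D(2)[OF that] in simp_all)
  have out: "limit_melon n F j u = 0" if "j \<notin> {1..n}" for j u
    by (rule tendsto_unique[OF _ tendsto_limit_melon]) (use D(3)[OF that] in simp_all)
  have mono: "limit_melon n F j u \<le> limit_melon n F j v" if "base u = base v" "u \<le> v" for j u v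
    by (rule tendsto_le[OF _ tendsto_limit_melon tendsto_limit_melon]) (use D(4)[OF that] in simp_all)
  have seq: "limit_melon n F i u = limit_melon n F i (spt (base u) 0) \<or> limit_melon n F j u = limit_melon n F j (spt (base u) 1)"
    if "i < j" for i j u
  proof -
    \<comment> \<open>The alternative is encoded as a vanishing product, which passes to the limit
      even if the valid alternative depends on \<open>t\<close>.\<close>
    let ?p = "\<lambda>E :: nat \<Rightarrow> split_real \<Rightarrow> real. (E i u - E i (spt (base u) 0)) * (E j u - E j (spt (base u) 1))"
    have eq: "(\<lambda>t. ?p (finite_melon n F t)) = (\<lambda>_. 0)" using D(5)[OF that] by fastforce
    have "((\<lambda>t. ?p (finite_melon n F t)) \<longlongrightarrow> ?p (limit_melon n F)) at_top"
      by (intro tendsto_intros tendsto_limit_melon)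
    then have "((\<lambda>_ :: real. 0 :: real) \<longlongrightarrow> ?p (limit_melon n F)) at_top" unfolding eq .
    then have "?p (limit_melon n F) = 0" by (rule tendsto_unique[rotated, OF _ tendsto_const]) simp
    then show ?thesis by simp
  qed
  show ?thesis unfolding line_ensemble_def
    by (intro conjI allI impI, rule cont, erule zero, erule out, erule (1) mono, erule seq)
qed

text \<open>For \<open>t\<close> beyond \<open>base v\<close> the values of
  \<open>finite_melon\<close> equal those of \<open>F\<close>, while uniform convergence up to
  \<open>v\<close> makes them converge to those of the limit.\<close>

lemma array_lpp_limit_melon:
  assumes uv: "spt 0 0 \<le> u" "u \<le> v" and k: "k \<le> n"
  shows "array_lpp (limit_melon n F) k n u v = array_lpp F k n u v"
proof -
  have v: "spt 0 0 \<le> v" using uv by (meson order.trans)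
  have "((\<lambda>t. array_lpp (finite_melon n F t) k n u v) \<longlongrightarrow> array_lpp (limit_melon n F) k n u v) at_top"
  proof (rule tendstoI)
    fix e :: real assume e: "0 < e"
    define c where "c = real k * (real n * 2)"
    have c: "0 < c + 1" by (simp add: c_def add_nonneg_pos)
    define d where "d = e / (2 * (c + 1))"
    have d: "0 < d" "c * d < e"
    proof -
      show "0 < d" using e c by (simp add: d_def)
      have "(c + 1) * d = e / 2" using c by (simp add: d_def field_simps)
      then show "c * d < e" using \<open>0 < d\<close> e by (simp add: algebra_simps)
    qed
    have "eventually (\<lambda>t. \<forall>j\<in>{1..n}. \<forall>w\<in>{..v}. dist (finite_melon n F t j w) (limit_melon n F j w) < d) at_top"
      by (rule eventually_ball_finite) (use uniform_limitD[OF uniform_limit_melon[OF v] d(1)] in auto)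
    then show "eventually (\<lambda>t. dist (array_lpp (finite_melon n F t) k n u v) (array_lpp (limit_melon n F) k n u v) < e) at_top"
    proof (rule eventually_mono)
      fix t assume t: "\<forall>j\<in>{1..n}. \<forall>w\<in>{..v}. dist (finite_melon n F t j w) (limit_melon n F j w) < d"
      have "\<bar>array_lpp (finite_melon n F t) k n u v - array_lpp (limit_melon n F) k n u v\<bar> \<le> real k * (real n * (2 * d))"
      proof (rule array_lpp_perturb)
        show "\<forall>j\<in>{1..n}. continuous_on UNIV (finite_melon n F t j)"
          using line_ensembleD(1)[OF line_ensemble_finite_melon[OF F]] by blast
        show "\<forall>j\<in>{1..n}. continuous_on UNIV (limit_melon n F j)"
          using line_ensembleD(1)[OF line_ensemble_limit_melon] by blast
        show "\<bar>finite_melon n F t j w - limit_melon n F j w\<bar> \<le> d" if "1 \<le> j" "j \<le> n" "w \<le> v" for j w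
        proof -
          have "dist (finite_melon n F t j w) (limit_melon n F j w) < d" using t that by simp
          then show ?thesis by (simp add: dist_real_def)
        qed
      qed (use k uv in auto)
      then show "dist (array_lpp (finite_melon n F t) k n u v) (array_lpp (limit_melon n F) k n u v) < e"
        using d(2) by (simp add: dist_real_def c_def mult.assoc)
    qed
  qed
  moreover have "((\<lambda>t. array_lpp (finite_melon n F t) k n u v) \<longlongrightarrow> array_lpp F k n u v) at_top"
  proof (rule tendsto_eventually)
    show "eventually (\<lambda>t. array_lpp (finite_melon n F t) k n u v = array_lpp F k n u v) at_top"
      using eventually_ge_at_top[of "base v"]
      by (rule eventually_mono) (rule array_lpp_finite_melon[OF F uv], simp)
  qed
  ultimately show ?thesis by (rule tendsto_unique[rotated]) simp
qed

lemma sum_limit_melon: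
  assumes "k \<le> n" "spt 0 0 \<le> u"
  shows "(\<Sum>i<k. limit_melon n F (n - i) u) = busemann n F k u"
proof (rule tendsto_unique)
  show "((\<lambda>t. \<Sum>i<k. finite_melon n F t (n - i) u) \<longlongrightarrow> (\<Sum>i<k. limit_melon n F (n - i) u)) at_top"
    by (intro tendsto_sum tendsto_limit_melon)
  have "eventually (\<lambda>t. lpp_increment n F k t u = (\<Sum>i<k. finite_melon n F t (n - i) u)) at_top"
    using eventually_ge_at_top[of "base u"]
    by (rule eventually_mono) (use sum_finite_melon[OF F assms(2) _ assms(1)] in \<open>simp add: lpp_increment_def\<close>)
  then show "((\<lambda>t. \<Sum>i<k. finite_melon n F t (n - i) u) \<longlongrightarrow> busemann n F k u) at_top"
    using tendsto_busemann[OF assms] by (rule Lim_transform_eventually[rotated])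
qed simp

lemma M_sample: "M n (sample F) = sample (limit_melon n F)"
proof (rule sample_eqI[OF _ line_ensemble_limit_melon])
  fix i and x :: real assume i: "i \<in> {1..n}" and x: "0 \<le> x"
  have "eventually (\<lambda>t. finite_melon n F t i (spt x 1) = M_approx n (sample F) t i x) at_top"
    using eventually_ge_at_top[of x]
    by (rule eventually_mono) (use M_approx_sample[OF F i x] in \<open>simp add: finite_melon_def\<close>)
  then have "((\<lambda>t. M_approx n (sample F) t i x) \<longlongrightarrow> limit_melon n F i (spt x 1)) at_top"
    using tendsto_limit_melon by (rule Lim_transform_eventually[rotated])
  then have "Lim at_top (\<lambda>t. M_approx n (sample F) t i x) = limit_melon n F i (spt x 1)"
    by (intro tendsto_Lim) simp_all
  then show "M n (sample F) i x = limit_melon n F i (spt x 1)" using i x by (simp add: M_def)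
qed (auto simp: M_def)

lemma uniform_limit_M:
  assumes K: "compact K" "K \<subseteq> {0..}" and i: "i \<in> {1..n}"
  shows "uniform_limit K (\<lambda>t. M_approx n (sample F) t i) (M n (sample F) i) at_top"
proof -
  obtain b where b: "\<And>x. x \<in> K \<Longrightarrow> x \<le> b" "0 \<le> b"
    using compact_imp_bounded[OF K(1)] unfolding bounded_iff
    by (metis abs_le_D1 abs_ge_zero dual_order.trans linear real_norm_def)
  have M_lim: "M n (sample F) i x = limit_melon n F i (spt x 1)" for x
    unfolding M_sample by (simp add: sample_def)
  have ul: "uniform_limit {..spt b 1} (\<lambda>t. finite_melon n F t i) (limit_melon n F i) at_top"
    by (rule uniform_limit_melon[OF _ i]) (use b in simp)
  have "eventually (\<lambda>t. \<forall>x\<in>K. dist (M_approx n (sample F) t i x) (M n (sample F) i x) < e) at_top"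
    if e: "0 < e" for e
    using uniform_limitD[OF ul e] eventually_ge_at_top[of b]
  proof eventually_elim
    case (elim t)
    show ?case
    proof
      fix x assume x: "x \<in> K"
      then have "0 \<le> x" "x \<le> t" "x \<le> b" using K b elim by force+
      then show "dist (M_approx n (sample F) t i x) (M n (sample F) i x) < e"
        using elim(1) M_approx_sample[OF F i, of x t, folded finite_melon_def] M_lim by simp
    qed
  qed
  then show ?thesis by (rule uniform_limitI)
qed

end

text \<open>This serves twice: applied to the limit itself it gives idempotence, applied to the
  melon it shows that \<open>W\<close> loses nothing that \<open>M\<close> sees.\<close>

lemma limit_melon_cong:
  assumes eq: "\<And>k u v. k \<le> n \<Longrightarrow> spt 0 0 \<le> u \<Longrightarrow> u \<le> v \<Longrightarrow> array_lpp F k n u v = array_lpp G k n u v"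
  shows "limit_melon n F = limit_melon n G"
proof (intro ext)
  fix j u
  show "limit_melon n F j u = limit_melon n G j u"
  proof (cases "j \<in> {1..n} \<and> spt 0 0 \<le> u")
    case True
    have "busemann n F k u = busemann n G k u" if "k \<le> n" for k
    proof -
      have "lpp_increment n F k t u = lpp_increment n G k t u" if "base u \<le> t" for t
        unfolding lpp_increment_def using eq[OF \<open>k \<le> n\<close>, of "spt 0 0" "spt t 1"] eq[OF \<open>k \<le> n\<close>, of u "spt t 1"] True that
        by auto
      then show ?thesis unfolding busemann_def by (intro arg_cong[of _ _ Inf] image_cong) auto
    qed
    then show ?thesis using True by (auto simp: limit_melon_def)
  qed (auto simp only: limit_melon_def if_False)
qed

lemma limit_melon_idem: "line_ensemble n F \<Longrightarrow> limit_melon n (limit_melon n F) = limit_melon n F"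
  by (rule limit_melon_cong) (rule array_lpp_limit_melon)

lemma multi_lpp_sample:
  assumes "line_ensemble n F" "k \<le> n" "0 \<le> x" "x \<le> y"
  shows "multi_lpp (sample F) k (x, n) (y, 1) = array_lpp F k n (spt x 0) (spt y 1)"
  using multi_lpp_eq_array_lpp[OF assms(1) matches_sample[OF assms(1)] assms(2-4)] .

lemma lpp_eq_multi_lpp:
  assumes "1 \<le> n"
  shows "lpp f (x, n) (y, 1) = multi_lpp f 1 (x, n) (y, 1)"
proof -
  have "{\<pi>. is_path (x, n) (y, 1) \<pi>} = (\<lambda>\<pi>. \<pi> 1) ` {\<pi>. disjoint_paths 1 (x, n) (y, 1) \<pi>}"
  proof (intro equalityI subsetI)
    fix \<pi> assume "\<pi> \<in> {\<pi>. is_path (x, n) (y, 1) \<pi>}"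
    then show "\<pi> \<in> (\<lambda>\<pi>. \<pi> 1) ` {\<pi>. disjoint_paths 1 (x, n) (y, 1) \<pi>}"
      by (intro image_eqI[of _ _ "\<lambda>_. \<pi>"]) (auto simp: disjoint_paths_def)
  qed (auto simp: disjoint_paths_def)
  then show ?thesis by (simp add: lpp_def multi_lpp_def image_image)
qed

section \<open>Fixed points in terms of Busemann functions\<close>

lemma busemann_eq_bottom_imp_fixed:
  assumes F: "line_ensemble n F"
    and b: "\<And>k u. k \<le> n \<Longrightarrow> spt 0 0 \<le> u \<Longrightarrow> busemann n F k u = (\<Sum>i<k. F (Suc (n - k + i)) u)"
  shows "limit_melon n F = F"
proof (intro ext)
  fix j u
  show "limit_melon n F j u = F j u"
  proof (cases "j \<in> {1..n} \<and> spt 0 0 \<le> u")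
    case True
    define m where "m = n - j"
    have m: "n + 1 - j = Suc m" "n - j = m" "Suc (n - Suc m) = j" "Suc m \<le> n" using True by (auto simp: m_def)
    have "(\<Sum>i<Suc m. F (Suc (n - Suc m + i)) u) = F j u + (\<Sum>i<m. F (Suc (n - m + i)) u)"
      unfolding sum.lessThan_Suc_shift using m
      by (auto intro!: sum.cong simp: Suc_diff_Suc add_ac)
    moreover have "limit_melon n F j u = busemann n F (Suc m) u - busemann n F m u"
      unfolding limit_melon_def m(1,2) using True by (simp only: if_True simp_thms)
    ultimately show ?thesis using b[of "Suc m" u] b[of m u] True m(4) by simp
  next
    case False
    then have "j \<notin> {1..n} \<or> u \<le> spt 0 0" by (meson linear)
    then have "F j u = 0" using line_ensembleD(2,3)[OF F] by metis
    then show ?thesis using False unfolding limit_melon_def by (simp only: if_False)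
  qed
qed

lemma fixed_imp_busemann_eq_bottom:
  assumes F: "line_ensemble n F" and fixed: "limit_melon n F = F" and "k \<le> n" "spt 0 0 \<le> u"
  shows "busemann n F k u = (\<Sum>i<k. F (Suc (n - k + i)) u)"
proof -
  have "busemann n F k u = (\<Sum>i<k. F (n - i) u)"
    using sum_limit_melon[OF F assms(3,4)] unfolding fixed by simp
  also have "\<dots> = (\<Sum>i<k. F (n - (k - Suc i)) u)"
    by (rule sum.nat_diff_reindex[symmetric])
  also have "\<dots> = (\<Sum>i<k. F (Suc (n - k + i)) u)"
  proof (intro sum.cong refl)
    fix i assume "i \<in> {..<k}"
    then have "n - (k - Suc i) = Suc (n - k + i)" using \<open>k \<le> n\<close> by auto
    then show "F (n - (k - Suc i)) u = F (Suc (n - k + i)) u" by simp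
  qed
  finally show ?thesis .
qed

section \<open>The image\<close>

text \<open>An optimizer that stays on the \<open>k\<close> lowest lines beyond \<open>u\<close> can
  be cut at \<open>u\<close>: it is an array from \<open>u\<close> with these lines prepended. This
  bounds the increment from above by the bottom sum, which is always a lower bound.\<close>

lemma Dn_down_minus_busemann:
  assumes g: "g \<in> Dn_down_minus n" and k: "k \<le> n" and u: "spt 0 0 \<le> u"
  defines "G \<equiv> unfold_jumps n g"
  shows "busemann n G k u = (\<Sum>i<k. G (Suc (n - k + i)) u)"
proof -
  have gD: "g \<in> Dn n" using g by (simp add: Dn_down_minus_def)
  have G: "line_ensemble n G" unfolding G_def by (rule line_ensemble_unfold_jumps[OF gD])
  have gG: "g = sample G" unfolding G_def using sample_unfold_jumps[OF gD] by simp
  show ?thesis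
  proof (cases "k = 0")
    case True
    then show ?thesis using sum_limit_melon[OF G _ u, of 0] by simp
  next
    case False
    then have k': "k \<in> {1..n}" "1 \<le> k" using k by auto
    have "\<exists>(t :: nat \<Rightarrow> real) \<pi>. filterlim t at_top sequentially \<and> (\<forall>m. optimizer n g k (t m) (\<pi> m)) \<and>
       (\<forall>T>0. \<forall>\<^sub>F m in sequentially. \<forall>i\<in>{1..k}. {0..T} \<times> {n - k + i} \<subseteq> \<pi> m i)"
      using g k'(1) unfolding Dn_down_minus_def by blast
    then obtain t :: "nat \<Rightarrow> real" and \<pi> where t: "filterlim t at_top sequentially"
      and opt: "\<And>m. optimizer n g k (t m) (\<pi> m)"
      and loc: "\<And>T. 0 < T \<Longrightarrow> \<forall>\<^sub>F m in sequentially. \<forall>i\<in>{1..k}. {0..T} \<times> {n - k + i} \<subseteq> \<pi> m i"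
      by auto
    \<comment> \<open>The strict inequality between base times makes late entries lie after
      \<open>u\<close> whatever their phases are.\<close>
    define T where "T = base u + 1"
    have T: "0 < T" "base u < T" using u by (auto simp: T_def)
    have "\<forall>\<^sub>F m in sequentially. (\<forall>i\<in>{1..k}. {0..T} \<times> {n - k + i} \<subseteq> \<pi> m i) \<and> T \<le> t m"
      using loc[OF T(1)] t by (intro eventually_conj) (auto simp: filterlim_at_top)
    from eventually_happens'[OF sequentially_bot this]
    obtain m where m: "\<forall>i\<in>{1..k}. {0..T} \<times> {n - k + i} \<subseteq> \<pi> m i" "T \<le> t m"
      by (elim exE conjE) (rule that)
    define y where "y = t m"
    have y: "0 \<le> y" "base u \<le> y" using m(2) T by (auto simp: y_def)
    have mt: "matches n g G 0 y" unfolding gG by (rule matches_sample[OF G])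
    obtain A where A: "A \<in> path_arrays k n (spt 0 0) (spt y 1)"
      "weight G k n A = array_lpp G k n (spt 0 0) (spt y 1)"
      "\<And>i j. i < k \<Longrightarrow> j \<le> n - k + i \<Longrightarrow> T \<le> base (A i j)"
      by (rule array_of_optimizer[OF G mt k'(2) k y(1) opt[of m, folded y_def] T(1) bspec[OF m(1)]],
          assumption, (rule that; assumption))
    define B where "B = (\<lambda>i j. max (A i j) u)"
    have uy: "u \<le> spt y 1" using y by simp
    have B: "B \<in> path_arrays k n u (spt y 1)"
      unfolding path_arrays_def mem_Collect_eq B_def
    proof (intro allI impI conjI)
      fix i assume "i < k"
      then show "max (A i n) u = u" "max (A i 0) u = spt y 1"
        using path_arraysD(1,2)[OF A(1)] u uy by (simp_all add: max_absorb1 max_absorb2)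
    qed (auto intro!: max.mono path_arraysD(3,4)[OF A(1)] simp del: max.bounded_iff)
    have "weight G k n A = weight G k n (\<lambda>i j. if n - k + i < j then spt 0 0 else B i j)"
    proof (rule weight_cong)
      fix i j assume ij: "i < k" "j \<le> n"
      show "A i j = (if n - k + i < j then spt 0 0 else B i j)"
      proof (cases "n - k + i < j")
        case True
        then show ?thesis using path_arrays_bottom[OF A(1) ij(1) _ ij(2)] k by simp
      next
        case False
        then have "u \<le> A i j" using A(3)[of i j] ij T by (simp add: less_eq_split_real_def)
        then show ?thesis using False by (simp add: B_def max_absorb1)
      qed
    qed auto
    also have "\<dots> = weight G k n B + (\<Sum>i<k. G (Suc (n - k + i)) u)"
      using weight_prepend(2)[OF B k u, of G] line_ensembleD(2)[OF G, of "spt 0 0"] by simp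
    finally have "array_lpp G k n (spt 0 0) (spt y 1) \<le> array_lpp G k n u (spt y 1) + (\<Sum>i<k. G (Suc (n - k + i)) u)"
      using array_lpp_upper[OF ensemble_cont[OF G] k uy B] A(2) by simp
    then have "lpp_increment n G k y u \<le> (\<Sum>i<k. G (Suc (n - k + i)) u)" by (simp add: lpp_increment_def)
    then have "busemann n G k u \<le> (\<Sum>i<k. G (Suc (n - k + i)) u)"
      using busemann_le[OF G k u y(2)] by simp
    moreover have "(\<Sum>i<k. G (Suc (n - k + i)) u) \<le> busemann n G k u"
    proof (rule tendsto_lowerbound[OF tendsto_busemann[OF G k u]])
      show "eventually (\<lambda>t. (\<Sum>i<k. G (Suc (n - k + i)) u) \<le> lpp_increment n G k t u) at_top"
        using eventually_ge_at_top[of "base u"] by (rule eventually_mono) (rule lpp_increment_lower[OF G k u])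
    qed simp
    ultimately show ?thesis by simp
  qed
qed

text \<open>The bound is uniform in \<open>t\<close> and so survives the limit. It needs closeness
  at all times, since the Busemann function looks arbitrarily far ahead; this fits the closure in
  \<open>Dn_down\<close>.\<close>

lemma busemann_perturb:
  assumes F: "line_ensemble n F" and G: "line_ensemble n G" and k: "k \<le> n" and u: "spt 0 0 \<le> u"
    and d: "\<And>j w. \<bar>F j w - G j w\<bar> \<le> d"
  shows "\<bar>busemann n F k u - busemann n G k u\<bar> \<le> 2 * (real k * (real n * (2 * d)))"
proof (rule tendsto_upperbound)
  show "((\<lambda>t. \<bar>lpp_increment n F k t u - lpp_increment n G k t u\<bar>) \<longlongrightarrow> \<bar>busemann n F k u - busemann n G k u\<bar>) at_top"
    by (intro tendsto_intros tendsto_busemann F G k u)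
  show "eventually (\<lambda>t. \<bar>lpp_increment n F k t u - lpp_increment n G k t u\<bar> \<le> 2 * (real k * (real n * (2 * d)))) at_top"
    using eventually_ge_at_top[of "base u"]
  proof (rule eventually_mono)
    fix t assume "base u \<le> t"
    then have "u \<le> spt t 1" "spt 0 0 \<le> spt t 1" using u by auto
    then show "\<bar>lpp_increment n F k t u - lpp_increment n G k t u\<bar> \<le> 2 * (real k * (real n * (2 * d)))"
      using array_lpp_perturb[OF ensemble_cont[OF F] ensemble_cont[OF G] k _ d, of u "spt t 1"]
        array_lpp_perturb[OF ensemble_cont[OF F] ensemble_cont[OF G] k _ d, of "spt 0 0" "spt t 1"]
      unfolding lpp_increment_def by linarith
  qed
qed simp

lemma M_fixes_Dn_down:
  assumes g: "g \<in> Dn_down n"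
  shows "M n g = g"
proof -
  have gD: "g \<in> Dn n" using g by (simp add: Dn_down_def)
  define G where "G = unfold_jumps n g"
  have G: "line_ensemble n G" unfolding G_def by (rule line_ensemble_unfold_jumps[OF gD])
  have gG: "g = sample G" unfolding G_def using sample_unfold_jumps[OF gD] by simp
  have "busemann n G k u = (\<Sum>i<k. G (Suc (n - k + i)) u)" if k: "k \<le> n" and u: "spt 0 0 \<le> u" for k u
  proof -
    \<comment> \<open>The first term is the perturbation constant of the Busemann function, the
      second that of the sum of \<open>k\<close> lines.\<close>
    define c where "c = 2 * (real k * (real n * 2)) + real k"
    have c: "0 \<le> c" by (simp add: c_def)
    have "\<bar>busemann n G k u - (\<Sum>i<k. G (Suc (n - k + i)) u)\<bar> \<le> c * e" if e: "0 < e" for e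
    proof -
      obtain h where h: "h \<in> Dn_down_minus n" "\<And>i x. i \<in> {1..n} \<Longrightarrow> 0 \<le> x \<Longrightarrow> \<bar>g i x - h i x\<bar> < e"
        using g e unfolding Dn_down_def by blast
      have hD: "h \<in> Dn n" using h(1) by (simp add: Dn_down_minus_def)
      define H where "H = unfold_jumps n h"
      have H: "line_ensemble n H" unfolding H_def by (rule line_ensemble_unfold_jumps[OF hD])
      have d: "\<bar>G j w - H j w\<bar> \<le> e" for j w
      proof (cases "j \<in> {1..n}")
        case True
        show ?thesis unfolding G_def H_def
          by (rule unfold_jumps_close[OF gD hD less_imp_le[OF h(2)[OF True]]])
      next
        case False
        then show ?thesis using line_ensembleD(3)[OF G False] line_ensembleD(3)[OF H False] e by simp
      qed
      have "\<bar>(\<Sum>i<k. H (Suc (n - k + i)) u) - (\<Sum>i<k. G (Suc (n - k + i)) u)\<bar> \<le> (\<Sum>i<k. e)"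
        unfolding sum_subtractf[symmetric]
        by (rule order.trans[OF sum_abs sum_mono]) (use d in \<open>simp add: abs_minus_commute\<close>)
      moreover have "busemann n H k u = (\<Sum>i<k. H (Suc (n - k + i)) u)"
        unfolding H_def by (rule Dn_down_minus_busemann[OF h(1) k u])
      moreover have "\<bar>busemann n G k u - busemann n H k u\<bar> \<le> 2 * (real k * (real n * (2 * e)))"
        by (rule busemann_perturb[OF G H k u d])
      ultimately have "\<bar>busemann n G k u - (\<Sum>i<k. G (Suc (n - k + i)) u)\<bar> \<le> 2 * (real k * (real n * (2 * e))) + real k * e"
        by simp
      then show ?thesis by (simp add: c_def algebra_simps)
    qed
    then have "\<bar>busemann n G k u - (\<Sum>i<k. G (Suc (n - k + i)) u)\<bar> \<le> 0 + e" if "0 < e" for e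
    proof -
      have "c * (e / (c + 1)) \<le> e" using c that by (simp add: field_simps)
      moreover have "0 < e / (c + 1)" using c that by simp
      ultimately show ?thesis
        using \<open>\<And>e. 0 < e \<Longrightarrow> \<bar>busemann n G k u - (\<Sum>i<k. G (Suc (n - k + i)) u)\<bar> \<le> c * e\<close>[of "e / (c + 1)"]
        by linarith
    qed
    then have "\<bar>busemann n G k u - (\<Sum>i<k. G (Suc (n - k + i)) u)\<bar> \<le> 0" by (rule field_le_epsilon)
    then show ?thesis by simp
  qed
  then have "limit_melon n G = G" by (rule busemann_eq_bottom_imp_fixed[OF G])
  then show ?thesis using M_sample[OF G] gG by simp
qed

section \<open>Tilting in favour of late jumps\<close>

lemma continuous_on_base: "continuous_on UNIV base"
proof (rule continuous_on_nhds_splitI)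
  fix u and e :: real assume e: "0 < e"
  show "\<exists>a<u. \<forall>w. a < w \<longrightarrow> w \<le> u \<longrightarrow> \<bar>base w - base u\<bar> < e"
    using e by (intro exI[of _ "spt (base u - e) 1"]) (auto dest: base_mono)
  show "\<exists>b>u. \<forall>w. u \<le> w \<longrightarrow> w < b \<longrightarrow> \<bar>base w - base u\<bar> < e"
    using e by (intro exI[of _ "spt (base u + e) 0"]) (auto dest: base_mono)
qed

text \<open>Strictly increasing in positive time, so that every delay counts, yet bounded, so that a
  small multiple is uniformly small. It is constant on fibres and leaves the ramps alone.\<close>

definition tilt :: "split_real \<Rightarrow> real" where
  "tilt u = 1 - exp (- max 0 (base u))"

lemma tilt_bounds: "0 \<le> tilt u" "tilt u \<le> 1"
  by (auto simp: tilt_def)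

lemma tilt_mono: "base u \<le> base v \<Longrightarrow> tilt u \<le> tilt v"
  by (auto simp: tilt_def)

lemma tilt_0: "tilt (spt 0 0) = 0"
  by (simp add: tilt_def)

text \<open>The factor \<open>real j\<close> makes each line gain exactly one unit of
  \<open>e * tilt u\<close> over the line above it.\<close>

definition tilted :: "nat \<Rightarrow> real \<Rightarrow> (nat \<Rightarrow> split_real \<Rightarrow> real) \<Rightarrow> nat \<Rightarrow> split_real \<Rightarrow> real" where
  "tilted n e F j u = F j u + (if j \<in> {1..n} then e * (real j * tilt u) else 0)"

lemma line_ensemble_tilted:
  assumes F: "line_ensemble n F" and "0 \<le> e"
  shows "line_ensemble n (tilted n e F)"
proof -
  note D = line_ensembleD[OF F]
  have ct: "continuous_on UNIV tilt"
    unfolding tilt_def by (intro continuous_intros continuous_on_base)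
  have cont: "continuous_on UNIV (tilted n e F j)" for j
    unfolding tilted_def[abs_def] by (cases "j \<in> {1..n}") (auto intro!: continuous_intros D(1) ct)
  have zero: "tilted n e F j u = 0" if "u \<le> spt 0 0" for j u
    using D(2)[OF that] base_mono[OF that] by (simp add: tilted_def tilt_def)
  have out: "tilted n e F j u = 0" if "j \<notin> {1..n}" for j u
    using D(3)[OF that] by (simp only: tilted_def that if_False add_0_right)
  have tc: "tilt u = tilt v" if "base u = base v" for u v using that by (simp add: tilt_def)
  have mono: "tilted n e F j u \<le> tilted n e F j v" if "base u = base v" "u \<le> v" for j u v
    using D(4)[OF that] tc[OF that(1)] by (simp add: tilted_def)
  have seq: "tilted n e F i u = tilted n e F i (spt (base u) 0) \<or> tilted n e F j u = tilted n e F j (spt (base u) 1)"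
    if "i < j" for i j u
    using D(5)[OF that, of u] tc[of u "spt (base u) 0"] tc[of u "spt (base u) 1"] by (auto simp: tilted_def)
  show ?thesis unfolding line_ensemble_def
    by (intro conjI allI impI, rule cont, erule zero, erule out, erule (1) mono, erule seq)
qed

lemma sum_linear_weights:
  fixes a :: "nat \<Rightarrow> real"
  shows "(\<Sum>j<n. real (Suc j) * (a j - a (Suc j))) = (\<Sum>j<n. a j) - real n * a n"
  by (induction n) (simp_all add: algebra_simps)

text \<open>Summation by parts turns the coefficients \<open>Suc j\<close> into 1, and the boundary
  term at the start disappears because \<open>tilt\<close> is 0 there. Every single entry is thus
  rewarded for its own time.\<close>

lemma weight_tilted:
  assumes "A \<in> path_arrays k n (spt 0 0) v"
  shows "weight (tilted n e F) k n A = weight F k n A + e * (\<Sum>i<k. \<Sum>j<n. tilt (A i j))"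
proof -
  have "(\<Sum>j<n. tilted n e F (Suc j) (A i j) - tilted n e F (Suc j) (A i (Suc j))) =
      (\<Sum>j<n. F (Suc j) (A i j) - F (Suc j) (A i (Suc j))) + e * (\<Sum>j<n. tilt (A i j))" if i: "i < k" for i
  proof -
    have "(\<Sum>j<n. tilted n e F (Suc j) (A i j) - tilted n e F (Suc j) (A i (Suc j))) =
      (\<Sum>j<n. (F (Suc j) (A i j) - F (Suc j) (A i (Suc j))) + e * (real (Suc j) * (tilt (A i j) - tilt (A i (Suc j)))))"
      by (intro sum.cong) (auto simp: tilted_def algebra_simps)
    also have "\<dots> = (\<Sum>j<n. F (Suc j) (A i j) - F (Suc j) (A i (Suc j))) +
        e * (\<Sum>j<n. real (Suc j) * (tilt (A i j) - tilt (A i (Suc j))))"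
      by (simp only: sum.distrib sum_distrib_left)
    also have "(\<Sum>j<n. real (Suc j) * (tilt (A i j) - tilt (A i (Suc j)))) = (\<Sum>j<n. tilt (A i j))"
      using sum_linear_weights[of "\<lambda>j. tilt (A i j)" n] path_arraysD(1)[OF assms i] tilt_0 by simp
    finally show ?thesis .
  qed
  then have "weight (tilted n e F) k n A = (\<Sum>i<k. (\<Sum>j<n. F (Suc j) (A i j) - F (Suc j) (A i (Suc j))) +
      e * (\<Sum>j<n. tilt (A i j)))"
    unfolding weight_def by (intro sum.cong refl) simp
  also have "\<dots> = weight F k n A + e * (\<Sum>i<k. \<Sum>j<n. tilt (A i j))"
    by (simp only: weight_def sum.distrib sum_distrib_left)
  finally show ?thesis .
qed

text \<open>For a fixed point \<open>H\<close> of the limit, following the \<open>k\<close> lowest lines up to a time beyond \<open>T\<close>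
  costs little in a long optimal array. The tilt rewards late jumps, so it turns this into a strict
  gain: replacing an array by its pointwise maximum with an array that starts late improves it.\<close>

lemma tilted_optimal_arrays:
  assumes H: "line_ensemble n H" and fixed: "limit_melon n H = H" and e: "0 < e" and k: "k \<le> n"
    and T: "0 < T"
  shows "eventually (\<lambda>t. \<forall>A. A \<in> path_arrays k n (spt 0 0) (spt t 1) \<longrightarrow>
    weight (tilted n e H) k n A = array_lpp (tilted n e H) k n (spt 0 0) (spt t 1) \<longrightarrow>
    (\<forall>i j. i < k \<longrightarrow> j \<le> n - k + i \<longrightarrow> T \<le> base (A i j))) at_top"
proof -
  let ?G = "tilted n e H"
  have G: "line_ensemble n ?G" using line_ensemble_tilted[OF H] e by simp
  define u where "u = spt (T + 1) 1"
  have u: "spt 0 0 \<le> u" using T by (simp add: u_def)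
  define b where "b = (\<Sum>i<k. H (Suc (n - k + i)) u)"
  \<comment> \<open>The least gain in \<open>tilt\<close> when an entry before \<open>T\<close> is
    moved to \<open>T + 1\<close> or later. The loss in untilted weight is kept below
    \<open>e * c\<close>.\<close>
  define c where "c = tilt (spt (T + 1) 1) - tilt (spt T 1)"
  have c: "0 < c" using T by (simp add: c_def tilt_def)
  have "((\<lambda>t. lpp_increment n H k t u) \<longlongrightarrow> b) at_top"
    using tendsto_busemann[OF H k u] fixed_imp_busemann_eq_bottom[OF H fixed k u] by (simp add: b_def)
  then have "eventually (\<lambda>t. lpp_increment n H k t u < b + e * c) at_top"
    by (rule order_tendstoD(2)) (use e c in simp)
  then show ?thesis
    using eventually_ge_at_top[of "T + 1"]
  proof eventually_elim
    case (elim t)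
    show ?case
    proof (intro allI impI, rule ccontr)
      fix A i0 j0
      assume A: "A \<in> path_arrays k n (spt 0 0) (spt t 1)"
        and opt: "weight ?G k n A = array_lpp ?G k n (spt 0 0) (spt t 1)"
        and ij: "i0 < k" "j0 \<le> n - k + i0" and early: "\<not> T \<le> base (A i0 j0)"
      have ut: "u \<le> spt t 1" "spt 0 0 \<le> spt t 1" using elim T by (auto simp: u_def)
      obtain R where R: "R \<in> path_arrays k n u (spt t 1)" "weight H k n R = array_lpp H k n u (spt t 1)"
        by (rule array_lpp_attained[OF ensemble_cont[OF H] k ut(1)])
      \<comment> \<open>The minimum of the two arrays still competes from time 0, so by modularity
        \<open>X\<close> loses at most the increment from 0 to \<open>u\<close> against
        \<open>A\<close>; prepending the lowest lines recovers this up to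
        \<open>e * c\<close>.\<close>
      define X where "X = (\<lambda>i j. max (A i j) (R i j))"
      define Y where "Y = (\<lambda>i j. if n - k + i < j then spt 0 0 else X i j)"
      have X: "X \<in> path_arrays k n u (spt t 1)"
        using path_arrays_max[OF A R(1)] u by (simp add: X_def max_absorb2)
      have mn: "(\<lambda>i j. min (A i j) (R i j)) \<in> path_arrays k n (spt 0 0) (spt t 1)"
        using path_arrays_min[OF A R(1)] u by (simp add: min_absorb1)
      note Y = weight_prepend[OF X k u, folded Y_def]
      have "weight H k n (\<lambda>i j. min (A i j) (R i j)) \<le> array_lpp H k n (spt 0 0) (spt t 1)"
        by (rule array_lpp_upper[OF ensemble_cont[OF H] k ut(2) mn])
      then have HX: "weight H k n A + array_lpp H k n u (spt t 1) - array_lpp H k n (spt 0 0) (spt t 1) \<le> weight H k n X"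
        using weight_min_max[of H k n A R] R(2) by (simp add: X_def)
      have "weight H k n Y = weight H k n X + b"
        using Y(2)[of H] line_ensembleD(2)[OF H, of "spt 0 0"] by (simp add: b_def)
      then have HY: "weight H k n A - e * c < weight H k n Y"
        using HX elim(1) by (simp add: lpp_increment_def)
      have le: "tilt (A i j) \<le> tilt (Y i j)" if "i < k" "j < n" for i j
      proof (cases "n - k + i < j")
        case True
        then show ?thesis using path_arrays_bottom[OF A, of i j] that k by (simp add: Y_def)
      next
        case False
        then show ?thesis by (auto simp: Y_def X_def intro!: tilt_mono base_mono)
      qed
      have j0: "j0 < n" using ij k by linarith
      have gain: "tilt (A i0 j0) + c \<le> tilt (Y i0 j0)"
      proof -
        have "u \<le> X i0 j0" using path_arrays_bounds(1)[OF X ij(1)] j0 by simp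
        then have "tilt (spt (T + 1) 1) \<le> tilt (Y i0 j0)"
          using ij by (intro tilt_mono) (auto simp: Y_def u_def dest: base_mono)
        moreover have "tilt (A i0 j0) \<le> tilt (spt T 1)" using early by (intro tilt_mono) simp
        ultimately show ?thesis by (simp add: c_def)
      qed
      have "(\<Sum>i<k. \<Sum>j<n. tilt (A i j)) + c \<le> (\<Sum>i<k. \<Sum>j<n. tilt (Y i j))"
      proof -
        have "(\<Sum>i<k. \<Sum>j<n. tilt (A i j)) + c =
            (\<Sum>i<k. \<Sum>j<n. tilt (A i j) + (if j = j0 then if i = i0 then c else 0 else 0))"
          using ij(1) j0 by (simp add: sum.distrib)
        also have "\<dots> \<le> (\<Sum>i<k. \<Sum>j<n. tilt (Y i j))"
          by (intro sum_mono) (use le gain in auto)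
        finally show ?thesis .
      qed
      then have "e * (\<Sum>i<k. \<Sum>j<n. tilt (A i j)) + e * c \<le> e * (\<Sum>i<k. \<Sum>j<n. tilt (Y i j))"
        using e by (simp add: mult_left_mono flip: distrib_left)
      then have "weight ?G k n A < weight ?G k n Y"
        unfolding weight_tilted[OF A] weight_tilted[OF Y(1)] using HY by simp
      also have "\<dots> \<le> array_lpp ?G k n (spt 0 0) (spt t 1)"
        by (rule array_lpp_upper[OF ensemble_cont[OF G] k ut(2) Y(1)])
      finally show False using opt by simp
    qed
  qed
qed

lemma tilted_in_Dn_down_minus:
  assumes H: "line_ensemble n H" and fixed: "limit_melon n H = H" and e: "0 < e"
  shows "sample (tilted n e H) \<in> Dn_down_minus n"
proof -
  let ?G = "tilted n e H"
  have G: "line_ensemble n ?G" using line_ensemble_tilted[OF H] e by simp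
  have "\<exists>(t :: nat \<Rightarrow> real) \<pi>. filterlim t at_top sequentially \<and> (\<forall>m. optimizer n (sample ?G) k (t m) (\<pi> m)) \<and>
       (\<forall>T>0. \<forall>\<^sub>F m in sequentially. \<forall>i\<in>{1..k}. {0..T} \<times> {n - k + i} \<subseteq> \<pi> m i)"
    if "k \<in> {1..n}" for k
  proof -
    have k: "1 \<le> k" "k \<le> n" using that by auto
    \<comment> \<open>\<open>Suc m\<close> instead of \<open>m\<close> provides the positive time
      bound that is needed for \<open>m = 0\<close>.\<close>
    define late where "late m A \<longleftrightarrow> (\<forall>i j. i < k \<longrightarrow> j \<le> n - k + i \<longrightarrow> real (Suc m) \<le> base (A i j))" for m A
    define Q where "Q m t A \<longleftrightarrow> real m \<le> t \<and> A \<in> path_arrays k n (spt 0 0) (spt t 1) \<and>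
      weight ?G k n A = array_lpp ?G k n (spt 0 0) (spt t 1) \<and> late m A" for m t A
    have ex: "\<exists>t A. Q m t A" for m
    proof -
      have "eventually (\<lambda>t. (\<forall>A. A \<in> path_arrays k n (spt 0 0) (spt t 1) \<longrightarrow>
        weight ?G k n A = array_lpp ?G k n (spt 0 0) (spt t 1) \<longrightarrow> late m A) \<and> real m \<le> t) at_top"
        unfolding late_def
        by (intro eventually_conj tilted_optimal_arrays[OF H fixed e k(2)] eventually_ge_at_top) simp
      from eventually_happens'[OF trivial_limit_at_top_linorder this]
      obtain t where t: "\<forall>A. A \<in> path_arrays k n (spt 0 0) (spt t 1) \<longrightarrow>
        weight ?G k n A = array_lpp ?G k n (spt 0 0) (spt t 1) \<longrightarrow> late m A" "real m \<le> t"
        by (elim exE conjE) (rule that)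
      have "spt 0 0 \<le> spt t 1" using t(2) by (simp add: order.trans[OF of_nat_0_le_iff])
      then obtain A where "A \<in> path_arrays k n (spt 0 0) (spt t 1)"
        "weight ?G k n A = array_lpp ?G k n (spt 0 0) (spt t 1)"
        by (rule array_lpp_attained[OF ensemble_cont[OF G] k(2)])
      then show ?thesis using t by (intro exI[of _ t] exI[of _ A]) (simp add: Q_def)
    qed
    then have "\<exists>t A. \<forall>m. Q m (t m) (A m)" by metis
    then obtain t A where "\<And>m. Q m (t m) (A m)" by blast
    then have tA: "\<And>m. real m \<le> t m" "\<And>m. A m \<in> path_arrays k n (spt 0 0) (spt (t m) 1)"
      "\<And>m. weight ?G k n (A m) = array_lpp ?G k n (spt 0 0) (spt (t m) 1)"
      "\<And>m i j. i < k \<Longrightarrow> j \<le> n - k + i \<Longrightarrow> real (Suc m) \<le> base (A m i j)"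
      unfolding Q_def late_def by blast+
    define \<pi> where "\<pi> m = (\<lambda>i. array_path n (\<lambda>i j. base (A m i j)) (i - 1))" for m
    have "filterlim t at_top sequentially"
      by (rule filterlim_at_top_mono[OF filterlim_real_sequentially]) (use tA(1) in simp)
    moreover have "optimizer n (sample ?G) k (t m) (\<pi> m)" for m
      unfolding \<pi>_def
      by (rule optimizer_of_array[OF G matches_sample[OF G] k _ tA(2,3)])
        (use tA(1)[of m] in \<open>simp add: order.trans[OF of_nat_0_le_iff]\<close>)
    moreover have "\<forall>\<^sub>F m in sequentially. \<forall>i\<in>{1..k}. {0..T} \<times> {n - k + i} \<subseteq> \<pi> m i" if "0 < T" for T :: real
    proof -
      have "\<forall>\<^sub>F m in sequentially. T \<le> real m"
        using filterlim_real_sequentially by (auto simp: filterlim_at_top)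
      then show ?thesis
      proof (rule eventually_mono)
        fix m assume m: "T \<le> real m"
        show "\<forall>i\<in>{1..k}. {0..T} \<times> {n - k + i} \<subseteq> \<pi> m i"
        proof (intro ballI subsetI)
          fix i p assume i: "i \<in> {1..k}" and p: "p \<in> {0..T} \<times> {n - k + i}"
          define i' where "i' = i - 1"
          have i': "i = Suc i'" "i' < k" using i by (auto simp: i'_def)
          have "base (A m i' (Suc (n - k + i'))) = 0"
            using path_arrays_bottom[OF tA(2) i'(2), of "Suc (n - k + i')" m] k i'(2) by simp
          moreover have "T \<le> base (A m i' (n - k + i'))" using tA(4)[OF i'(2), of "n - k + i'" m] m by simp
          ultimately have "(fst p, snd p) \<in> \<pi> m i"
            unfolding \<pi>_def mem_array_path using p i' k by (intro exI[of _ "n - k + i'"]) auto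
          then show "p \<in> \<pi> m i" by simp
        qed
      qed
    qed
    ultimately show ?thesis by blast
  qed
  then show ?thesis using sample_in_Dn[OF G] unfolding Dn_down_minus_def by blast
qed

lemma fixed_in_Dn_down:
  assumes H: "line_ensemble n H" and fixed: "limit_melon n H = H"
  shows "sample H \<in> Dn_down n"
proof -
  have "\<exists>g\<in>Dn_down_minus n. \<forall>i\<in>{1..n}. \<forall>x\<ge>0. \<bar>sample H i x - g i x\<bar> < e" if e: "0 < e" for e
  proof -
    \<comment> \<open>The tilt moves each line by at most \<open>d * n\<close>, which is strictly
      below \<open>e\<close>.\<close>
    define d where "d = e / (real n + 1)"
    have d: "0 < d" "d * (real n + 1) = e" using e by (auto simp: d_def)
    have "\<bar>sample H i x - sample (tilted n d H) i x\<bar> < e" if i: "i \<in> {1..n}" for i x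
    proof -
      have "real i * tilt (spt x 1) \<le> real n * 1"
        using i tilt_bounds by (intro mult_mono) auto
      then have "d * (real i * tilt (spt x 1)) \<le> d * real n" using d by simp
      also have "\<dots> < e" using d by (simp add: algebra_simps)
      finally have "d * (real i * tilt (spt x 1)) < e" .
      moreover have "0 \<le> d * (real i * tilt (spt x 1))" using d tilt_bounds(1) by simp
      ultimately show ?thesis using i by (simp add: sample_def tilted_def)
    qed
    then show ?thesis using tilted_in_Dn_down_minus[OF H fixed d(1)] by blast
  qed
  then show ?thesis using sample_in_Dn[OF H] unfolding Dn_down_def by blast
qed

section \<open>The main theorem\<close>

theorem theorem1p2:
  fixes n :: nat
  assumes "1 \<le> n"
  shows
    "(\<forall>f\<in>Dn n. M n f \<in> Dn n \<and>
        (\<forall>K. compact K \<and> K \<subseteq> {0..} \<longrightarrow>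
          (\<forall>i\<in>{1..n}. uniform_limit K (\<lambda>t. M_approx n f t i) (M n f i) at_top)))
   \<and> (\<forall>f\<in>Dn n. \<forall>x y. 0 \<le> x \<and> x \<le> y \<longrightarrow> lpp f (x, n) (y, 1) = lpp (M n f) (x, n) (y, 1))
   \<and> (\<forall>f\<in>Dn n. M n (M n f) = M n f)
   \<and> M n ` Dn n = Dn_down n
   \<and> bij_betw (M n) (Dn_up n) (Dn_down n)
   \<and> (\<forall>f\<in>Dn_up n. W n (M n f) = f)
   \<and> (\<forall>g\<in>Dn_down n. W n g \<in> Dn_up n \<and> M n (W n g) = g)"
proof -
  note le = line_ensemble_unfold_jumps and lim = line_ensemble_limit_melon[OF line_ensemble_unfold_jumps]
  have f_eq: "f = sample (unfold_jumps n f)" if "f \<in> Dn n" for f using sample_unfold_jumps[OF that] by simp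
  have M_eq: "M n f = sample (limit_melon n (unfold_jumps n f))" if "f \<in> Dn n" for f
    using M_sample[OF le[OF that]] f_eq[OF that] by simp
  have M_Dn: "M n f \<in> Dn n" if "f \<in> Dn n" for f
    unfolding M_eq[OF that] by (rule sample_in_Dn[OF lim[OF that]])
  have unif: "uniform_limit K (\<lambda>t. M_approx n f t i) (M n f i) at_top"
    if "f \<in> Dn n" "compact K" "K \<subseteq> {0..}" "i \<in> {1..n}" for f K i
    using uniform_limit_M[OF le[OF that(1)] that(2-4)] f_eq[OF that(1)] by simp
  have iso: "lpp f (x, n) (y, 1) = lpp (M n f) (x, n) (y, 1)" if f: "f \<in> Dn n" and xy: "0 \<le> x" "x \<le> y" for f x y
  proof -
    have "multi_lpp f 1 (x, n) (y, 1) = array_lpp (unfold_jumps n f) 1 n (spt x 0) (spt y 1)"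
      using multi_lpp_sample[OF le[OF f] assms xy] f_eq[OF f] by simp
    moreover have "multi_lpp (M n f) 1 (x, n) (y, 1) = array_lpp (limit_melon n (unfold_jumps n f)) 1 n (spt x 0) (spt y 1)"
      using multi_lpp_sample[OF lim[OF f] assms xy] M_eq[OF f] by simp
    ultimately show ?thesis
      using array_lpp_limit_melon[OF le[OF f] _ _ assms, of "spt x 0" "spt y 1"] xy
      unfolding lpp_eq_multi_lpp[OF assms] by simp
  qed
  have idem: "M n (M n f) = M n f" if f: "f \<in> Dn n" for f
    unfolding M_eq[OF f] M_sample[OF lim[OF f]] limit_melon_idem[OF le[OF f]] ..
  have M_down: "M n f \<in> Dn_down n" if f: "f \<in> Dn n" for f
    unfolding M_eq[OF f] by (rule fixed_in_Dn_down[OF lim[OF f] limit_melon_idem[OF le[OF f]]])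
  have down_Dn: "g \<in> Dn n" if "g \<in> Dn_down n" for g using that by (simp add: Dn_down_def)
  have up_Dn: "f \<in> Dn n" if "f \<in> Dn_up n" for f using that by (simp add: Dn_up_def)
  have WM: "W n (M n f) = f" if f: "f \<in> Dn_up n" for f
  proof -
    let ?F = "unfold_jumps n f" and ?L = "limit_melon n (unfold_jumps n f)"
    note F = le[OF up_Dn[OF f]] and L = lim[OF up_Dn[OF f]]
    have "melon n ?L k v = ?F k v" for k v
    proof (cases "k \<in> {1..n} \<and> spt 0 0 \<le> v")
      case True
      \<comment> \<open>Both melons are read off from the same values from time 0, and the extension
        of \<open>f\<close> is sorted, hence its own melon.\<close>
      have "melon n ?L k v = melon n ?F k v"
        using melon_diff[OF L, of k v] melon_diff[OF F, of k v] array_lpp_limit_melon[OF F, of "spt 0 0" v] True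
        by auto
      then show ?thesis using melon_of_sorted[OF F unfold_jumps_sorted[OF f]] by simp
    next
      case False
      then have "k \<notin> {1..n} \<or> v \<le> spt 0 0" by (meson linear)
      then show ?thesis
        using line_ensembleD(2,3)[OF F] line_ensembleD(2,3)[OF line_ensemble_melon[OF L]] by metis
    qed
    then have "melon n ?L = ?F" by blast
    then show ?thesis using W_sample[OF L] M_eq[OF up_Dn[OF f]] f_eq[OF up_Dn[OF f]] by simp
  qed
  have W_up: "W n g \<in> Dn_up n" and MW: "M n (W n g) = g" if g: "g \<in> Dn_down n" for g
  proof -
    let ?G = "unfold_jumps n g"
    note G = le[OF down_Dn[OF g]]
    have W: "W n g = sample (melon n ?G)" using W_sample[OF G] f_eq[OF down_Dn[OF g]] by simp
    show "W n g \<in> Dn_up n" unfolding W by (rule sample_melon_in_Dn_up[OF G])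
    have "limit_melon n (melon n ?G) = limit_melon n ?G"
      by (rule limit_melon_cong) (rule array_lpp_melon[OF G])
    then have "M n (W n g) = M n g"
      unfolding W using M_sample[OF line_ensemble_melon[OF G]] M_eq[OF down_Dn[OF g]] by simp
    then show "M n (W n g) = g" using M_fixes_Dn_down[OF g] by simp
  qed
  have image: "M n ` Dn n = Dn_down n"
  proof (intro equalityI subsetI)
    fix g assume "g \<in> Dn_down n"
    \<comment> \<open>Each element of the image is a fixed point and so its own preimage.\<close>
    then show "g \<in> M n ` Dn n" using M_fixes_Dn_down down_Dn by (intro image_eqI[of _ _ g]) auto
  qed (use M_down in blast)
  have bij: "bij_betw (M n) (Dn_up n) (Dn_down n)"
  proof (rule bij_betw_byWitness[where f' = "W n"])
    show "\<forall>f\<in>Dn_up n. W n (M n f) = f" using WM by blast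
    show "\<forall>g\<in>Dn_down n. M n (W n g) = g" using MW by blast
    show "M n ` Dn_up n \<subseteq> Dn_down n" using M_down up_Dn by blast
    show "W n ` Dn_down n \<subseteq> Dn_up n" using W_up by blast
  qed
  show ?thesis
    by (intro conjI ballI allI impI, erule M_Dn, erule unif, erule conjunct1, erule conjunct2, assumption,
        erule iso, erule conjunct1, erule conjunct2, erule idem, rule image, rule bij, erule WM, erule W_up, erule MW)
qed

end
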